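(* For all $n,d\ge 0$, there is a one-to-one correspondence between rooted planar maps with $n$ edges and outer face degree $d$, and normal planar terms (NPTs) $[x]t$ whose $R$-coloring $\pi$ has $n+1$ uses of rule (s) and $d+1$ outer neutral handles (i.e. $|\mathrm{ONH}(\pi)| = d+1$).
   Context: Rooted planar maps: a planar map is a connected graph (loops and multiple edges allowed) embedded in the oriented sphere so that the complement of vertices and edges is a union of open disks (faces), up to orientation-preserving homeomorphism. A dart is an edge with one of its two orientations; the face to the left of a dart is incident to it. The degree of a face is the number of darts incident to it (an isthmus bordering a face is counted twice). A rooted planar map is a planar map with a chosen root dart, up to root-preserving homeomorphism; the vertex map (one vertex, no edges, one face) is rooted by default. The outer face is the face to the left of the root dart (the unique face for the vertex map, whose outer face degree is $0$). Lambda terms: lambda skeletons are graded sets $\mathrm{SLam}(i)$, least such that $\_ \in \mathrm{SLam}(1)$; $p\in\mathrm{SLam}(j), q\in\mathrm{SLam}(k)\Rightarrow p(q)\in\mathrm{SLam}(j+k)$; $p\in\mathrm{SLam}(i+1)\Rightarrow \lambda\_.p\in\mathrm{SLam}(i)$. A planar lambda term with ordered list of free variables $\Gamma$ decorating $p$, $[\Gamma]t\in\Lambda_1^0(p)$, is defined by: $[x]x\in\Lambda_1^0(\_)$; from $[\Gamma]t\in\Lambda_1^0(p)$, $[\Delta]u\in\Lambda_1^0(q)$ infer $[\Gamma,\Delta]t(u)\in\Lambda_1^0(p(q))$; from $[x,\Gamma]t\in\Lambda_1^0(p)$ infer $[\Gamma]\lambda x.t\in\Lambda_1^0(\lambda\_.p)$;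 terms modulo renaming of variables. $\mathrm{SNeu}(i)$ and $\mathrm{SNF}(i)$ are defined by rules (v) $\_\in\mathrm{SNeu}(1)$; (a) $p\in\mathrm{SNeu}(j)$, $q\in\mathrm{SNF}(k)\Rightarrow p(q)\in\mathrm{SNeu}(j+k)$; (s) $p\in\mathrm{SNeu}(i)\Rightarrow p\in\mathrm{SNF}(i)$; ($\ell$) $p\in\mathrm{SNF}(i+1)\Rightarrow\lambda\_.p\in\mathrm{SNF}(i)$. A $B$-/$R$-coloring of a term is a derivation of its skeleton in $\mathrm{SNeu}$/$\mathrm{SNF}$. An NPT is a planar term $[x]t$ with exactly one free variable that has an $R$-coloring. A neutral handle of a term is a decomposition of it as a context with one marked occurrence of a neutral subterm, written $C[\langle n\rangle]$. For a neutral or normal planar term with coloring $\pi$, the list $\mathrm{ONH}(\pi)$ of outer neutral handles is defined inductively: for rule (v) on $[x]x$, $\mathrm{ONH}=(\langle x\rangle)$; if $\pi$ ends with (a) deriving $[\Gamma,\Delta]t(u)$ from a $B$-coloring $\pi_1$ of $[\Gamma]t$ and an $R$-coloring $\pi_2$ of $[\Delta]u$, $\mathrm{ONH}(\pi)$ consists of $\langle t(u)\rangle$, then $t(H)$ for $H\in\mathrm{ONH}(\pi_2)$, then, only if $\Delta$ is empty, $H(u)$ for $H\in\mathrm{ONH}(\pi_1)$; if $\pi$ ends with (s) applied to $\pi_1$, $\mathrm{ONH}(\pi)=\mathrm{ONH}(\pi_1)$; if $\pi$ ends with ($\ell$) deriving $[\Gamma]\lambda x.t$ from $\pi_1$, $\mathrm{ONH}(\pi)$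 consists of $\lambda x.H$ for $H\in\mathrm{ONH}(\pi_1)$. *)

theory Defs
  imports "HOL-Combinatorics.Permutations"
begin

section \<open>Rooted planar maps as combinatorial maps\<close>

text \<open>A rooted planar map with n \<ge> 1 edges is encoded by labelled data on the dart set
  {0..<2n}: a vertex rotation s (clockwise cyclic order of darts around their origin),
  an edge involution a (fixed-point free), and a root dart r. The face permutation is
  s \<circ> a, whose orbit of a dart is the face to the left of that dart.
  Connectedness = transitivity of the generated group, planarity = Euler's formula.
  Rooted maps are labelled maps up to root-preserving relabelling.\<close>

definition darts :: "nat \<Rightarrow> nat set" where
  "darts n = {0..<2*n}"

definition orbit_of :: "(nat \<Rightarrow> nat) \<Rightarrow> nat \<Rightarrow> nat set" where
  "orbit_of f x = {(f ^^ k) x | k. True}"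

definition cycles_of :: "(nat \<Rightarrow> nat) \<Rightarrow> nat set \<Rightarrow> nat set set" where
  "cycles_of f D = {orbit_of f x | x. x \<in> D}"

definition connected_map :: "nat set \<Rightarrow> (nat \<Rightarrow> nat) \<Rightarrow> (nat \<Rightarrow> nat) \<Rightarrow> bool" where
  "connected_map D s a \<longleftrightarrow>
     (\<forall>x\<in>D. \<forall>y\<in>D. (x, y) \<in> ({(z, s z) | z. z \<in> D} \<union> {(z, a z) | z. z \<in> D})\<^sup>*)"

type_synonym lmap = "(nat \<Rightarrow> nat) \<times> (nat \<Rightarrow> nat) \<times> nat"

definition is_rmap :: "nat \<Rightarrow> lmap \<Rightarrow> bool" where
  "is_rmap n m = (case m of (s, a, r) \<Rightarrow>
      s permutes darts n \<and> a permutes darts n \<and>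
      (\<forall>x\<in>darts n. a x \<noteq> x \<and> a (a x) = x) \<and>
      r \<in> darts n \<and>
      connected_map (darts n) s a \<and>
      card (cycles_of s (darts n)) + card (cycles_of (s \<circ> a) (darts n)) = n + 2)"

definition outer_degree :: "lmap \<Rightarrow> nat" where
  "outer_degree m = (case m of (s, a, r) \<Rightarrow> card (orbit_of (s \<circ> a) r))"

definition map_iso :: "nat \<Rightarrow> (lmap \<times> lmap) set" where
  "map_iso n = {((s, a, r), (s', a', r')). \<exists>h. h permutes darts n \<and>
       (\<forall>x\<in>darts n. h (s x) = s' (h x) \<and> h (a x) = a' (h x)) \<and> h r = r'}"

text \<open>Rooted planar maps with n edges and outer face degree d (isomorphism classes).
  For n = 0 the only rooted map is the vertex map, with outer degree 0.\<close>

definition vertex_map :: "lmap set" where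
  "vertex_map = {(id, id, 0)}"

definition rooted_maps :: "nat \<Rightarrow> nat \<Rightarrow> lmap set set" where
  "rooted_maps n d =
     (if n = 0 then (if d = 0 then {vertex_map} else {})
      else {m. is_rmap n m \<and> outer_degree m = d} // map_iso n)"

section \<open>Lambda skeletons, planar terms, colorings\<close>

datatype skel = SVar | SApp skel skel | SLam skel

inductive slam :: "skel \<Rightarrow> nat \<Rightarrow> bool" where
  "slam SVar 1"
| "slam p j \<Longrightarrow> slam q k \<Longrightarrow> slam (SApp p q) (j + k)"
| "slam p (Suc i) \<Longrightarrow> slam (SLam p) i"

datatype lterm = V nat | A lterm lterm | L nat lterm

text \<open>Planar terms [Gamma]t decorating skeleton p (contexts are lists of distinct variables).\<close>
inductive planar :: "nat list \<Rightarrow> lterm \<Rightarrow> skel \<Rightarrow> bool" where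
  pvar: "planar [x] (V x) SVar"
| papp: "planar G t p \<Longrightarrow> planar D u q \<Longrightarrow> distinct (G @ D) \<Longrightarrow>
           planar (G @ D) (A t u) (SApp p q)"
| plam: "planar (x # G) t p \<Longrightarrow> planar G (L x t) (SLam p)"

text \<open>Alpha-equivalence relative to a correspondence of variables (innermost first).\<close>
fun rel_var :: "(nat \<times> nat) list \<Rightarrow> nat \<Rightarrow> nat \<Rightarrow> bool" where
  "rel_var [] x y = False"
| "rel_var ((a, b) # env) x y =
     (if a = x \<or> b = y then a = x \<and> b = y else rel_var env x y)"

inductive aeq :: "(nat \<times> nat) list \<Rightarrow> lterm \<Rightarrow> lterm \<Rightarrow> bool" where
  "rel_var env x y \<Longrightarrow> aeq env (V x) (V y)"
| "aeq env t t' \<Longrightarrow> aeq env u u' \<Longrightarrow> aeq env (A t u) (A t' u')"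
| "aeq ((x, y) # env) t t' \<Longrightarrow> aeq env (L x t) (L y t')"

text \<open>Terms with context, modulo renaming of (free and bound) variables.\<close>
definition term_renaming :: "((nat list \<times> lterm) \<times> (nat list \<times> lterm)) set" where
  "term_renaming = {((G, t), (G', t')). length G = length G' \<and> aeq (zip G G') t t'}"

fun fv :: "lterm \<Rightarrow> nat set" where
  "fv (V x) = {x}"
| "fv (A t u) = fv t \<union> fv u"
| "fv (L x t) = fv t - {x}"

text \<open>Derivations (colorings) built from rules (v), (a), (s), (l).\<close>
datatype deriv = Dv | Da deriv deriv | Ds deriv | Dl deriv

inductive sneu :: "deriv \<Rightarrow> skel \<Rightarrow> nat \<Rightarrow> bool"
  and snf :: "deriv \<Rightarrow> skel \<Rightarrow> nat \<Rightarrow> bool" where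
  rv: "sneu Dv SVar 1"
| ra: "sneu \<pi>1 p j \<Longrightarrow> snf \<pi>2 q k \<Longrightarrow> sneu (Da \<pi>1 \<pi>2) (SApp p q) (j + k)"
| rs: "sneu \<pi> p i \<Longrightarrow> snf (Ds \<pi>) p i"
| rl: "snf \<pi> p (Suc i) \<Longrightarrow> snf (Dl \<pi>) (SLam p) i"

fun uses_s :: "deriv \<Rightarrow> nat" where
  "uses_s Dv = 0"
| "uses_s (Da \<pi>1 \<pi>2) = uses_s \<pi>1 + uses_s \<pi>2"
| "uses_s (Ds \<pi>) = Suc (uses_s \<pi>)"
| "uses_s (Dl \<pi>) = uses_s \<pi>"

text \<open>A neutral handle C[<n>] is represented by the position of the hole
  (a path from the root of the term).\<close>
datatype dir = Fun | Arg | Body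

fun onh :: "deriv \<Rightarrow> lterm \<Rightarrow> dir list list" where
  "onh Dv (V x) = [[]]"
| "onh (Da \<pi>1 \<pi>2) (A t u) =
     [] # map ((#) Arg) (onh \<pi>2 u) @
     (if fv u = {} then map ((#) Fun) (onh \<pi>1 t) else [])"
| "onh (Ds \<pi>) t = onh \<pi> t"
| "onh (Dl \<pi>) (L x t) = map ((#) Body) (onh \<pi> t)"
| "onh _ _ = []"

text \<open>NPTs [x]t whose R-coloring has n+1 uses of (s) and d+1 outer neutral handles,
  modulo renaming.\<close>
definition npts :: "nat \<Rightarrow> nat \<Rightarrow> (nat list \<times> lterm) set set" where
  "npts n d = {(G, t). \<exists>x p \<pi>. G = [x] \<and> planar [x] t p \<and> snf \<pi> p 1 \<and>
                 uses_s \<pi> = n + 1 \<and> length (onh \<pi> t) = d + 1} // term_renaming"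

end

theory Submission
  imports Defs
begin

text \<open>Both families are put in bijection with the trees recording Tutte's iterated deletion of the
  root edge. A map is rooted at an extra dangling dart, so that the vertex map is not exceptional and
  the outer face has one dart more than its degree. If the edge following the root is an isthmus,
  deleting it leaves an ordered pair of maps; otherwise it leaves one map together with a dart of its
  outer face, namely the corner at which the edge ended. Euler's inequality, obtained from the same
  deletion, shows that planarity is inherited and that this corner does lie on the outer face.

  For an NPT one looks at the occurrence of the free variable x. Either it is the head of an application
  x(u) with u closed, and u and the term with x(u) replaced by x form a pair of NPTs; or it is the argument
  of n(x), the term starts with a lambda, and erasing this lambda and replacing n(x) by n leaves an NPT with
  a marked outer neutral handle n.\<close>

text \<open>Dart systems carry arbitrary finite sets of names and are related to trees by
  \<open>rep\<close>; recursion on isomorphism classes would force a relabelling at every deletion,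
  so isomorphism enters only when the tree is shown to be a complete invariant. On the term side one
  free variable is not enough for the recursion, since the parts of an application and the bodies of
  abstractions may have several or none. All operations are therefore stated for the last free
  variable, which survives abstraction because a lambda binds the first one. The outer neutral
  handles are those met on the way to this variable together with those inside the closed arguments
  passed; this explains the clause about an empty context in their definition. The statistics agree
  after a shift by one on both sides, d + 1 darts of the outer face with the dangling one, d + 1
  handles, but the natural numberings run in opposite directions: corners passed before the chosen
  one leave the outer face, whereas handles listed before the chosen one are those that stay. Hence
  the reversed index in \<open>tree_deriv\<close>.\<close>

section \<open>Cycles of permutations\<close>

text \<open>The unqualified name refers to the transposition of lists of lists.\<close>

abbreviation tr :: "nat \<Rightarrow> nat \<Rightarrow> nat \<Rightarrow> nat" where
  "tr \<equiv> Transposition.transpose"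

lemma orbit_of_self: "x \<in> orbit_of f x"
  unfolding orbit_of_def by (auto intro: exI[of _ 0])

lemma orbit_of_step: "y \<in> orbit_of f x \<Longrightarrow> f y \<in> orbit_of f x"
  unfolding orbit_of_def by clarsimp (metis comp_apply funpow.simps(2))

lemma orbit_of_funpow: "(f ^^ k) x \<in> orbit_of f x"
  unfolding orbit_of_def by blast

lemma orbit_of_least:
  assumes "x \<in> X" "\<And>y. y \<in> X \<Longrightarrow> f y \<in> X"
  shows "orbit_of f x \<subseteq> X"
proof -
  have "(f ^^ k) x \<in> X" for k
    by (induction k) (use assms in auto)
  then show ?thesis unfolding orbit_of_def by blast
qed

lemma orbit_of_subset: "y \<in> orbit_of f x \<Longrightarrow> orbit_of f y \<subseteq> orbit_of f x"
  by (rule orbit_of_least) (auto intro: orbit_of_step)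

lemma orbit_of_fixed: "f x = x \<Longrightarrow> orbit_of f x = {x}"
  using orbit_of_least[of x "{x}" f] orbit_of_self[of x f] by auto

lemma orbit_of_in:
  assumes "p permutes D" "x \<in> D"
  shows "orbit_of p x \<subseteq> D"
  by (rule orbit_of_least) (use assms in \<open>auto simp: permutes_in_image\<close>)

lemma funpow_returns:
  fixes p :: "nat \<Rightarrow> nat"
  assumes "p permutes D" "finite D"
  obtains n where "n > 0" "(p ^^ n) x = x"
proof (cases "x \<in> D")
  case True
  have "{y. \<exists>n. y = (p ^^ n) x} \<subseteq> D"
    using orbit_of_in[OF assms(1) True] unfolding orbit_of_def by blast
  then have "finite {y. \<exists>n. y = (p ^^ n) x}"
    using assms(2) finite_subset by blast
  then show ?thesis
    using funpow_inj_finite[of p x] permutes_inj[OF assms(1)] that by blast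
next
  case False
  then have "(p ^^ 1) x = x" using assms(1) by (simp add: permutes_not_in)
  then show ?thesis using that[of 1] by simp
qed

text \<open>\<open>orbit_of\<close> follows forward powers only; every point returns to itself, so
  an iterate can be undone by further iterates.\<close>

lemma orbit_of_sym:
  assumes "p permutes D" "finite D" "y \<in> orbit_of p x"
  shows "x \<in> orbit_of p y"
proof -
  obtain k where k: "y = (p ^^ k) x" using assms(3) unfolding orbit_of_def by blast
  obtain n where n: "n > 0" "(p ^^ n) x = x" using funpow_returns[OF assms(1,2)] by blast
  have "(p ^^ (n * m)) x = x" for m
    by (induction m) (auto simp: funpow_add n)
  \<comment> \<open>Any multiple of the period that is at least k serves; n * Suc k does because n
    \<ge> 1.\<close>
  moreover have "n * Suc k - k + k = n * Suc k" using n(1) by (cases n) auto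
  ultimately have "(p ^^ (n * Suc k - k + k)) x = x" by metis
  then have "(p ^^ (n * Suc k - k)) y = x" by (simp add: k funpow_add)
  then show ?thesis unfolding orbit_of_def by blast
qed

lemma orbit_of_eq:
  assumes "p permutes D" "finite D" "y \<in> orbit_of p x"
  shows "orbit_of p y = orbit_of p x"
  using assms orbit_of_subset orbit_of_sym by (metis subset_antisym)

lemma orbit_of_disjoint:
  assumes "p permutes D" "finite D" "y \<notin> orbit_of p x"
  shows "orbit_of p x \<inter> orbit_of p y = {}"
  using assms orbit_of_eq orbit_of_self by (metis disjoint_iff)

lemma orbit_of_cong:
  assumes "\<And>y. y \<in> orbit_of p x \<Longrightarrow> q y = p y"
  shows "orbit_of q x = orbit_of p x"
proof -
  have "(q ^^ k) x = (p ^^ k) x" for k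
    by (induction k) (use assms orbit_of_funpow in auto)
  then show ?thesis unfolding orbit_of_def by simp
qed

lemma cycles_of_image: "cycles_of p D = orbit_of p ` D"
  unfolding cycles_of_def by auto

section \<open>Effect of a transposition on the cycles of a permutation\<close>

lemma permutes_comp_transpose:
  "p permutes D \<Longrightarrow> x \<in> D \<Longrightarrow> y \<in> D \<Longrightarrow> p \<circ> tr x y permutes D"
  by (simp add: permutes_compose permutes_swap_id)

text \<open>The transposition exchanges two exits: from x the new walk goes on with p y, runs round
  the old cycle of y until it stands at y, and from there continues with p x round the old cycle of
  x. Disjointness of the cycles ensures that no exit is met too early.\<close>

lemma orbit_of_merge_first:
  assumes "p permutes D" "finite D" "x \<in> D" "y \<in> D" "y \<notin> orbit_of p x"
  shows "orbit_of (p \<circ> tr x y) x = orbit_of p x \<union> orbit_of p y"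
proof
  let ?q = "p \<circ> tr x y"
  let ?W = "orbit_of ?q x"
  have q: "?q permutes D" using assms by (simp add: permutes_comp_transpose)
  have disj: "orbit_of p x \<inter> orbit_of p y = {}" using orbit_of_disjoint assms by blast
  show "?W \<subseteq> orbit_of p x \<union> orbit_of p y"
    by (rule orbit_of_least)
       (auto simp: transpose_def orbit_of_self orbit_of_step)
  have step: "p z \<in> ?W" if "z \<in> ?W" "z \<noteq> x" "z \<noteq> y" for z
    using orbit_of_step[OF that(1)] that by simp
  have px: "p y \<in> ?W" using orbit_of_step[OF orbit_of_self[of x ?q]] by simp
  have "(p ^^ Suc i) y \<in> ?W" for i
  proof (induction i)
    case (Suc i)
    have "(p ^^ Suc i) y \<noteq> x"
      using disj orbit_of_self[of x p] orbit_of_funpow[of "Suc i" p y] by (metis disjoint_iff)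
    then show ?case
      using step[OF Suc] px by (cases "(p ^^ Suc i) y = y") (simp_all add: comp_def)
  qed (use px in \<open>simp add: comp_def\<close>)
  then have yW': "(p ^^ i) y \<in> ?W" if "i > 0" for i
    using that by (cases i) auto
  have yW: "y \<in> ?W"
    using yW' funpow_returns[OF assms(1,2), of y] by metis
  have "(p ^^ i) y \<in> ?W" for i
    using yW yW'[of i] by (cases "i = 0") auto
  then have 1: "orbit_of p y \<subseteq> ?W"
    unfolding orbit_of_def[of p y] by blast
  have py: "p x \<in> ?W" using orbit_of_step[OF yW] by simp
  have "(p ^^ Suc i) x \<in> ?W" for i
  proof (induction i)
    case (Suc i)
    have "(p ^^ Suc i) x \<noteq> y"
      using disj orbit_of_self[of y p] orbit_of_funpow[of "Suc i" p x] by (metis disjoint_iff)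
    then show ?case
      using step[OF Suc] py by (cases "(p ^^ Suc i) x = x") (simp_all add: comp_def)
  qed (use py in \<open>simp add: comp_def\<close>)
  then have "(p ^^ i) x \<in> ?W" for i
    using orbit_of_self[of x ?q] by (cases i) auto
  then have 2: "orbit_of p x \<subseteq> ?W"
    unfolding orbit_of_def[of p x] by blast
  show "orbit_of p x \<union> orbit_of p y \<subseteq> ?W" using 1 2 by blast
qed

lemma orbit_of_merge_other:
  assumes "p permutes D" "finite D" "z \<notin> orbit_of p x" "z \<notin> orbit_of p y"
  shows "orbit_of (p \<circ> tr x y) z = orbit_of p z"
proof (rule orbit_of_cong)
  fix w assume "w \<in> orbit_of p z"
  then have "w \<noteq> x" "w \<noteq> y" using assms orbit_of_sym by blast+
  then show "(p \<circ> tr x y) w = p w" by simp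
qed

lemma orbit_of_merge:
  assumes "p permutes D" "finite D" "x \<in> D" "y \<in> D" "y \<notin> orbit_of p x"
    "z \<in> orbit_of p x \<union> orbit_of p y"
  shows "orbit_of (p \<circ> tr x y) z = orbit_of p x \<union> orbit_of p y"
  using orbit_of_merge_first[OF assms(1-5)] assms orbit_of_eq[of "p \<circ> tr x y" D z x]
  by (simp add: permutes_comp_transpose)

lemma card_cycles_merge:
  assumes "p permutes D" "finite D" "x \<in> D" "y \<in> D" "y \<notin> orbit_of p x"
  shows "card (cycles_of p D) = Suc (card (cycles_of (p \<circ> tr x y) D))"
proof -
  let ?q = "p \<circ> tr x y"
  let ?U = "orbit_of p x \<union> orbit_of p y"
  let ?R = "cycles_of p D - {orbit_of p x, orbit_of p y}"
  have fin: "finite (cycles_of p D)" using assms by (simp add: cycles_of_image)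
  have ne: "orbit_of p x \<noteq> orbit_of p y" using assms orbit_of_self by metis
  have "cycles_of ?q D = insert ?U ?R"
  proof
    show "cycles_of ?q D \<subseteq> insert ?U ?R"
    proof
      fix C assume "C \<in> cycles_of ?q D"
      then obtain z where z: "z \<in> D" "C = orbit_of ?q z" by (auto simp: cycles_of_image)
      show "C \<in> insert ?U ?R"
      proof (cases "z \<in> ?U")
        case True
        then show ?thesis using z orbit_of_merge[OF assms] by simp
      next
        case False
        then have "C = orbit_of p z" using z orbit_of_merge_other[OF assms(1,2)] by simp
        then show ?thesis using z False orbit_of_self[of z p] by (auto simp: cycles_of_image)
      qed
    qed
    show "insert ?U ?R \<subseteq> cycles_of ?q D"
    proof
      fix C assume "C \<in> insert ?U ?R"
      then consider "C = ?U" | z where "z \<in> D" "C = orbit_of p z" "C \<noteq> orbit_of p x" "C \<noteq> orbit_of p y"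
        by (auto simp: cycles_of_image)
      then show "C \<in> cycles_of ?q D"
      proof cases
        case 1
        then show ?thesis using orbit_of_merge_first[OF assms] assms(3) by (auto simp: cycles_of_image)
      next
        case 2
        then have "z \<notin> orbit_of p x" "z \<notin> orbit_of p y"
          using orbit_of_eq[OF assms(1,2), of z] by auto
        then have "C = orbit_of ?q z" using 2 orbit_of_merge_other[OF assms(1,2)] by simp
        then show ?thesis using 2(1) unfolding cycles_of_image by blast
      qed
    qed
  qed
  moreover have "?U \<notin> ?R"
  proof
    assume "?U \<in> ?R"
    then obtain z where z: "z \<in> D" "?U = orbit_of p z" by (auto simp: cycles_of_image)
    then have "x \<in> orbit_of p z" "y \<in> orbit_of p z" using orbit_of_self[of x p] orbit_of_self[of y p] by blast+
    then show False using orbit_of_eq[OF assms(1,2)] ne by metis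
  qed
  moreover have "card (cycles_of p D) = card ?R + 2"
  proof -
    have sub: "{orbit_of p x, orbit_of p y} \<subseteq> cycles_of p D" using assms by (auto simp: cycles_of_image)
    have "card {orbit_of p x, orbit_of p y} = 2" using ne by simp
    then show ?thesis using card_Diff_subset[OF _ sub] card_mono[OF fin sub] by simp
  qed
  ultimately show ?thesis using fin by simp
qed

text \<open>Let m be the first time at which p takes x to y. The arc p x, ..., (p ^^ m) x = y is
  closed under the new permutation, which sends y back to p x, and it avoids x. So it confines the
  new orbit of y, and symmetry gives the claim.\<close>

lemma orbit_of_split:
  assumes "p permutes D" "finite D" "x \<in> D" "y \<in> orbit_of p x" "x \<noteq> y"
  shows "y \<notin> orbit_of (p \<circ> tr x y) x"
proof -
  let ?q = "p \<circ> tr x y"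
  have yD: "y \<in> D" using assms orbit_of_in by blast
  have q: "?q permutes D" using assms yD by (simp add: permutes_comp_transpose)
  define m where "m = (LEAST i. (p ^^ i) x = y)"
  have "\<exists>i. (p ^^ i) x = y" using assms(4) unfolding orbit_of_def by blast
  then have m: "(p ^^ m) x = y" unfolding m_def by (rule LeastI_ex)
  have least: "(p ^^ i) x \<noteq> y" if "i < m" for i using that not_less_Least unfolding m_def by blast
  have m0: "m > 0" using m assms(5) by (cases m) auto
  let ?S = "(\<lambda>i. (p ^^ i) x) ` {1..m}"
  have nx: "(p ^^ i) x \<noteq> x" if "0 < i" "i \<le> m" for i
  proof
    assume e: "(p ^^ i) x = x"
    have "(p ^^ (m - i + i)) x = y" using m that by simp
    then have "(p ^^ (m - i)) x = y" using e by (simp only: funpow_add comp_apply)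
    then show False using least[of "m - i"] that by simp
  qed
  have "orbit_of ?q y \<subseteq> ?S"
  proof (rule orbit_of_least)
    show "y \<in> ?S" using m m0 by force
    fix z assume "z \<in> ?S"
    then obtain i where i: "z = (p ^^ i) x" "0 < i" "i \<le> m" by auto
    show "?q z \<in> ?S"
    proof (cases "i = m")
      case True
      then show ?thesis using i m m0 by (auto intro!: image_eqI[of _ _ 1])
    next
      case False
      then have "z \<noteq> y" "z \<noteq> x" using i least nx by auto
      then show ?thesis using i False by (auto intro!: image_eqI[of _ _ "Suc i"])
    qed
  qed
  moreover have "x \<notin> ?S"
  proof
    assume "x \<in> ?S"
    then obtain i where "x = (p ^^ i) x" "i \<in> {1..m}" by (rule imageE)
    then show False using nx[of i] by (metis One_nat_def Suc_le_eq atLeastAtMost_iff)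
  qed
  ultimately have "x \<notin> orbit_of ?q y" by blast
  then show ?thesis using orbit_of_sym[OF q assms(2)] by blast
qed

text \<open>Multiplying twice by the same transposition gives p back, so this is the merging count
  read backwards.\<close>

lemma card_cycles_split:
  assumes "p permutes D" "finite D" "x \<in> D" "y \<in> orbit_of p x" "x \<noteq> y"
  shows "card (cycles_of (p \<circ> tr x y) D) = Suc (card (cycles_of p D))"
proof -
  have y: "y \<in> D" using assms orbit_of_in by blast
  have "p \<circ> tr x y \<circ> tr x y = p" by (simp add: comp_assoc)
  then show ?thesis
    using card_cycles_merge[OF _ assms(2,3) y orbit_of_split[OF assms]] assms y
    by (simp add: permutes_comp_transpose)
qed

lemma cycles_of_insert_fixed:
  assumes "p permutes D" "finite D" "e \<notin> D"
  shows "card (cycles_of p (insert e D)) = Suc (card (cycles_of p D))"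
proof -
  have "orbit_of p e = {e}" using assms by (simp add: orbit_of_fixed permutes_not_in)
  moreover have "{e} \<notin> cycles_of p D"
    unfolding cycles_of_image using assms(3) orbit_of_in[OF assms(1)] orbit_of_self by blast
  ultimately show ?thesis using assms by (simp add: cycles_of_image)
qed

lemma cycles_of_disjoint_union:
  assumes "p permutes D" "q permutes E" "finite D" "finite E" "D \<inter> E = {}"
  shows "card (cycles_of (p \<circ> q) (D \<union> E)) = card (cycles_of p D) + card (cycles_of q E)"
    and "x \<in> D \<Longrightarrow> orbit_of (p \<circ> q) x = orbit_of p x"
    and "x \<in> E \<Longrightarrow> orbit_of (p \<circ> q) x = orbit_of q x"
proof -
  show D: "orbit_of (p \<circ> q) x = orbit_of p x" if "x \<in> D" for x
  proof (rule orbit_of_cong)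
    fix y assume "y \<in> orbit_of p x"
    then have "y \<in> D" using orbit_of_in[OF assms(1) that] by blast
    then show "(p \<circ> q) y = p y" using permutes_not_in[OF assms(2), of y] assms(5) by (auto simp: disjoint_iff)
  qed
  show E: "orbit_of (p \<circ> q) x = orbit_of q x" if "x \<in> E" for x
  proof (rule orbit_of_cong)
    fix y assume "y \<in> orbit_of q x"
    then have "q y \<in> E" using orbit_of_in[OF assms(2) that] orbit_of_step by blast
    then show "(p \<circ> q) y = q y" using permutes_not_in[OF assms(1), of "q y"] assms(5) by (auto simp: disjoint_iff)
  qed
  have "cycles_of (p \<circ> q) (D \<union> E) = cycles_of p D \<union> cycles_of q E"
    unfolding cycles_of_image image_Un using D E by simp
  moreover have "cycles_of p D \<inter> cycles_of q E = {}"
  proof (rule ccontr)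
    assume "cycles_of p D \<inter> cycles_of q E \<noteq> {}"
    then obtain x y where "x \<in> D" "y \<in> E" "orbit_of p x = orbit_of q y"
      by (auto simp: cycles_of_image)
    then show False
      using orbit_of_in[OF assms(1)] orbit_of_in[OF assms(2)] orbit_of_self[of x p] assms(5) by blast
  qed
  ultimately show "card (cycles_of (p \<circ> q) (D \<union> E)) = card (cycles_of p D) + card (cycles_of q E)"
    using assms by (simp add: card_Un_disjoint cycles_of_image)
qed

section \<open>Enumeration of an orbit by powers\<close>

lemma card_orbit_of_period:
  assumes "p permutes D" "N > 0" "(p ^^ N) x = x" "\<And>i. 0 < i \<Longrightarrow> i < N \<Longrightarrow> (p ^^ i) x \<noteq> x"
  shows "orbit_of p x = (\<lambda>i. (p ^^ i) x) ` {..<N}" "inj_on (\<lambda>i. (p ^^ i) x) {..<N}"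
    "card (orbit_of p x) = N"
proof -
  show 1: "orbit_of p x = (\<lambda>i. (p ^^ i) x) ` {..<N}"
  proof
    show "orbit_of p x \<subseteq> (\<lambda>i. (p ^^ i) x) ` {..<N}"
    proof (rule orbit_of_least)
      fix y assume "y \<in> (\<lambda>i. (p ^^ i) x) ` {..<N}"
      then obtain i where i: "i < N" "y = (p ^^ i) x" by auto
      then have "p y = (p ^^ Suc i) x" by simp
      then show "p y \<in> (\<lambda>i. (p ^^ i) x) ` {..<N}"
        using i assms(2,3) by (cases "Suc i = N") (auto intro: image_eqI[of _ _ 0] image_eqI[of _ _ "Suc i"])
    qed (use assms(2) in force)
  qed (auto simp: orbit_of_funpow)
  show 2: "inj_on (\<lambda>i. (p ^^ i) x) {..<N}"
  proof (rule linorder_inj_onI)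
    fix i j assume ij: "i < j" "i \<in> {..<N}" "j \<in> {..<N}"
    show "(p ^^ i) x \<noteq> (p ^^ j) x"
    proof
      assume "(p ^^ i) x = (p ^^ j) x"
      then have "(p ^^ i) x = (p ^^ i) ((p ^^ (j - i)) x)"
        using ij by (metis add_diff_inverse_nat comp_apply funpow_add less_imp_not_less)
      then have "x = (p ^^ (j - i)) x"
        by (meson assms(1) bij_fn inj_eq bij_is_inj permutes_bij)
      moreover have "0 < j - i" "j - i < N" using ij by auto
      ultimately show False using assms(4)[of "j - i"] by metis
    qed
  qed auto
  show "card (orbit_of p x) = N" using 1 2 by (simp add: card_image)
qed

lemma funpow_card_orbit_of:
  assumes "p permutes D" "finite D"
  shows "(p ^^ card (orbit_of p x)) x = x"
    and "0 < i \<Longrightarrow> i < card (orbit_of p x) \<Longrightarrow> (p ^^ i) x \<noteq> x"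
    and "0 < card (orbit_of p x)"
proof -
  define N where "N = (LEAST n. 0 < n \<and> (p ^^ n) x = x)"
  have "\<exists>n. 0 < n \<and> (p ^^ n) x = x" using funpow_returns[OF assms] by blast
  then have N: "0 < N" "(p ^^ N) x = x" unfolding N_def using LeastI_ex[of "\<lambda>n. 0 < n \<and> (p ^^ n) x = x"] by auto
  have least: "(p ^^ i) x \<noteq> x" if "0 < i" "i < N" for i
    using that not_less_Least[of i "\<lambda>n. 0 < n \<and> (p ^^ n) x = x"] unfolding N_def by blast
  have c: "card (orbit_of p x) = N" by (rule card_orbit_of_period[OF assms(1) N least])
  show "(p ^^ card (orbit_of p x)) x = x" "0 < card (orbit_of p x)" using c N by auto
  show "0 < i \<Longrightarrow> i < card (orbit_of p x) \<Longrightarrow> (p ^^ i) x \<noteq> x" using c least by auto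
qed

lemma orbit_of_enum:
  assumes "p permutes D" "finite D"
  shows "orbit_of p x = (\<lambda>i. (p ^^ i) x) ` {..<card (orbit_of p x)}"
    and "inj_on (\<lambda>i. (p ^^ i) x) {..<card (orbit_of p x)}"
proof -
  have "\<And>i. 0 < i \<Longrightarrow> i < card (orbit_of p x) \<Longrightarrow> (p ^^ i) x \<noteq> x"
    using funpow_card_orbit_of(2)[OF assms] by blast
  note per = assms(1) funpow_card_orbit_of(3)[OF assms] funpow_card_orbit_of(1)[OF assms] this
  show "orbit_of p x = (\<lambda>i. (p ^^ i) x) ` {..<card (orbit_of p x)}"
    by (rule card_orbit_of_period(1)[OF per])
  show "inj_on (\<lambda>i. (p ^^ i) x) {..<card (orbit_of p x)}"
    by (rule card_orbit_of_period(2)[OF per])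
qed

section \<open>Maps rooted at a dangling dart\<close>

definition closed_under :: "(nat \<Rightarrow> nat) \<Rightarrow> (nat \<Rightarrow> nat) \<Rightarrow> nat set \<Rightarrow> bool" where
  "closed_under s a X \<longleftrightarrow> (\<forall>x\<in>X. s x \<in> X \<and> a x \<in> X)"

text \<open>As an intersection of closed sets, it turns connectedness into an induction principle: a
  closed set containing r contains everything. No paths are needed.\<close>

definition comp_of :: "(nat \<Rightarrow> nat) \<Rightarrow> (nat \<Rightarrow> nat) \<Rightarrow> nat \<Rightarrow> nat set" where
  "comp_of s a r = \<Inter> {X. r \<in> X \<and> closed_under s a X}"

text \<open>The last conjunct is connectedness: for permutations of a finite set, forward closure from one
  point already yields transitivity.\<close>

definition dmap :: "nat set \<Rightarrow> (nat \<Rightarrow> nat) \<Rightarrow> (nat \<Rightarrow> nat) \<Rightarrow> nat \<Rightarrow> bool" where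
  "dmap D s a r \<longleftrightarrow> finite D \<and> s permutes D \<and> a permutes D \<and> (\<forall>x. a (a x) = x) \<and> r \<in> D \<and>
     (\<forall>x\<in>D. a x = x \<longleftrightarrow> x = r) \<and> comp_of s a r = D"

lemma comp_of_least: "r \<in> X \<Longrightarrow> closed_under s a X \<Longrightarrow> comp_of s a r \<subseteq> X"
  unfolding comp_of_def by blast

lemma comp_of_root: "r \<in> comp_of s a r"
  unfolding comp_of_def by blast

lemma closed_comp_of: "closed_under s a (comp_of s a r)"
  unfolding comp_of_def closed_under_def by blast

lemma comp_of_eqI:
  assumes "r \<in> D" "closed_under s a D" "\<And>X. r \<in> X \<Longrightarrow> closed_under s a X \<Longrightarrow> X \<subseteq> D \<Longrightarrow> D \<subseteq> X"
  shows "comp_of s a r = D"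
proof
  show "comp_of s a r \<subseteq> D" using comp_of_least assms by blast
  show "D \<subseteq> comp_of s a r"
    using assms(3)[OF comp_of_root closed_comp_of] \<open>comp_of s a r \<subseteq> D\<close> by blast
qed

lemma closed_permutes: "s permutes D \<Longrightarrow> a permutes D \<Longrightarrow> closed_under s a D"
  unfolding closed_under_def by (simp add: permutes_in_image)

text \<open>In both constructions the dart e is inserted right after the root r. In a join its mate is the
  root of the second map. When an edge is added to a single map, its mate e' is inserted right after
  a c, that is, into the corner between a c and s (a c), through which the face of c passes.\<close>

definition join_s where "join_s s1 s2 r1 e = s1 \<circ> s2 \<circ> tr r1 e"
definition join_a where "join_a a1 a2 e r2 = a1 \<circ> a2 \<circ> tr e r2"
definition add_s where "add_s s a r c e e' = s \<circ> tr (a c) e' \<circ> tr r e"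
definition add_a where "add_a a e e' = a \<circ> tr e e'"

lemma permutes_insert_superset: "p permutes D \<Longrightarrow> p permutes insert e D"
  using permutes_subset by blast

lemma dmapD:
  assumes "dmap D s a r"
  shows "finite D" "s permutes D" "a permutes D" "a (a x) = x" "r \<in> D" "a r = r"
    "x \<in> D \<Longrightarrow> a x = x \<Longrightarrow> x = r" "comp_of s a r = D"
    "x \<in> D \<Longrightarrow> s x \<in> D" "x \<in> D \<Longrightarrow> a x \<in> D" "x \<notin> D \<Longrightarrow> s x = x" "x \<notin> D \<Longrightarrow> a x = x"
  using assms unfolding dmap_def by (auto simp: permutes_in_image permutes_not_in)

lemma dmap_least: "dmap D s a r \<Longrightarrow> r \<in> X \<Longrightarrow> closed_under s a X \<Longrightarrow> D \<subseteq> X"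
  using comp_of_least dmapD(8) by metis

lemma join_apply:
  assumes "dmap D1 s1 a1 r1" "dmap D2 s2 a2 r2" "D1 \<inter> D2 = {}" "e \<notin> D1" "e \<notin> D2"
  shows "join_s s1 s2 r1 e x = (if x = r1 then e else if x = e then s1 r1 else if x \<in> D1 then s1 x
      else if x \<in> D2 then s2 x else x)"
    "join_a a1 a2 e r2 x = (if x = e then r2 else if x = r2 then e else if x \<in> D1 then a1 x
      else if x \<in> D2 then a2 x else x)"
proof -
  have r: "r1 \<in> D1" "r2 \<in> D2" "r1 \<noteq> e" "r2 \<noteq> e" "r1 \<noteq> r2" "r1 \<notin> D2" "r2 \<notin> D1" "a2 r2 = r2"
    using dmapD(5)[OF assms(1)] dmapD(5)[OF assms(2)] dmapD(6)[OF assms(2)] assms(3-5) by auto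
  have o: "s2 y = y" "a2 y = y" if "y \<notin> D2" for y
    using that dmapD(11,12)[OF assms(2)] by auto
  have o1: "s1 y = y" "a1 y = y" if "y \<notin> D1" for y
    using that dmapD(11,12)[OF assms(1)] by auto
  have i: "s2 y \<notin> D1" "a2 y \<notin> D1" if "y \<in> D2" for y
    using that dmapD(9,10)[OF assms(2)] assms(3) by (meson disjoint_iff)+
  have d: "y \<in> D1 \<Longrightarrow> y \<notin> D2" for y using assms(3) by auto
  have e: "s2 e = e" "s1 e = e" "a2 e = e" "a1 e = e" "s2 r1 = r1" "a1 r2 = r2"
    using o o1 r assms(4,5) by auto
  consider "x \<in> D1" "x \<noteq> e" "x \<noteq> r2" "x \<notin> D2" "s2 x = x" "a2 x = x"
    | "x \<in> D2" "x \<noteq> e" "x \<noteq> r1" "x \<notin> D1" "s1 (s2 x) = s2 x" "a1 (a2 x) = a2 x"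
    | "x = e" | "x \<notin> D1" "x \<notin> D2" "x \<noteq> e" "x \<noteq> r1" "x \<noteq> r2" "s1 x = x" "s2 x = x" "a1 x = x" "a2 x = x"
    using d[of x] o[of x] o1 i[of x] r assms(4,5) by metis
  note cs = this
  show "join_s s1 s2 r1 e x = (if x = r1 then e else if x = e then s1 r1 else if x \<in> D1 then s1 x
      else if x \<in> D2 then s2 x else x)"
    using cs by cases (simp_all add: join_s_def transpose_def e r(3,4) not_sym[OF r(3)] not_sym[OF r(4)])
  show "join_a a1 a2 e r2 x = (if x = e then r2 else if x = r2 then e else if x \<in> D1 then a1 x
      else if x \<in> D2 then a2 x else x)"
    using cs by cases (simp_all add: join_a_def transpose_def e r(3,4,8) not_sym[OF r(3)] not_sym[OF r(4)])
qed

text \<open>The nested conditional is the case a c = r, in which both ends enter the root corner.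
  The order of the transpositions in \<open>add_s\<close> then yields the rotation r, e, e', s r, so
  that e still comes right after r.\<close>

lemma add_apply:
  assumes "dmap D s a r" "c \<in> D" "e \<notin> D" "e' \<notin> D" "e \<noteq> e'"
  shows "add_s s a r c e e' x = (if x = r then e else if x = e then (if a c = r then e' else s r)
       else if x = e' then s (a c) else if x = a c then e' else s x)"
    "add_a a e e' x = (if x = e then e' else if x = e' then e else a x)"
proof -
  have r: "r \<in> D" "a c \<in> D" using dmapD(5,10)[OF assms(1)] assms(2) by blast+
  have f: "s e = e" "s e' = e'" "a e = e" "a e' = e'" using dmapD(11,12)[OF assms(1)] assms(3,4) by blast+
  have n: "r \<noteq> e" "r \<noteq> e'" "a c \<noteq> e" "a c \<noteq> e'" using r assms(3,4) by blast+
  show "add_s s a r c e e' x = (if x = r then e else if x = e then (if a c = r then e' else s r)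
       else if x = e' then s (a c) else if x = a c then e' else s x)"
    by (simp add: add_s_def transpose_def f n not_sym[OF n(1)] not_sym[OF n(2)] not_sym[OF n(3)]
        not_sym[OF n(4)] assms(5) not_sym[OF assms(5)])
  show "add_a a e e' x = (if x = e then e' else if x = e' then e else a x)"
    by (simp add: add_a_def transpose_def f assms(5))
qed

text \<open>For connectedness: a closed set containing r1 contains e, which follows r1, then its
  mate r2, and s1 r1, which now follows e. The new permutations differ from the old ones only at r1,
  e and r2, so the traces on D1 and D2 are closed for the two parts.\<close>

lemma dmap_join:
  assumes m: "dmap D1 s1 a1 r1" "dmap D2 s2 a2 r2" "D1 \<inter> D2 = {}" "e \<notin> D1" "e \<notin> D2"
  shows "dmap (insert e (D1 \<union> D2)) (join_s s1 s2 r1 e) (join_a a1 a2 e r2) r1"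
proof -
  let ?D = "insert e (D1 \<union> D2)"
  note d1 = dmapD[OF m(1)] and d2 = dmapD[OF m(2)]
  note S = join_apply(1)[OF m] and A = join_apply(2)[OF m]
  have ne: "r1 \<noteq> e" "r2 \<noteq> e" "r1 \<notin> D2" "r2 \<notin> D1" using d1(5) d2(5) m(3-5) by auto
  have dj: "x \<in> D1 \<Longrightarrow> x \<notin> D2" for x using m(3) by auto
  have s: "join_s s1 s2 r1 e permutes ?D"
    unfolding join_s_def
    by (rule permutes_comp_transpose[OF permutes_compose[OF permutes_subset[OF d2(2)] permutes_subset[OF d1(2)]]])
       (use d1(5) in auto)
  have a: "join_a a1 a2 e r2 permutes ?D"
    unfolding join_a_def
    by (rule permutes_comp_transpose[OF permutes_compose[OF permutes_subset[OF d2(3)] permutes_subset[OF d1(3)]]])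
       (use d2(5) in auto)
  have inv: "join_a a1 a2 e r2 (join_a a1 a2 e r2 x) = x" for x
  proof -
    consider "x = e" | "x = r2" | "x \<in> D1" | "x \<in> D2" "x \<noteq> r2" | "x \<notin> D1" "x \<notin> D2" "x \<noteq> e" by blast
    then show ?thesis
    proof cases
      case 3
      then have "a1 x \<in> D1" using d1(10) by blast
      then have "a1 x \<noteq> e" "a1 x \<noteq> r2" "x \<noteq> e" "x \<noteq> r2" using 3 ne m(4) by metis+
      then show ?thesis using A 3 \<open>a1 x \<in> D1\<close> d1(4) by simp
    next
      case 4
      then have "a2 x \<in> D2" using d2(10) by blast
      moreover have "a2 x \<noteq> r2" using 4 d2(4,6) by metis
      ultimately have "a2 x \<noteq> e" "a2 x \<noteq> r2" "x \<noteq> e" "x \<notin> D1" "a2 x \<notin> D1" using 4 dj m(5) by metis+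
      then show ?thesis using A 4 \<open>a2 x \<in> D2\<close> d2(4) by simp
    qed (use A ne d2(5) in auto)
  qed
  have fixd: "join_a a1 a2 e r2 x = x \<longleftrightarrow> x = r1" if "x \<in> ?D" for x
  proof
    assume h: "join_a a1 a2 e r2 x = x"
    show "x = r1"
    proof (rule ccontr)
      assume "x \<noteq> r1"
      then show False using h[unfolded A] that d1(7)[of x] d2(7)[of x] ne by (metis UnE insertE)
    qed
  next
    assume "x = r1"
    then show "join_a a1 a2 e r2 x = x" using ne d1(5,6) A[of r1] by auto
  qed
  have "comp_of (join_s s1 s2 r1 e) (join_a a1 a2 e r2) r1 = ?D"
  proof (rule comp_of_eqI)
    show "r1 \<in> ?D" using d1(5) by simp
    show "closed_under (join_s s1 s2 r1 e) (join_a a1 a2 e r2) ?D" using closed_permutes s a by blast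
    fix X assume X: "r1 \<in> X" "closed_under (join_s s1 s2 r1 e) (join_a a1 a2 e r2) X" "X \<subseteq> ?D"
    have cs: "x \<in> X \<Longrightarrow> join_s s1 s2 r1 e x \<in> X" and ca: "x \<in> X \<Longrightarrow> join_a a1 a2 e r2 x \<in> X" for x
      using X(2) unfolding closed_under_def by auto
    have e: "e \<in> X" using cs[OF X(1)] S ne by simp
    have r2: "r2 \<in> X" using ca[OF e] A ne by simp
    have s1: "s1 r1 \<in> X" using cs[OF e] S ne by simp
    have "closed_under s1 a1 (X \<inter> D1)"
      unfolding closed_under_def
    proof safe
      fix x assume x: "x \<in> X" "x \<in> D1"
      show "s1 x \<in> X" using cs[OF x(1)] s1 x m(4) S[of x] by (auto split: if_splits)
      show "a1 x \<in> X" using ca[OF x(1)] x ne m(4) A[of x] by (auto split: if_splits)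
    qed (use d1(9,10) in blast)+
    then have "D1 \<subseteq> X \<inter> D1" using dmap_least[OF m(1)] X(1) d1(5) by blast
    moreover have "closed_under s2 a2 (X \<inter> D2)"
      unfolding closed_under_def
    proof safe
      fix x assume x: "x \<in> X" "x \<in> D2"
      show "s2 x \<in> X" using cs[OF x(1)] x m(5) ne(3) dj[of x] S[of x] by (auto split: if_splits)
      show "a2 x \<in> X" using ca[OF x(1)] x m(5) dj[of x] r2 d2(6) A[of x] by (auto split: if_splits)
    qed (use d2(9,10) in blast)+
    then have "D2 \<subseteq> X \<inter> D2" using dmap_least[OF m(2)] r2 d2(5) by blast
    ultimately show "?D \<subseteq> X" using e by blast
  qed
  then show ?thesis
    unfolding dmap_def using d1(1,5) d2(1) s a inv fixd by blast
qed

text \<open>A closed set containing r picks up e and e', then s (a c) and s r, the successors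
  displaced by the insertions; hence its trace on D is closed under the old permutations.\<close>

lemma dmap_add:
  assumes m: "dmap D s a r" "c \<in> D" "e \<notin> D" "e' \<notin> D" "e \<noteq> e'"
  shows "dmap (insert e (insert e' D)) (add_s s a r c e e') (add_a a e e') r"
proof -
  let ?D = "insert e (insert e' D)"
  note d = dmapD[OF m(1)]
  note S = add_apply(1)[OF m] and A = add_apply(2)[OF m]
  have ne: "r \<noteq> e" "r \<noteq> e'" "a c \<in> D" "a c \<noteq> e" "a c \<noteq> e'" using d m by metis+
  have s: "add_s s a r c e e' permutes ?D"
    unfolding add_s_def
    by (rule permutes_comp_transpose[OF permutes_comp_transpose[OF permutes_subset[OF d(2)]]])
       (use d(5) ne in auto)
  have a: "add_a a e e' permutes ?D"
    unfolding add_a_def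
    by (rule permutes_comp_transpose[OF permutes_subset[OF d(3)]]) auto
  have inv: "add_a a e e' (add_a a e e' x) = x" for x
  proof -
    have "a e = e" "a e' = e'" using d(12) m(3,4) by blast+
    then have "a x \<noteq> e" "a x \<noteq> e'" if "x \<noteq> e" "x \<noteq> e'" using that d(4)[of x] by auto
    then show ?thesis using A d(4)[of x] m(5) by (cases "x = e"; cases "x = e'") simp_all
  qed
  have fixd: "add_a a e e' x = x \<longleftrightarrow> x = r" if "x \<in> ?D" for x
    using that A[of x] d(6) d(7)[of x] m(5) ne(1,2) by (cases "x = e"; cases "x = e'") auto
  have "comp_of (add_s s a r c e e') (add_a a e e') r = ?D"
  proof (rule comp_of_eqI)
    show "r \<in> ?D" using d(5) by simp
    show "closed_under (add_s s a r c e e') (add_a a e e') ?D" using closed_permutes s a by blast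
    fix X assume X: "r \<in> X" "closed_under (add_s s a r c e e') (add_a a e e') X" "X \<subseteq> ?D"
    have cs: "x \<in> X \<Longrightarrow> add_s s a r c e e' x \<in> X" and ca: "x \<in> X \<Longrightarrow> add_a a e e' x \<in> X" for x
      using X(2) unfolding closed_under_def by auto
    have e: "e \<in> X" using cs[OF X(1)] S[of r] by simp
    have e': "e' \<in> X" using ca[OF e] A[of e] by simp
    have sf: "s (a c) \<in> X" using cs[OF e'] S[of e'] ne m by simp
    \<comment> \<open>If both new darts sit in the corner after r, then s r is s (a c), which is
      already known to belong to X.\<close>
    have sr: "s r \<in> X" using cs[OF e] sf S[of e] ne by (cases "a c = r") auto
    have "closed_under s a (X \<inter> D)"
      unfolding closed_under_def
    proof safe
      fix x assume x: "x \<in> X" "x \<in> D"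
      show "s x \<in> X" using cs[OF x(1)] sf sr x m(3,4) S[of x] by (auto split: if_splits)
      show "a x \<in> X" using ca[OF x(1)] x m(3,4) A[of x] by (auto split: if_splits)
    qed (use d(9,10) in blast)+
    then have "D \<subseteq> X \<inter> D" using dmap_least[OF m(1)] X(1) d(5) by blast
    then show "?D \<subseteq> X" using e e' by blast
  qed
  then show ?thesis
    unfolding dmap_def using d(1,5) s a inv fixd by blast
qed

section \<open>Counting vertices and faces\<close>

abbreviation nvert :: "nat set \<Rightarrow> (nat \<Rightarrow> nat) \<Rightarrow> nat" where
  "nvert D s \<equiv> card (cycles_of s D)"
abbreviation nface :: "nat set \<Rightarrow> (nat \<Rightarrow> nat) \<Rightarrow> (nat \<Rightarrow> nat) \<Rightarrow> nat" where
  "nface D s a \<equiv> card (cycles_of (s \<circ> a) D)"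

lemma comp_tr_eq:
  assumes "inj f" shows "f \<circ> tr x y = tr (f x) (f y) \<circ> f"
  using assms by (auto simp: transpose_def fun_eq_iff inj_eq)

lemma permutes_disjoint_commute:
  assumes "p permutes D" "q permutes E" "D \<inter> E = {}"
  shows "p \<circ> q = q \<circ> p"
proof
  fix x
  show "(p \<circ> q) x = (q \<circ> p) x"
  proof (cases "x \<in> E")
    case True
    then have "x \<notin> D" "q x \<notin> D" using assms permutes_in_image[OF assms(2)] by blast+
    then show ?thesis using permutes_not_in[OF assms(1)] by simp
  next
    case x: False
    have "p x \<notin> E"
    proof (cases "x \<in> D")
      case True
      then show ?thesis using assms permutes_in_image[OF assms(1)] by blast
    qed (use x permutes_not_in[OF assms(1)] in simp)
    then show ?thesis using x permutes_not_in[OF assms(2)] by simp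
  qed
qed

lemma dmap_face_permutes: "dmap D s a r \<Longrightarrow> s \<circ> a permutes D"
  by (rule permutes_compose[OF dmapD(3) dmapD(2)])

text \<open>Both involutions fix r1 and e, so \<open>tr r1 e\<close> can be moved past them. What
  results is the product of the two old face permutations with two transpositions, to which the
  merging lemmas apply.\<close>

lemma face_join:
  assumes "dmap D1 s1 a1 r1" "dmap D2 s2 a2 r2" "D1 \<inter> D2 = {}" "e \<notin> D1" "e \<notin> D2"
  shows "join_s s1 s2 r1 e \<circ> join_a a1 a2 e r2 = (s1 \<circ> a1) \<circ> (s2 \<circ> a2) \<circ> tr r1 e \<circ> tr e r2"
proof -
  have r1: "r1 \<notin> D2" using dmapD(5)[OF assms(1)] assms(3) by blast
  have fx: "a1 r1 = r1" "a1 e = e" "a2 r1 = r1" "a2 e = e"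
    using dmapD(6)[OF assms(1)] dmapD(12)[OF assms(1)] dmapD(12)[OF assms(2)] r1 assms(4,5) by blast+
  have inj: "inj a1" "inj a2" using dmapD(3)[OF assms(1)] dmapD(3)[OF assms(2)] permutes_inj by blast+
  have c: "tr r1 e \<circ> a1 = a1 \<circ> tr r1 e" "tr r1 e \<circ> a2 = a2 \<circ> tr r1 e"
    using comp_tr_eq[OF inj(1), of r1 e] comp_tr_eq[OF inj(2), of r1 e] fx by simp_all
  have sa: "s2 \<circ> a1 = a1 \<circ> s2"
    using permutes_disjoint_commute[OF dmapD(3)[OF assms(1)] dmapD(2)[OF assms(2)] assms(3)] by simp
  have "join_s s1 s2 r1 e \<circ> join_a a1 a2 e r2 = s1 \<circ> s2 \<circ> (tr r1 e \<circ> a1) \<circ> a2 \<circ> tr e r2"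
    by (simp add: join_s_def join_a_def comp_assoc)
  also have "\<dots> = s1 \<circ> (s2 \<circ> a1) \<circ> (tr r1 e \<circ> a2) \<circ> tr e r2"
    unfolding c(1) by (simp add: comp_assoc)
  also have "\<dots> = (s1 \<circ> a1) \<circ> (s2 \<circ> a2) \<circ> tr r1 e \<circ> tr e r2"
    unfolding c(2) sa by (simp add: comp_assoc)
  finally show ?thesis .
qed

text \<open>Moving \<open>tr (a c) e'\<close> past a turns it into \<open>tr c e'\<close>. In the
  product the first two transpositions attach e' to the face of c and e to the face of r; only the
  last one changes the number of faces.\<close>

lemma face_add:
  assumes "dmap D s a r" "c \<in> D" "e \<notin> D" "e' \<notin> D" "e \<noteq> e'"
  shows "add_s s a r c e e' \<circ> add_a a e e' = s \<circ> a \<circ> tr c e' \<circ> tr r e \<circ> tr e e'"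
proof -
  have fx: "a r = r" "a e = e" "a e' = e'"
    using dmapD(6,12)[OF assms(1)] assms(3,4) by blast+
  have inj: "inj a" using dmapD(3)[OF assms(1)] permutes_inj by blast
  have c: "tr r e \<circ> a = a \<circ> tr r e" "tr (a c) e' \<circ> a = a \<circ> tr c e'"
    using comp_tr_eq[OF inj, of r e] comp_tr_eq[OF inj, of c e'] fx by simp_all
  have "add_s s a r c e e' \<circ> add_a a e e' = s \<circ> tr (a c) e' \<circ> (tr r e \<circ> a) \<circ> tr e e'"
    by (simp add: add_s_def add_a_def comp_assoc)
  also have "\<dots> = s \<circ> (tr (a c) e' \<circ> a) \<circ> tr r e \<circ> tr e e'"
    unfolding c(1) by (simp add: comp_assoc)
  also have "\<dots> = s \<circ> a \<circ> tr c e' \<circ> tr r e \<circ> tr e e'"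
    unfolding c(2) by (simp add: comp_assoc)
  finally show ?thesis .
qed

text \<open>Since e is a fixed point of p, merging its singleton cycle into that of x undoes the
  gain of one cycle on passing from D to \<open>insert e D\<close>.\<close>

lemma card_cycles_attach:
  assumes "p permutes D" "finite D" "x \<in> D" "e \<notin> D"
  shows "card (cycles_of (p \<circ> tr x e) (insert e D)) = card (cycles_of p D)"
    and "orbit_of (p \<circ> tr x e) x = insert e (orbit_of p x)"
    and "orbit_of (p \<circ> tr x e) e = insert e (orbit_of p x)"
    and "z \<noteq> e \<Longrightarrow> z \<notin> orbit_of p x \<Longrightarrow> orbit_of (p \<circ> tr x e) z = orbit_of p z"
    and "z \<in> orbit_of p x \<Longrightarrow> orbit_of (p \<circ> tr x e) z = insert e (orbit_of p x)"
    and "p \<circ> tr x e permutes insert e D"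
proof -
  have p: "p permutes insert e D" using permutes_insert_superset[OF assms(1)] .
  have oe: "orbit_of p e = {e}" using orbit_of_fixed[of p e] permutes_not_in[OF assms(1,4)] by simp
  have ne: "e \<notin> orbit_of p x" using orbit_of_in[OF assms(1,3)] assms(4) by blast
  have fin: "finite (insert e D)" using assms(2) by simp
  show "card (cycles_of (p \<circ> tr x e) (insert e D)) = card (cycles_of p D)"
    using card_cycles_merge[OF p fin _ _ ne] cycles_of_insert_fixed[OF assms(1,2,4)] assms(3) by simp
  have m: "orbit_of (p \<circ> tr x e) z = insert e (orbit_of p x)" if "z \<in> insert e (orbit_of p x)" for z
    using orbit_of_merge[OF p fin _ _ ne, of z] oe that assms(3) by simp
  show "orbit_of (p \<circ> tr x e) x = insert e (orbit_of p x)" using m[of x] orbit_of_self[of x p] by simp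
  show "orbit_of (p \<circ> tr x e) e = insert e (orbit_of p x)" using m[of e] by simp
  show "z \<in> orbit_of p x \<Longrightarrow> orbit_of (p \<circ> tr x e) z = insert e (orbit_of p x)" using m[of z] by simp
  show "z \<noteq> e \<Longrightarrow> z \<notin> orbit_of p x \<Longrightarrow> orbit_of (p \<circ> tr x e) z = orbit_of p z"
    using orbit_of_merge_other[OF p fin, of z x e] oe by simp
  show "p \<circ> tr x e permutes insert e D" using permutes_comp_transpose[OF p] assms(3) by simp
qed

text \<open>In the faces, e is attached to the outer face of r1, and \<open>tr e r2\<close> merges
  the result with the outer face of r2: one face less, and an outer face made of both and e. At the
  vertices only the attachment of e takes place.\<close>

lemma join_counts:
  assumes m: "dmap D1 s1 a1 r1" "dmap D2 s2 a2 r2" "D1 \<inter> D2 = {}" "e \<notin> D1" "e \<notin> D2"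
  defines "D \<equiv> insert e (D1 \<union> D2)"
    and "s \<equiv> join_s s1 s2 r1 e" and "a \<equiv> join_a a1 a2 e r2"
  shows "nvert D s = nvert D1 s1 + nvert D2 s2"
    and "Suc (nface D s a) = nface D1 s1 a1 + nface D2 s2 a2"
    and "card (orbit_of (s \<circ> a) r1) = Suc (card (orbit_of (s1 \<circ> a1) r1) + card (orbit_of (s2 \<circ> a2) r2))"
    and "card D = Suc (card D1 + card D2)"
proof -
  note d1 = dmapD(1,2,5)[OF m(1)] and d2 = dmapD(1,2,5)[OF m(2)]
  have fin: "finite (D1 \<union> D2)" using d1(1) d2(1) by simp
  have e: "e \<notin> D1 \<union> D2" using m(4,5) by simp
  have r1: "r1 \<in> D1 \<union> D2" using d1 by simp
  have "s1 \<circ> s2 permutes D1 \<union> D2"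
    by (rule permutes_compose[OF permutes_subset[OF d2(2)] permutes_subset[OF d1(2)]]) auto
  from card_cycles_attach(1)[OF this fin r1 e] show "nvert D s = nvert D1 s1 + nvert D2 s2"
    unfolding D_def s_def join_s_def
    using cycles_of_disjoint_union(1)[OF d1(2) d2(2) d1(1) d2(1) m(3)] by simp
  let ?f1 = "s1 \<circ> a1" and ?f2 = "s2 \<circ> a2"
  note f1 = dmap_face_permutes[OF m(1)] and f2 = dmap_face_permutes[OF m(2)]
  let ?P = "?f1 \<circ> ?f2" and ?Q = "?f1 \<circ> ?f2 \<circ> tr r1 e"
  have P: "?P permutes D1 \<union> D2"
    by (rule permutes_compose[OF permutes_subset[OF f2] permutes_subset[OF f1]]) auto
  note att = card_cycles_attach[OF P fin r1 e]
  note du = cycles_of_disjoint_union[OF f1 f2 d1(1) d2(1) m(3)]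
  have o1: "orbit_of ?P r1 = orbit_of ?f1 r1" using du(2)[OF d1(3)] .
  have i1: "orbit_of ?f1 r1 \<subseteq> D1" using orbit_of_in[OF f1 d1(3)] .
  have i2: "orbit_of ?f2 r2 \<subseteq> D2" using orbit_of_in[OF f2 d2(3)] .
  have r2: "r2 \<notin> orbit_of ?P r1" "r2 \<noteq> e" using o1 i1 d2(3) m(3,5) by auto
  have oe: "orbit_of ?Q e = insert e (orbit_of ?f1 r1)" using att(3) o1 by simp
  have or: "orbit_of ?Q r2 = orbit_of ?f2 r2" using att(4)[OF r2(2,1)] du(3)[OF d2(3)] by simp
  have ne: "r2 \<notin> orbit_of ?Q e" using oe r2 o1 by simp
  have Q: "?Q permutes D" using att(6) unfolding D_def .
  have finD: "finite D" "e \<in> D" "r2 \<in> D" unfolding D_def using fin d2(3) by auto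
  have F: "s \<circ> a = ?Q \<circ> tr e r2" unfolding s_def a_def using face_join[OF m] .
  show "Suc (nface D s a) = nface D1 s1 a1 + nface D2 s2 a2"
    unfolding F using card_cycles_merge[OF Q finD ne] att(1) du(1) unfolding D_def by simp
  have "orbit_of (s \<circ> a) r1 = insert e (orbit_of ?f1 r1) \<union> orbit_of ?f2 r2"
    unfolding F using orbit_of_merge[OF Q finD ne, of r1] oe or orbit_of_self[of r1 ?f1] by simp
  moreover have "finite (orbit_of ?f1 r1)" "finite (orbit_of ?f2 r2)"
    using i1 i2 d1(1) d2(1) finite_subset by blast+
  moreover have "insert e (orbit_of ?f1 r1) \<inter> orbit_of ?f2 r2 = {}" "e \<notin> orbit_of ?f1 r1"
    using i1 i2 m(3-5) by blast+
  ultimately show "card (orbit_of (s \<circ> a) r1) = Suc (card (orbit_of (s1 \<circ> a1) r1) + card (orbit_of (s2 \<circ> a2) r2))"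
    by (simp add: card_Un_disjoint)
  show "card D = Suc (card D1 + card D2)"
    unfolding D_def using fin e d1(1) d2(1) m(3) by (simp add: card_Un_disjoint)
qed

text \<open>The transposition \<open>tr e e'\<close> splits a cycle when e and e' lie on the same
  one and merges two otherwise; after the attachments they lie together exactly when c is on the
  face of r. The last claim tells the two situations apart by looking at the new system
  alone.\<close>

lemma add_counts:
  assumes m: "dmap D s a r" "c \<in> D" "e \<notin> D" "e' \<notin> D" "e \<noteq> e'"
  defines "D' \<equiv> insert e (insert e' D)"
    and "s' \<equiv> add_s s a r c e e'" and "a' \<equiv> add_a a e e'"
  shows "nvert D' s' = nvert D s"
    and "c \<in> orbit_of (s \<circ> a) r \<Longrightarrow> nface D' s' a' = Suc (nface D s a)"
    and "c \<notin> orbit_of (s \<circ> a) r \<Longrightarrow> Suc (nface D' s' a') = nface D s a"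
    and "card D' = Suc (Suc (card D))"
    and "c \<in> orbit_of (s \<circ> a) r \<longleftrightarrow> e' \<notin> orbit_of (s' \<circ> a') e"
proof -
  note d = dmapD(1,2,5)[OF m(1)]
  have ac: "a c \<in> D" using dmapD(10)[OF m(1) m(2)] .
  have fin: "finite (insert e' D)" "finite D'" using d(1) unfolding D'_def by simp_all
  have e: "e \<notin> insert e' D" "r \<in> insert e' D" using m d(3) by auto
  show "card D' = Suc (Suc (card D))" unfolding D'_def using m d(1) by simp
  note attv = card_cycles_attach[OF d(2,1) ac m(4)]
  note attv' = card_cycles_attach[OF attv(6) fin(1) e(2) e(1)]
  show "nvert D' s' = nvert D s"
    unfolding D'_def s'_def add_s_def using attv(1) attv'(1) by simp
  let ?f = "s \<circ> a" and ?p = "s \<circ> a \<circ> tr c e'" and ?q = "s \<circ> a \<circ> tr c e' \<circ> tr r e"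
  note f = dmap_face_permutes[OF m(1)]
  note att = card_cycles_attach[OF f d(1) m(2) m(4)]
  note att' = card_cycles_attach[OF att(6) fin(1) e(2) e(1)]
  have F: "s' \<circ> a' = ?q \<circ> tr e e'" unfolding s'_def a'_def using face_add[OF m] .
  have Q: "?q permutes D'" using att'(6) unfolding D'_def .
  have n: "card (cycles_of ?q D') = nface D s a" using att(1) att'(1) unfolding D'_def by simp
  have mem: "e \<in> D'" "e' \<in> D'" unfolding D'_def by auto
  have oe: "orbit_of ?q e = insert e (orbit_of ?p r)" using att'(3) .
  have iff: "c \<in> orbit_of ?f r \<longleftrightarrow> e' \<in> orbit_of ?q e"
  proof
    assume "c \<in> orbit_of ?f r"
    then have "r \<in> orbit_of ?f c" using orbit_of_sym[OF f d(1)] by blast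
    then show "e' \<in> orbit_of ?q e" using att(5) oe by simp
  next
    assume h: "e' \<in> orbit_of ?q e"
    show "c \<in> orbit_of ?f r"
    proof (rule ccontr)
      assume "c \<notin> orbit_of ?f r"
      then have "r \<notin> orbit_of ?f c" using orbit_of_sym[OF f d(1)] by blast
      moreover have "r \<noteq> e'" using d(3) m(4) by blast
      ultimately have "orbit_of ?p r = orbit_of ?f r" using att(4) by blast
      then show False using h oe orbit_of_in[OF f d(3)] m(4,5) by auto
    qed
  qed
  show 1: "nface D' s' a' = Suc (nface D s a)" if "c \<in> orbit_of ?f r"
    unfolding F using card_cycles_split[OF Q fin(2) mem(1) _ m(5)] iff that n by simp
  show 2: "Suc (nface D' s' a') = nface D s a" if "c \<notin> orbit_of ?f r"
    unfolding F using card_cycles_merge[OF Q fin(2) mem] iff that n by simp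
  show "c \<in> orbit_of (s \<circ> a) r \<longleftrightarrow> e' \<notin> orbit_of (s' \<circ> a') e"
  proof
    show "e' \<notin> orbit_of (s' \<circ> a') e" if "c \<in> orbit_of (s \<circ> a) r"
      unfolding F using orbit_of_split[OF Q fin(2) mem(1) _ m(5)] iff that by simp
    show "c \<in> orbit_of (s \<circ> a) r" if h: "e' \<notin> orbit_of (s' \<circ> a') e"
    proof (rule ccontr)
      assume "c \<notin> orbit_of ?f r"
      then have "orbit_of (s' \<circ> a') e = orbit_of ?q e \<union> orbit_of ?q e'"
        unfolding F using orbit_of_merge_first[OF Q fin(2) mem] iff by simp
      then show False using h orbit_of_self[of e' ?q] by simp
    qed
  qed
qed

text \<open>The new outer face runs from r to e and then to (s \<circ> a) c, from where it follows
  the old face from position k + 1 until it is back at r. These are 2 darts and N - k - 1 further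
  ones, where N is the old number.\<close>

lemma add_degree:
  assumes m: "dmap D s a r" "c \<in> D" "e \<notin> D" "e' \<notin> D" "e \<noteq> e'"
    and c: "c = ((s \<circ> a) ^^ k) r" "k < card (orbit_of (s \<circ> a) r)"
  defines "s' \<equiv> add_s s a r c e e'" and "a' \<equiv> add_a a e e'"
  shows "card (orbit_of (s' \<circ> a') r) = Suc (card (orbit_of (s \<circ> a) r) - k)"
proof -
  define f g where "f = s \<circ> a" and "g = s' \<circ> a'"
  note fg = f_def g_def s'_def a'_def
  define N where "N = card (orbit_of f r)"
  note c = c[folded f_def]
  note d = dmapD(1,2,5,6)[OF m(1)]
  have f: "f permutes D" unfolding f_def by (rule dmap_face_permutes[OF m(1)])
  have per: "(f ^^ N) r = r" "\<And>i. 0 < i \<Longrightarrow> i < N \<Longrightarrow> (f ^^ i) r \<noteq> r" "0 < N"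
    using funpow_card_orbit_of[OF f d(1)] unfolding N_def by blast+
  have inj: "inj_on (\<lambda>i. (f ^^ i) r) {..<N}"
    using card_orbit_of_period(2)[OF f per(3,1,2)] .
  have gr: "g r = e"
    unfolding fg using add_apply[OF m] d(3,4) m(3,4) by auto
  have ge: "g e = f c"
  proof -
    have "e' \<noteq> r" using d(3) m(4) by blast
    then show ?thesis unfolding fg using add_apply[OF m] m(5) by auto
  qed
  have gx: "g x = f x" if "x \<in> D" "x \<noteq> r" "x \<noteq> c" for x
  proof -
    have a: "a x \<in> D" "a x \<noteq> r" "a x \<noteq> a c"
      using that dmapD(4)[OF m(1), of x] dmapD(4)[OF m(1), of c] d(4) dmapD(10)[OF m(1)] by metis+
    then have "a x \<noteq> e" "a x \<noteq> e'" "x \<noteq> e" "x \<noteq> e'" using that m(3,4) by blast+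
    then show ?thesis unfolding fg using a add_apply[OF m] by auto
  qed
  \<comment> \<open>Between positions k + 1 and N - 1 the old walk meets neither r nor c, so f and g
    agree there.\<close>
  have pow: "(g ^^ Suc (Suc i)) r = (f ^^ (Suc k + i)) r" if "Suc k + i \<le> N" for i
    using that
  proof (induction i)
    case 0
    have "(g ^^ Suc (Suc 0)) r = g (g r)" by simp
    also have "\<dots> = f c" unfolding gr ge ..
    finally show ?case unfolding c(1) by simp
  next
    case (Suc i)
    let ?x = "(f ^^ (Suc k + i)) r"
    have "?x \<in> D" using orbit_of_funpow orbit_of_in[OF f d(3)] by blast
    moreover have "?x \<noteq> r" using per(2)[of "Suc k + i"] Suc(2) by simp
    moreover have "?x \<noteq> c"
      using inj_onD[OF inj, of "Suc k + i" k] Suc(2) c(1) by auto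
    ultimately have "g ?x = f ?x" by (rule gx)
    then show ?case using Suc by simp
  qed
  have kN: "k < N" using c(2) unfolding N_def .
  have "card (orbit_of g r) = Suc (Suc (N - Suc k))"
  proof (rule card_orbit_of_period(3))
    show "g permutes insert e (insert e' D)"
      using dmap_face_permutes[OF dmap_add[OF m]] unfolding fg .
    show "(g ^^ Suc (Suc (N - Suc k))) r = r"
      using pow[of "N - Suc k"] per(1) kN by simp
    fix i assume i: "0 < i" "i < Suc (Suc (N - Suc k))"
    show "(g ^^ i) r \<noteq> r"
    proof (cases "i = 1")
      case True
      then show ?thesis using gr d(3) m(3) by auto
    next
      case False
      then obtain j where j: "i = Suc (Suc j)" using i(1) by (cases i; cases "i - 1") auto
      then show ?thesis using pow[of j] per(2)[of "Suc k + j"] i by simp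
    qed
  qed simp
  then show ?thesis using kN unfolding N_def[symmetric] f_def[symmetric] g_def[symmetric] by simp
qed

section \<open>Deletion of the root edge\<close>

definition restr :: "(nat \<Rightarrow> nat) \<Rightarrow> nat set \<Rightarrow> nat \<Rightarrow> nat" where
  "restr p X = (\<lambda>x. if x \<in> X then p x else x)"

text \<open>An injection maps a finite closed set onto itself, so no point outside is mapped into
  it: closure of X entails closure of the complement.\<close>

lemma restr_permutes:
  assumes "p permutes E" "finite E" "X \<subseteq> E" "\<forall>x\<in>X. p x \<in> X"
  shows "restr p X permutes X" "restr p (E - X) permutes (E - X)"
    "restr p X \<circ> restr p (E - X) = p" "\<And>x. x \<in> E - X \<Longrightarrow> p x \<in> E - X"
proof -
  have inj: "inj p" using permutes_inj[OF assms(1)] .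
  have fin: "finite X" using assms(2,3) finite_subset by blast
  have im: "p ` X = X"
    using endo_inj_surj[OF fin] assms(4) inj by (meson image_subsetI inj_on_subset subset_UNIV)
  show co: "p x \<in> E - X" if "x \<in> E - X" for x
  proof -
    have "p x \<notin> X"
    proof
      assume "p x \<in> X"
      then obtain y where "y \<in> X" "p x = p y" using im by (metis imageE)
      then show False using that inj by (auto dest: injD)
    qed
    then show ?thesis using that permutes_in_image[OF assms(1)] by blast
  qed
  have *: "restr p Y permutes Y" if Y: "finite Y" "\<And>x. x \<in> Y \<Longrightarrow> p x \<in> Y" for Y
  proof (rule inj_imp_permutes)
    show "inj_on (restr p Y) Y"
      using inj by (auto simp: restr_def inj_on_def)
  qed (use Y in \<open>auto simp: restr_def\<close>)
  show "restr p X permutes X" using *[OF fin] assms(4) by blast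
  show "restr p (E - X) permutes (E - X)" using *[of "E - X"] assms(2) co by blast
  show "restr p X \<circ> restr p (E - X) = p"
  proof
    fix x
    consider "x \<in> X" | "x \<in> E - X" | "x \<notin> E" by blast
    then show "(restr p X \<circ> restr p (E - X)) x = p x"
    proof cases
      case 2
      then have "p x \<notin> X" using co by blast
      then show ?thesis using 2 by (simp add: restr_def)
    next
      case 3
      then have "p x = x" "x \<notin> X" using permutes_not_in[OF assms(1)] assms(3) by blast+
      then show ?thesis using 3 by (simp add: restr_def)
    qed (simp add: restr_def)
  qed
qed

lemma permutes_delete_fixed:
  assumes "p permutes D" "p e = e" shows "p permutes (D - {e})"
  by (rule permutes_superset[OF assms(1)]) (use assms(2) in auto)

lemma closed_restr:
  assumes "closed_under s a X"
  shows "closed_under (restr s Y) (restr a Z) X"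
  using assms unfolding closed_under_def restr_def by auto

text \<open>Turning the mate e' of the dart e after the root into a dangling dart and dropping e keeps all vertices.
  Whether e' is still reachable from the root decides between the two cases of the decomposition.\<close>

lemma dmap_cut:
  assumes m: "dmap D s a r" and ne: "s r \<noteq> r"
  defines "e \<equiv> s r"
  defines "e' \<equiv> a e"
  defines "st \<equiv> s \<circ> tr r e" and "at \<equiv> a \<circ> tr e e'" and "E \<equiv> D - {e}"
  shows "e \<in> D" "e' \<in> E" "e' \<noteq> r" "r \<in> E" "st permutes E" "at permutes E" "at e = e" "at e' = e'" "st e = e"
    "at (at x) = x" "x \<noteq> e \<Longrightarrow> x \<noteq> e' \<Longrightarrow> at x = a x" "a e' = e"
    "comp_of st at r \<subseteq> E"
    "closed_under st at X \<Longrightarrow> r \<in> X \<Longrightarrow> e' \<in> X \<Longrightarrow> closed_under s a (insert e X)"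
proof -
  note d = dmapD[OF m]
  show eD: "e \<in> D" unfolding e_def using d(5,9) by blast
  have nr: "e \<noteq> r" using ne unfolding e_def .
  have ne': "e' \<noteq> e" unfolding e'_def using d(7)[OF eD] nr by blast
  show ae': "a e' = e" unfolding e'_def using d(4) .
  show e'E: "e' \<in> E" unfolding E_def using ne' d(10)[OF eD] unfolding e'_def by blast
  show e'r: "e' \<noteq> r" using ae' d(6) nr by metis
  show rE: "r \<in> E" unfolding E_def using d(5) nr by blast
  show ste: "st e = e" unfolding st_def by (simp add: e_def)
  show ate: "at e = e" "at e' = e'" unfolding at_def using ae' by (simp_all add: e'_def)
  have stD: "st permutes D" unfolding st_def using permutes_comp_transpose[OF d(2,5) eD] .
  show stE: "st permutes E" unfolding E_def using permutes_delete_fixed[OF stD ste] .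
  have e'D: "e' \<in> D" using e'E unfolding E_def by blast
  have atD: "at permutes D" unfolding at_def using permutes_comp_transpose[OF d(3) eD e'D] .
  show atE: "at permutes E" unfolding E_def using permutes_delete_fixed[OF atD ate(1)] .
  show atx: "x \<noteq> e \<Longrightarrow> x \<noteq> e' \<Longrightarrow> at x = a x" for x unfolding at_def by simp
  show "at (at x) = x"
  proof (cases "x = e \<or> x = e'")
    case True
    then show ?thesis using ate by auto
  next
    case False
    then have "at x = a x" using atx by blast
    moreover have "a x \<noteq> e" "a x \<noteq> e'" using False d(4)[of x] ae' e'_def by metis+
    ultimately show ?thesis using atx d(4) by simp
  qed
  show "comp_of st at r \<subseteq> E" using comp_of_least[OF rE closed_permutes[OF stE atE]] .
  show "closed_under s a (insert e X)" if X: "closed_under st at X" "r \<in> X" "e' \<in> X"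
    unfolding closed_under_def
  proof
    fix x assume x: "x \<in> insert e X"
    have "st x \<in> X" "at x \<in> X" if "x \<in> X" for x using X(1) that unfolding closed_under_def by auto
    then have cl: "st r \<in> X" "x \<in> X \<Longrightarrow> st x \<in> X" "x \<in> X \<Longrightarrow> at x \<in> X" using X(2) by auto
    have s: "s x \<in> insert e X"
    proof (cases "x = r \<or> x = e")
      case True
      then show ?thesis using cl(1) unfolding st_def by (auto simp: e_def)
    next
      case False
      then have "st x = s x" unfolding st_def by simp
      then show ?thesis using x cl False by auto
    qed
    have "a x \<in> insert e X"
    proof (cases "x = e \<or> x = e'")
      case True
      then show ?thesis using X(3) ae' by (auto simp: e'_def)
    next
      case False
      then show ?thesis using x cl atx by auto
    qed
    with s show "s x \<in> insert e X \<and> a x \<in> insert e X" by blast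
  qed
qed

text \<open>D1 below is what r still reaches after the cut. If it misses e', the other darts must
  all be reachable from e' and form a second system rooted there. If it contains e', it is
  everything but e, and the dangling e' is taken out of its vertex as well.\<close>

lemma dmap_decomp:
  assumes m: "dmap D s a r"
  obtains "D = {r}" "s = id" "a = id"
  | D1 s1 a1 D2 s2 a2 r2 e where "dmap D1 s1 a1 r" "dmap D2 s2 a2 r2" "D1 \<inter> D2 = {}" "e \<notin> D1" "e \<notin> D2"
      "D = insert e (D1 \<union> D2)" "s = join_s s1 s2 r e" "a = join_a a1 a2 e r2"
  | D0 s0 a0 c e e' where "dmap D0 s0 a0 r" "c \<in> D0" "e \<notin> D0" "e' \<notin> D0" "e \<noteq> e'"
      "D = insert e (insert e' D0)" "s = add_s s0 a0 r c e e'" "a = add_a a0 e e'"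
proof (cases "s r = r")
  case True
  note d = dmapD[OF m]
  have "closed_under s a {r}" using True d(6) unfolding closed_under_def by simp
  then have "D \<subseteq> {r}" using dmap_least[OF m] by blast
  then have D: "D = {r}" using d(5) by blast
  then show ?thesis using that(1) d(2,3) by simp
next
  case ne: False
  note d = dmapD[OF m]
  define e where "e = s r"
  define e' where "e' = a e"
  define st at E where "st = s \<circ> tr r e" and "at = a \<circ> tr e e'" and "E = D - {e}"
  note cut = dmap_cut[OF m ne, folded e_def, folded e'_def, folded st_def at_def E_def]
  have finE: "finite E" unfolding E_def using d(1) by simp
  have eE: "e \<notin> E" unfolding E_def by simp
  have D: "D = insert e E" unfolding E_def using cut(1) by blast
  have sback: "st \<circ> tr r e = s" and aback: "at \<circ> tr e e' = a"
    unfolding st_def at_def by (simp_all add: comp_assoc)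
  have fixE: "at x = x \<longleftrightarrow> x = r \<or> x = e'" if "x \<in> E" for x
  proof (cases "x = e'")
    case False
    moreover have "x \<noteq> e" using that eE by blast
    ultimately show ?thesis using cut(11)[of x] d(6) d(7)[of x] that D by auto
  qed (use cut(8) in simp)
  define D1 where "D1 = comp_of st at r"
  have D1E: "D1 \<subseteq> E" unfolding D1_def using cut(13) .
  have clD1: "closed_under st at D1" unfolding D1_def using closed_comp_of .
  have rD1: "r \<in> D1" unfolding D1_def using comp_of_root .
  have c1: "\<And>x. x \<in> D1 \<Longrightarrow> st x \<in> D1" "\<And>x. x \<in> D1 \<Longrightarrow> at x \<in> D1"
    using clD1 unfolding closed_under_def by blast+
  show ?thesis
  proof (cases "e' \<in> D1")
    case False
    let ?D2 = "E - D1"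
    have c1': "\<forall>x\<in>D1. st x \<in> D1" "\<forall>x\<in>D1. at x \<in> D1" using c1 by blast+
    note rs = restr_permutes[OF cut(5) finE D1E c1'(1)]
    note ra = restr_permutes[OF cut(6) finE D1E c1'(2)]
    have e'2: "e' \<in> ?D2" using False cut(2) by blast
    have m1: "dmap D1 (restr st D1) (restr at D1) r"
      unfolding dmap_def
    proof (intro conjI allI ballI)
      show "finite D1" using finE D1E finite_subset by blast
      show "restr at D1 (restr at D1 x) = x" for x
        using c1(2) cut(10) by (simp add: restr_def)
      show "restr at D1 x = x \<longleftrightarrow> x = r" if "x \<in> D1" for x
        using fixE[of x] that False D1E by (auto simp: restr_def)
      show "comp_of (restr st D1) (restr at D1) r = D1"
      proof (rule comp_of_eqI[OF rD1])
        show "closed_under (restr st D1) (restr at D1) D1" using closed_restr[OF clD1] .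
        fix X assume X: "r \<in> X" "closed_under (restr st D1) (restr at D1) X" "X \<subseteq> D1"
        then have "st x \<in> X \<and> at x \<in> X" if "x \<in> X" for x
          using that subsetD[OF X(3) that] unfolding closed_under_def restr_def by auto
        then have "closed_under st at X" unfolding closed_under_def by blast
        then show "D1 \<subseteq> X" unfolding D1_def using comp_of_least X(1) by blast
      qed
    qed (fact rs(1) ra(1) rD1)+
    have m2: "dmap ?D2 (restr st ?D2) (restr at ?D2) e'"
      unfolding dmap_def
    proof (intro conjI allI ballI)
      show "finite ?D2" using finE by blast
      show "restr at ?D2 (restr at ?D2 x) = x" for x
      proof (cases "x \<in> ?D2")
        case True
        then show ?thesis unfolding restr_def using ra(4)[OF True] cut(10)[of x] by (simp only: if_True)
      qed (simp only: restr_def if_False)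
      show "restr at ?D2 x = x \<longleftrightarrow> x = e'" if "x \<in> ?D2" for x
        using fixE[of x] that rD1 by (auto simp: restr_def)
      show "comp_of (restr st ?D2) (restr at ?D2) e' = ?D2"
      proof (rule comp_of_eqI[OF e'2])
        show "closed_under (restr st ?D2) (restr at ?D2) ?D2"
          using closed_permutes[OF rs(2) ra(2)] .
        fix X assume X: "e' \<in> X" "closed_under (restr st ?D2) (restr at ?D2) X" "X \<subseteq> ?D2"
        have "st x \<in> X \<and> at x \<in> X" if "x \<in> X" for x
          using X(2) that subsetD[OF X(3) that] unfolding closed_under_def restr_def by auto
        \<comment> \<open>A closed set on the far side together with D1 is closed after the cut;
          putting e back makes it closed in the original system, hence all of D.\<close>
        then have "closed_under st at (D1 \<union> X)"
          using c1 unfolding closed_under_def by blast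
        then have "closed_under s a (insert e (D1 \<union> X))"
          by (rule cut(14)) (use rD1 X(1) in simp_all)
        then have "D \<subseteq> insert e (D1 \<union> X)" by (rule dmap_least[OF m, rotated]) (use rD1 in simp)
        then have "E \<subseteq> insert e (D1 \<union> X)" unfolding E_def by blast
        then show "?D2 \<subseteq> X" using eE by auto
      qed
    qed (fact rs(2) ra(2) e'2)+
    show ?thesis
    proof (rule that(2)[OF m1 m2])
      show "D = insert e (D1 \<union> ?D2)" using D D1E by blast
      show "s = join_s (restr st D1) (restr st ?D2) r e" unfolding join_s_def rs(3) sback ..
      show "a = join_a (restr at D1) (restr at ?D2) e e'" unfolding join_a_def ra(3) aback ..
    qed (use eE D1E in auto)
  next
    case True
    have "closed_under s a (insert e D1)" using cut(14)[OF clD1 rD1 True] .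
    then have "D \<subseteq> insert e D1" by (rule dmap_least[OF m, rotated]) (use rD1 in simp)
    then have D1: "D1 = E" using D eE D1E by blast
    let ?D0 = "E - {e'}"
    \<comment> \<open>f is the dart preceding e' at its vertex; once e' is taken out, f is followed
      by st e'.\<close>
    define f where "f = inv st e'"
    have stf: "st f = e'" unfolding f_def using permutes_inverses(1)[OF cut(5)] .
    have fE: "f \<in> E" using stf cut(2) permutes_in_image[OF cut(5)] by metis
    have least: "E \<subseteq> X" if "r \<in> X" "closed_under st at X" for X
      using comp_of_least[OF that] D1 unfolding D1_def by blast
    have inj: "inj st" using permutes_inj[OF cut(5)] .
    have at0: "at x \<in> ?D0" if "x \<in> ?D0" for x
    proof -
      have "at x \<noteq> at e'" using that cut(10)[of x] cut(10)[of e'] by auto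
      then have "at x \<noteq> e'" using cut(8) by simp
      then show ?thesis using that permutes_in_image[OF cut(6)] by blast
    qed
    \<comment> \<open>If e' were alone at its vertex, E without e' would be closed and contain r, so
      r would not reach e'.\<close>
    have ff: "f \<noteq> e'"
    proof
      assume f: "f = e'"
      have "closed_under st at ?D0"
        unfolding closed_under_def
      proof (intro ballI conjI at0)
        fix x assume x: "x \<in> ?D0"
        then have "st x \<noteq> st f" using f inj by (auto dest: injD)
        then have "st x \<noteq> e'" using stf by simp
        then show "st x \<in> ?D0" using x permutes_in_image[OF cut(5)] by blast
      qed
      then have "E \<subseteq> ?D0" by (rule least[rotated]) (use cut(3,4) in simp)
      then show False using cut(2) by blast
    qed
    define s0 where "s0 = st \<circ> tr f e'"
    have s0e: "s0 e' = e'" unfolding s0_def using stf by simp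
    have s0f: "s0 f = st e'" unfolding s0_def by simp
    have s0x: "s0 x = st x" if "x \<noteq> f" "x \<noteq> e'" for x using that unfolding s0_def by simp
    have s0E: "s0 permutes E" unfolding s0_def using permutes_comp_transpose[OF cut(5) fE cut(2)] .
    have s0D: "s0 permutes ?D0" using permutes_delete_fixed[OF s0E s0e] .
    have atD: "at permutes ?D0" using permutes_delete_fixed[OF cut(6,8)] .
    have f0: "f \<in> ?D0" using fE ff by blast
    \<comment> \<open>\<open>add_s\<close> inserts e' after the image of c under the involution;
      with this choice the image is f.\<close>
    define c where "c = at f"
    have c0: "c \<in> ?D0" unfolding c_def using at0[OF f0] .
    have atc: "at c = f" unfolding c_def using cut(10) .
    have r0: "r \<in> ?D0" using cut(3,4) by blast
    have m0: "dmap ?D0 s0 at r"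
      unfolding dmap_def
    proof (intro conjI allI ballI)
      show "finite ?D0" using finE by blast
      show "at (at x) = x" for x using cut(10) .
      show "at x = x \<longleftrightarrow> x = r" if "x \<in> ?D0" for x
        using fixE[of x] that by auto
      show "comp_of s0 at r = ?D0"
      proof (rule comp_of_eqI[OF r0])
        show "closed_under s0 at ?D0" using closed_permutes[OF s0D atD] .
        fix X assume X: "r \<in> X" "closed_under s0 at X" "X \<subseteq> ?D0"
        have cX: "x \<in> X \<Longrightarrow> s0 x \<in> X" "x \<in> X \<Longrightarrow> at x \<in> X" for x
          using X(2) unfolding closed_under_def by blast+
        show "?D0 \<subseteq> X"
        \<comment> \<open>Closure under st can fail only at f, where st f = e'. With f in X, adding
          e' repairs it; without f there is nothing to repair.\<close>
        proof (cases "f \<in> X")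
          case True
          have "closed_under st at (insert e' X)"
            unfolding closed_under_def
          proof
            fix x assume x: "x \<in> insert e' X"
            have "st x \<in> insert e' X"
              using x stf s0f s0x[of x] cX(1)[OF True] cX(1)[of x] by (metis insert_iff)
            moreover have "at x \<in> insert e' X" using x cX(2) cut(8) by auto
            ultimately show "st x \<in> insert e' X \<and> at x \<in> insert e' X" ..
          qed
          then have "E \<subseteq> insert e' X" by (rule least[rotated]) (use X(1) in simp)
          then show ?thesis by blast
        next
          case False
          have "closed_under st at X"
            unfolding closed_under_def
          proof
            fix x assume x: "x \<in> X"
            then have "x \<noteq> f" "x \<noteq> e'" using False X(3) by blast+
            then show "st x \<in> X \<and> at x \<in> X" using cX x s0x by metis
          qed
          then have "E \<subseteq> X" by (rule least[rotated]) (rule X(1))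
          then show ?thesis by blast
        qed
      qed
    qed (fact s0D atD r0)+
    show ?thesis
    proof (rule that(3)[OF m0 c0])
      show "e \<notin> ?D0" using eE by blast
      show "e' \<notin> ?D0" by blast
      show "e \<noteq> e'" using eE cut(2) by blast
      show "D = insert e (insert e' ?D0)" using D cut(2) by blast
      show "s = add_s s0 at r c e e'"
        unfolding add_s_def atc s0_def using sback by (simp add: comp_assoc)
      show "a = add_a at e e'" unfolding add_a_def aback ..
    qed
  qed
qed

section \<open>Decomposition trees\<close>

text \<open>In Non t k the new edge ends at the k-th corner along the outer face of t. The k corners passed
  on the way are cut off from the outer face, hence the degree tdeg t - k + 1.\<close>

datatype tree = Vtx | Iso tree tree | Non tree nat

fun tdeg :: "tree \<Rightarrow> nat" where
  "tdeg Vtx = 0"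
| "tdeg (Iso t u) = tdeg t + tdeg u + 2"
| "tdeg (Non t k) = Suc (tdeg t - k)"

fun tedges :: "tree \<Rightarrow> nat" where
  "tedges Vtx = 0"
| "tedges (Iso t u) = Suc (tedges t + tedges u)"
| "tedges (Non t k) = Suc (tedges t)"

fun twf :: "tree \<Rightarrow> bool" where
  "twf Vtx = True"
| "twf (Iso t u) = (twf t \<and> twf u)"
| "twf (Non t k) = (twf t \<and> k \<le> tdeg t)"

text \<open>A relation, because dart names are arbitrary; existence, uniqueness and invariance under
  relabelling are separate matters. The outer face has tdeg t + 1 darts with the dangling one, so k
  \<le> tdeg t makes k the index of exactly one corner.\<close>

inductive rep :: "nat set \<Rightarrow> (nat \<Rightarrow> nat) \<Rightarrow> (nat \<Rightarrow> nat) \<Rightarrow> nat \<Rightarrow> tree \<Rightarrow> bool" where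
  rep_Vtx: "rep {r} id id r Vtx"
| rep_Iso: "rep D1 s1 a1 r1 t1 \<Longrightarrow> rep D2 s2 a2 r2 t2 \<Longrightarrow> D1 \<inter> D2 = {} \<Longrightarrow> e \<notin> D1 \<Longrightarrow> e \<notin> D2 \<Longrightarrow>
    rep (insert e (D1 \<union> D2)) (join_s s1 s2 r1 e) (join_a a1 a2 e r2) r1 (Iso t1 t2)"
| rep_Non: "rep D s a r t \<Longrightarrow> e \<notin> D \<Longrightarrow> e' \<notin> D \<Longrightarrow> e \<noteq> e' \<Longrightarrow> k \<le> tdeg t \<Longrightarrow>
    rep (insert e (insert e' D)) (add_s s a r (((s \<circ> a) ^^ k) r) e e') (add_a a e e') r (Non t k)"

lemma dmap_single: "dmap {r} id id r"
  unfolding dmap_def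
  using comp_of_eqI[of r "{r}" id id] by (auto simp: closed_under_def)

lemma single_counts: "card (orbit_of id r) = 1" "card (cycles_of id {r}) = 1"
  using orbit_of_fixed[of id r] by (auto simp: cycles_of_image id_def)

lemma dmap_face_in: "dmap D s a r \<Longrightarrow> ((s \<circ> a) ^^ k) r \<in> D"
  using orbit_of_in[OF dmap_face_permutes dmapD(5)] orbit_of_funpow by blast

text \<open>Both successors come from the dangling dart: n edges give 2n + 1 darts, and the outer
  face has one dart more than its degree d. Belonging to no edge, it leaves Euler's formula in its
  usual form.\<close>

definition planar_dmap :: "nat set \<Rightarrow> (nat \<Rightarrow> nat) \<Rightarrow> (nat \<Rightarrow> nat) \<Rightarrow> nat \<Rightarrow> nat \<Rightarrow> nat \<Rightarrow> bool" where
  "planar_dmap D s a r n d \<longleftrightarrow> dmap D s a r \<and> card (orbit_of (s \<circ> a) r) = Suc d \<and>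
    card D = Suc (2 * n) \<and> nvert D s + nface D s a = n + 2"

lemma planar_single: "planar_dmap {r} id id r 0 0"
  unfolding planar_dmap_def id_comp single_counts by (intro conjI dmap_single) simp_all

lemma planar_join:
  assumes "planar_dmap D1 s1 a1 r1 n1 d1" "planar_dmap D2 s2 a2 r2 n2 d2" "D1 \<inter> D2 = {}" "e \<notin> D1" "e \<notin> D2"
  shows "planar_dmap (insert e (D1 \<union> D2)) (join_s s1 s2 r1 e) (join_a a1 a2 e r2) r1 (Suc (n1 + n2)) (d1 + d2 + 2)"
proof -
  have m: "dmap D1 s1 a1 r1" "dmap D2 s2 a2 r2" "D1 \<inter> D2 = {}" "e \<notin> D1" "e \<notin> D2"
    using assms unfolding planar_dmap_def by blast+
  show ?thesis
    using assms(1,2) dmap_join[OF m] join_counts[OF m] unfolding planar_dmap_def by simp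
qed

lemma planar_add:
  assumes "planar_dmap D s a r n d" "e \<notin> D" "e' \<notin> D" "e \<noteq> e'" "k \<le> d"
  shows "planar_dmap (insert e (insert e' D)) (add_s s a r (((s \<circ> a) ^^ k) r) e e') (add_a a e e') r
    (Suc n) (Suc (d - k))"
proof -
  let ?c = "((s \<circ> a) ^^ k) r"
  have d: "dmap D s a r" using assms unfolding planar_dmap_def by blast
  have m: "dmap D s a r" "?c \<in> D" "e \<notin> D" "e' \<notin> D" "e \<noteq> e'"
    using d dmap_face_in[OF d] assms(2-4) by blast+
  have o: "card (orbit_of (s \<circ> a) r) = Suc d" using assms(1) unfolding planar_dmap_def by blast
  then have "k < card (orbit_of (s \<circ> a) r)" using assms(5) by simp
  note deg = add_degree[OF m refl this, unfolded o]
  have pl: "card D = Suc (2 * n)" "nvert D s + nface D s a = n + 2"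
    using assms(1) unfolding planar_dmap_def by blast+
  note c = add_counts(1,2,4)[OF m]
  show ?thesis
    unfolding planar_dmap_def
  proof (intro conjI)
    show "dmap (insert e (insert e' D)) (add_s s a r ?c e e') (add_a a e e') r" by (rule dmap_add[OF m])
    show "card (orbit_of (add_s s a r ?c e e' \<circ> add_a a e e') r) = Suc (Suc (d - k))"
      unfolding deg using assms(5) by simp
    show "card (insert e (insert e' D)) = Suc (2 * Suc n)"
      unfolding c(3) pl(1) by simp
    show "nvert (insert e (insert e' D)) (add_s s a r ?c e e') +
      nface (insert e (insert e' D)) (add_s s a r ?c e e') (add_a a e e') = Suc n + 2"
      unfolding c(1) c(2)[OF orbit_of_funpow] using pl(2) by simp
  qed
qed

lemma rep_planar: "rep D s a r t \<Longrightarrow> planar_dmap D s a r (tedges t) (tdeg t) \<and> twf t"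
proof (induction rule: rep.induct)
  case (rep_Vtx r)
  show ?case using planar_single[of r] by (simp only: tedges.simps tdeg.simps twf.simps)
next
  case (rep_Iso D1 s1 a1 r1 t1 D2 s2 a2 r2 t2 e)
  then show ?case unfolding tedges.simps tdeg.simps twf.simps by (blast intro: planar_join)
next
  case (rep_Non D s a r t e e' k)
  then show ?case unfolding tedges.simps tdeg.simps twf.simps by (blast intro: planar_add)
qed

lemma rep_dmap: "rep D s a r t \<Longrightarrow> dmap D s a r"
  using rep_planar planar_dmap_def by blast

text \<open>A join adds the two bounds, with one edge more and one face less; any other edge creates
  at most one face. Planarity is not assumed, so the bound applies to the pieces of a decomposition
  before they are known to be planar.\<close>

lemma euler_bound:
  "dmap D s a r \<Longrightarrow> \<exists>n. card D = Suc (2 * n) \<and> nvert D s + nface D s a \<le> n + 2"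
proof (induction "card D" arbitrary: D s a r rule: less_induct)
  case less
  from less.prems show ?case
  proof (cases rule: dmap_decomp)
    case 1
    show ?thesis unfolding 1 id_comp single_counts by (rule exI[of _ 0]) simp
  next
    case (2 D1 s1 a1 D2 s2 a2 r2 e)
    note m = 2(1-5)
    note c = join_counts[OF m, folded 2(6-8)]
    obtain n1 where n1: "card D1 = Suc (2 * n1)" "nvert D1 s1 + nface D1 s1 a1 \<le> n1 + 2"
      using less.hyps[OF _ m(1)] c(4) by auto
    obtain n2 where n2: "card D2 = Suc (2 * n2)" "nvert D2 s2 + nface D2 s2 a2 \<le> n2 + 2"
      using less.hyps[OF _ m(2)] c(4) by auto
    show ?thesis by (rule exI[of _ "Suc (n1 + n2)"]) (use c n1 n2 in simp)
  next
    case (3 D0 s0 a0 c e e')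
    note m = 3(1-5)
    note c = add_counts[OF m, folded 3(6-8)]
    obtain n0 where n0: "card D0 = Suc (2 * n0)" "nvert D0 s0 + nface D0 s0 a0 \<le> n0 + 2"
      using less.hyps[OF _ m(1)] c(4) by auto
    have "nface D s a \<le> Suc (nface D0 s0 a0)" using c(2,3) by fastforce
    then show ?thesis by (intro exI[of _ "Suc n0"]) (use c(1,4) n0 in simp)
  qed
qed

lemma rep_exists:
  "dmap D s a r \<Longrightarrow> card D = Suc (2 * n) \<Longrightarrow> nvert D s + nface D s a = n + 2 \<Longrightarrow> \<exists>t. rep D s a r t"
proof (induction "card D" arbitrary: D s a r n rule: less_induct)
  case less
  from less.prems(1) show ?case
  proof (cases rule: dmap_decomp)
    case 1
    then show ?thesis using rep_Vtx by blast
  next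
    case (2 D1 s1 a1 D2 s2 a2 r2 e)
    note m = 2(1-5)
    note c = join_counts[OF m, folded 2(6-8)]
    obtain n1 where n1: "card D1 = Suc (2 * n1)" "nvert D1 s1 + nface D1 s1 a1 \<le> n1 + 2"
      using euler_bound[OF m(1)] by blast
    obtain n2 where n2: "card D2 = Suc (2 * n2)" "nvert D2 s2 + nface D2 s2 a2 \<le> n2 + 2"
      using euler_bound[OF m(2)] by blast
    have n: "n = Suc (n1 + n2)" using c(4) n1(1) n2(1) less.prems(2) by simp
    \<comment> \<open>The two bounds add up to an equality, so neither can be strict.\<close>
    have e: "nvert D1 s1 + nface D1 s1 a1 = n1 + 2" "nvert D2 s2 + nface D2 s2 a2 = n2 + 2"
      using n n1(2) n2(2) c(1,2) less.prems(3) by linarith+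
    obtain t1 where "rep D1 s1 a1 r t1"
      using less.hyps[OF _ m(1) n1(1) e(1)] c(4) by auto
    moreover obtain t2 where "rep D2 s2 a2 r2 t2"
      using less.hyps[OF _ m(2) n2(1) e(2)] c(4) by auto
    ultimately show ?thesis using rep_Iso[OF _ _ m(3-5)] 2(6-8) by blast
  next
    case (3 D0 s0 a0 c e e')
    note m = 3(1-5)
    note c = add_counts[OF m, folded 3(6-8)]
    obtain n0 where n0: "card D0 = Suc (2 * n0)" "nvert D0 s0 + nface D0 s0 a0 \<le> n0 + 2"
      using euler_bound[OF m(1)] by blast
    have n: "n = Suc n0" using c(4) n0(1) less.prems(2) by simp
    \<comment> \<open>Off the outer face the new edge would merge two faces, and vertices plus faces
      of the smaller system would number n0 + 4, above the bound n0 + 2.\<close>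
    have orb: "c \<in> orbit_of (s0 \<circ> a0) r"
    proof (rule ccontr)
      assume "c \<notin> orbit_of (s0 \<circ> a0) r"
      then show False using c(1,3) n n0(2) less.prems(3) by simp
    qed
    have e: "nvert D0 s0 + nface D0 s0 a0 = n0 + 2"
      using c(1) c(2)[OF orb] n less.prems(3) by simp
    obtain t where t: "rep D0 s0 a0 r t"
      using less.hyps[OF _ m(1) n0(1) e] c(4) by auto
    define N where "N = card (orbit_of (s0 \<circ> a0) r)"
    have p: "s0 \<circ> a0 permutes D0" "finite D0" using dmap_face_permutes dmapD(1) m(1) by blast+
    have "c \<in> (\<lambda>i. ((s0 \<circ> a0) ^^ i) r) ` {..<N}"
      unfolding N_def orbit_of_enum(1)[OF p, symmetric] by (rule orb)
    then obtain k where k: "c = ((s0 \<circ> a0) ^^ k) r" "k < N" by blast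
    have "k \<le> tdeg t" using k(2) rep_planar[OF t] unfolding N_def planar_dmap_def by simp
    then show ?thesis using rep_Non[OF t m(3-5)] 3(6-8) k(1) by blast
  qed
qed

text \<open>The bound N allows the second dart set of a join to be chosen beyond the first.\<close>

lemma rep_total:
  "twf t \<Longrightarrow> \<exists>D s a r. rep D s a r t \<and> D \<subseteq> {N..}"
proof (induction t arbitrary: N)
  case Vtx
  then show ?case using rep_Vtx[of N] by (metis atLeast_iff empty_subsetI insert_subset order_refl)
next
  case (Iso t1 t2)
  obtain D1 s1 a1 r1 where 1: "rep D1 s1 a1 r1 t1" "D1 \<subseteq> {N..}" using Iso by force
  have "finite D1" using dmapD(1)[OF rep_dmap[OF 1(1)]] .
  then obtain M where M: "D1 \<subseteq> {..M}" using finite_nat_set_iff_bounded_le by (metis atMost_iff subsetI)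
  obtain D2 s2 a2 r2 where 2: "rep D2 s2 a2 r2 t2" "D2 \<subseteq> {Suc (M + N)..}" using Iso by (metis twf.simps(2))
  have "finite D2" using dmapD(1)[OF rep_dmap[OF 2(1)]] .
  then obtain K where K: "D2 \<subseteq> {..K}" using finite_nat_set_iff_bounded_le by (metis atMost_iff subsetI)
  define e where "e = Suc (K + M + N)"
  have "D1 \<inter> D2 = {}" "e \<notin> D1" "e \<notin> D2" using M 2(2) K unfolding e_def by fastforce+
  from rep_Iso[OF 1(1) 2(1) this] show ?case
    using 1(2) 2(2) unfolding e_def
    by (intro exI conjI) (assumption, fastforce)
next
  case (Non t k)
  obtain D s a r where 1: "rep D s a r t" "D \<subseteq> {N..}" using Non by force
  have "finite D" using dmapD(1)[OF rep_dmap[OF 1(1)]] .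
  then obtain M where M: "D \<subseteq> {..M}" using finite_nat_set_iff_bounded_le by (metis atMost_iff subsetI)
  define e e' where "e = Suc (M + N)" and "e' = Suc e"
  have "e \<notin> D" "e' \<notin> D" "e \<noteq> e'" using M unfolding e_def e'_def by fastforce+
  from rep_Non[OF 1(1) this, of k] show ?case
    using 1(2) Non.prems unfolding e_def e'_def
    by (intro exI conjI) (fastforce, fastforce)
qed

section \<open>Uniqueness of decompositions\<close>

text \<open>Everything is read off from D, s, a and r1: e follows the root, r2 is its mate, D1 is
  the component left after the cut, and the permutations are restrictions. The last claim says that
  the two sides of an isthmus lie on one face.\<close>

lemma join_invert:
  assumes m: "dmap D1 s1 a1 r1" "dmap D2 s2 a2 r2" "D1 \<inter> D2 = {}" "e \<notin> D1" "e \<notin> D2"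
    and D: "D = insert e (D1 \<union> D2)" "s = join_s s1 s2 r1 e" "a = join_a a1 a2 e r2"
  shows "s r1 = e" "a e = r2" "D1 = comp_of (s \<circ> tr r1 e) (a \<circ> tr e r2) r1" "D2 = D - {e} - D1"
    "s1 = restr (s \<circ> tr r1 e) D1" "a1 = restr (a \<circ> tr e r2) D1"
    "s2 = restr (s \<circ> tr r1 e) D2" "a2 = restr (a \<circ> tr e r2) D2"
    "r1 \<noteq> e" "r2 \<in> orbit_of (s \<circ> a) e"
proof -
  note d1 = dmapD[OF m(1)] and d2 = dmapD[OF m(2)]
  show re: "r1 \<noteq> e" using d1(5) m(4) by blast
  show "s r1 = e" "a e = r2" using join_apply[OF m] D by simp_all
  have st: "s \<circ> tr r1 e = s1 \<circ> s2" and at: "a \<circ> tr e r2 = a1 \<circ> a2"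
    unfolding D join_s_def join_a_def by (simp_all add: comp_assoc)
  have dj: "x \<notin> D2" if "x \<in> D1" for x using m(3) that by blast
  have on1: "(s1 \<circ> s2) x = s1 x" "(a1 \<circ> a2) x = a1 x" if "x \<in> D1" for x
    using d2(11,12)[OF dj[OF that]] by simp_all
  have on2: "(s1 \<circ> s2) x = s2 x" "(a1 \<circ> a2) x = a2 x" if "x \<in> D2" for x
  proof -
    have "s2 x \<notin> D1" "a2 x \<notin> D1" using d2(9,10)[OF that] m(3) by blast+
    then show "(s1 \<circ> s2) x = s2 x" "(a1 \<circ> a2) x = a2 x" using d1(11,12) by simp_all
  qed
  have "comp_of (s1 \<circ> s2) (a1 \<circ> a2) r1 = D1"
  proof (rule comp_of_eqI[OF d1(5)])
    show "closed_under (s1 \<circ> s2) (a1 \<circ> a2) D1"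
      unfolding closed_under_def using on1 d1(9,10) by (metis (no_types))
    fix X assume X: "r1 \<in> X" "closed_under (s1 \<circ> s2) (a1 \<circ> a2) X" "X \<subseteq> D1"
    have "closed_under s1 a1 X"
      unfolding closed_under_def
    proof
      fix x assume x: "x \<in> X"
      then have "(s1 \<circ> s2) x \<in> X" "(a1 \<circ> a2) x \<in> X" "x \<in> D1"
        using X(2,3) unfolding closed_under_def by blast+
      then show "s1 x \<in> X \<and> a1 x \<in> X" using on1[of x] by metis
    qed
    then show "D1 \<subseteq> X" by (rule dmap_least[OF m(1) X(1)])
  qed
  then show "D1 = comp_of (s \<circ> tr r1 e) (a \<circ> tr e r2) r1" unfolding st at by simp
  show "D2 = D - {e} - D1" unfolding D using m(3-5) by blast
  show "s1 = restr (s \<circ> tr r1 e) D1" "a1 = restr (a \<circ> tr e r2) D1"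
    unfolding st at restr_def fun_eq_iff using on1 d1(11,12) by presburger+
  show "s2 = restr (s \<circ> tr r1 e) D2" "a2 = restr (a \<circ> tr e r2) D2"
    unfolding st at restr_def fun_eq_iff using on2 d2(11,12) by presburger+
  show "r2 \<in> orbit_of (s \<circ> a) e"
  proof -
    let ?Q = "(s1 \<circ> a1) \<circ> (s2 \<circ> a2) \<circ> tr r1 e"
    have f: "s \<circ> a = ?Q \<circ> tr e r2" unfolding D by (rule face_join[OF m])
    have fd: "s \<circ> a permutes D"
      using dmap_face_permutes[OF dmap_join[OF m]] unfolding D .
    have mem: "e \<in> D" "r2 \<in> D" unfolding D using d2(5) by auto
    have fin: "finite D" unfolding D using d1(1) d2(1) by simp
    have Q: "?Q permutes D"
    proof -
      have "?Q = s \<circ> a \<circ> tr e r2" unfolding f by (simp add: comp_assoc)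
      then show ?thesis using permutes_comp_transpose[OF fd mem] by simp
    qed
    have ne: "r2 \<notin> orbit_of ?Q e"
    proof
      have f1: "s1 \<circ> a1 permutes D1" and f2: "s2 \<circ> a2 permutes D2"
        using dmap_face_permutes m(1,2) by blast+
      have P: "(s1 \<circ> a1) \<circ> (s2 \<circ> a2) permutes D1 \<union> D2"
        by (rule permutes_compose[OF permutes_subset[OF f2] permutes_subset[OF f1]]) auto
      have fin': "finite (D1 \<union> D2)" and r1: "r1 \<in> D1 \<union> D2" and e: "e \<notin> D1 \<union> D2"
        using d1(1,5) d2(1) m(4,5) by auto
      assume "r2 \<in> orbit_of ?Q e"
      then have "r2 \<in> insert e (orbit_of ((s1 \<circ> a1) \<circ> (s2 \<circ> a2)) r1)"
        using card_cycles_attach(3)[OF P fin' r1 e] by simp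
      then have "r2 \<in> insert e (orbit_of (s1 \<circ> a1) r1)"
        using cycles_of_disjoint_union(2)[OF f1 f2 d1(1) d2(1) m(3) d1(5)] by simp
      then show False using orbit_of_in[OF f1 d1(5)] d2(5) m(3,5) by blast
    qed
    show ?thesis
      unfolding f using orbit_of_merge_first[OF Q fin mem ne] orbit_of_self[of r2 ?Q] by simp
  qed
qed

text \<open>The corner is recovered from the predecessor of e' after the cut, which is a0 c. In
  contrast to an isthmus, e and e' lie on different faces when c is on the outer face.\<close>

lemma add_invert:
  assumes m: "dmap D0 s0 a0 r" "c \<in> D0" "e \<notin> D0" "e' \<notin> D0" "e \<noteq> e'"
    and D: "D = insert e (insert e' D0)" "s = add_s s0 a0 r c e e'" "a = add_a a0 e e'"
  shows "s r = e" "a e = e'" "D0 = D - {e, e'}" "a0 = a \<circ> tr e e'"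
    "s0 = s \<circ> tr r e \<circ> tr (inv (s \<circ> tr r e) e') e'" "c = a0 (inv (s \<circ> tr r e) e')"
    "c \<in> orbit_of (s0 \<circ> a0) r \<Longrightarrow> e' \<notin> orbit_of (s \<circ> a) e" "r \<noteq> e"
proof -
  note d = dmapD[OF m(1)]
  show "r \<noteq> e" using d(5) m(3) by blast
  show "s r = e" "a e = e'" using add_apply[OF m] D by simp_all
  show "D0 = D - {e, e'}" unfolding D using m(3,4) by blast
  show "a0 = a \<circ> tr e e'" unfolding D add_a_def by (simp add: comp_assoc)
  have st: "s \<circ> tr r e = s0 \<circ> tr (a0 c) e'" unfolding D add_s_def by (simp add: comp_assoc)
  have "(s \<circ> tr r e) (a0 c) = e'" unfolding st using d(11)[OF m(4)] by simp
  moreover have "inj (s \<circ> tr r e)"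
    unfolding st using d(2) permutes_inj by (metis inj_compose inj_transpose)
  ultimately have f: "inv (s \<circ> tr r e) e' = a0 c" using inv_f_f by metis
  show "s0 = s \<circ> tr r e \<circ> tr (inv (s \<circ> tr r e) e') e'" unfolding f unfolding st by (simp add: comp_assoc)
  show "c = a0 (inv (s \<circ> tr r e) e')" unfolding f using d(4) by simp
  show "c \<in> orbit_of (s0 \<circ> a0) r \<Longrightarrow> e' \<notin> orbit_of (s \<circ> a) e"
    using add_counts(5)[OF m] unfolding D by blast
qed

lemma rep_IsoE:
  assumes "rep D s a r (Iso t1 t2)"
  obtains D1 s1 a1 D2 s2 a2 r2 e where "rep D1 s1 a1 r t1" "rep D2 s2 a2 r2 t2"
    "dmap D1 s1 a1 r" "dmap D2 s2 a2 r2" "D1 \<inter> D2 = {}" "e \<notin> D1" "e \<notin> D2"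
    "D = insert e (D1 \<union> D2)" "s = join_s s1 s2 r e" "a = join_a a1 a2 e r2"
  using assms by (cases rule: rep.cases) (blast intro: rep_dmap that)

lemma rep_NonE:
  assumes "rep D s a r (Non t k)"
  obtains D0 s0 a0 c e e' where "rep D0 s0 a0 r t" "c = ((s0 \<circ> a0) ^^ k) r" "k \<le> tdeg t"
    "dmap D0 s0 a0 r" "c \<in> D0" "e \<notin> D0" "e' \<notin> D0" "e \<noteq> e'"
    "D = insert e (insert e' D0)" "s = add_s s0 a0 r c e e'" "a = add_a a0 e e'"
  using assms by (cases rule: rep.cases) (use rep_dmap dmap_face_in that in metis)

lemma rep_VtxE: "rep D s a r Vtx \<Longrightarrow> D = {r} \<and> s = id \<and> a = id"
  by (erule rep.cases) auto

text \<open>Both tests, whether s fixes r and whether the root edge has one face on its two sides,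
  mention only the permutations; so the last rule of \<open>rep\<close> does not depend on the
  chosen tree.\<close>

lemma rep_shape:
  assumes "rep D s a r t"
  shows "s r = r \<longleftrightarrow> t = Vtx"
    and "s r \<noteq> r \<Longrightarrow> a (s r) \<in> orbit_of (s \<circ> a) (s r) \<longleftrightarrow> (\<exists>t1 t2. t = Iso t1 t2)"
proof -
  have "(s r = r \<longleftrightarrow> t = Vtx) \<and> (s r \<noteq> r \<longrightarrow> (a (s r) \<in> orbit_of (s \<circ> a) (s r) \<longleftrightarrow> (\<exists>t1 t2. t = Iso t1 t2)))"
  proof (cases t)
    case Vtx
    then show ?thesis using rep_VtxE assms by fastforce
  next
    case (Iso t1 t2)
    from assms[unfolded Iso] show ?thesis
    proof (cases rule: rep_IsoE)
      case (1 D1 s1 a1 D2 s2 a2 r2 e)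
      note i = join_invert[OF 1(3-10)]
      show ?thesis using i(1,2,9,10) Iso by auto
    qed
  next
    case (Non t k)
    from assms[unfolded Non] show ?thesis
    proof (cases rule: rep_NonE)
      case (1 D0 s0 a0 c e e')
      note i = add_invert[OF 1(4-11)]
      have "c \<in> orbit_of (s0 \<circ> a0) r" unfolding 1(2) by (rule orbit_of_funpow)
      then show ?thesis using i(1,2,7,8) Non by auto
    qed
  qed
  then show "s r = r \<longleftrightarrow> t = Vtx"
    "s r \<noteq> r \<Longrightarrow> a (s r) \<in> orbit_of (s \<circ> a) (s r) \<longleftrightarrow> (\<exists>t1 t2. t = Iso t1 t2)" by blast+
qed

lemma rep_unique: "rep D s a r t \<Longrightarrow> rep D s a r t' \<Longrightarrow> t = t'"
proof (induction t arbitrary: D s a r t')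
  case Vtx
  then show ?case using rep_shape(1) by metis
next
  case (Iso t1 t2)
  have "s r \<noteq> r" using rep_shape(1)[OF Iso.prems(1)] by simp
  then obtain t1' t2' where t': "t' = Iso t1' t2'"
    using rep_shape(2)[OF Iso.prems(1)] rep_shape(2)[OF Iso.prems(2)] by auto
  from Iso.prems(1) show ?case
  proof (cases rule: rep_IsoE)
    case 1: (1 D1 s1 a1 D2 s2 a2 r2 e)
    from Iso.prems(2)[unfolded t'] show ?thesis
    proof (cases rule: rep_IsoE)
      case 2: (1 E1 u1 b1 E2 u2 b2 q2 f)
      note i1 = join_invert[OF 1(3-10)] and i2 = join_invert[OF 2(3-10)]
      have e: "f = e" using i1(1) i2(1) by simp
      have q: "q2 = r2" using i1(2) i2(2) e by simp
      have E1: "E1 = D1" using i1(3) i2(3) e q by simp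
      have E2: "E2 = D2" using i1(4) i2(4) e E1 by simp
      have "u1 = s1" "b1 = a1" "u2 = s2" "b2 = a2"
        using i1(5-8) i2(5-8) e q E1 E2 by simp_all
      then show ?thesis
        using Iso.IH(1)[OF 1(1)] Iso.IH(2)[OF 1(2)] 2(1,2) E1 E2 q t' by simp
    qed
  qed
next
  case (Non t k)
  have ne: "s r \<noteq> r" using rep_shape(1)[OF Non.prems(1)] by simp
  then have "\<nexists>t1 t2. t' = Iso t1 t2" "t' \<noteq> Vtx"
    using rep_shape(2)[OF Non.prems(1)] rep_shape[OF Non.prems(2)] by auto
  then obtain t2 k2 where t': "t' = Non t2 k2" by (cases t') auto
  from Non.prems(1) show ?case
  proof (cases rule: rep_NonE)
    case 1: (1 D0 s0 a0 c e e')
    from Non.prems(2)[unfolded t'] show ?thesis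
    proof (cases rule: rep_NonE)
      case 2: (1 E0 u0 b0 q f f')
      note i1 = add_invert[OF 1(4-11)] and i2 = add_invert[OF 2(4-11)]
      have e: "f = e" using i1(1) i2(1) by simp
      have e': "f' = e'" using i1(2) i2(2) e by simp
      have E: "E0 = D0" "b0 = a0" "u0 = s0" using i1(3-5) i2(3-5) e e' by simp_all
      have "q = c" using i1(6) i2(6) e e' E(2) by simp
      have t: "t2 = t" using Non.IH[OF 1(1)] 2(1) E by simp
      have o: "card (orbit_of (s0 \<circ> a0) r) = Suc (tdeg t)"
        using rep_planar[OF 1(1)] unfolding planar_dmap_def by blast
      \<comment> \<open>Equal corners have equal indices because the first tdeg t + 1 iterates of r
        are distinct.\<close>
      have "inj_on (\<lambda>i. ((s0 \<circ> a0) ^^ i) r) {..<Suc (tdeg t)}"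
        using orbit_of_enum(2)[OF dmap_face_permutes[OF 1(4)] dmapD(1)[OF 1(4)], of r] unfolding o .
      moreover have "((s0 \<circ> a0) ^^ k) r = ((s0 \<circ> a0) ^^ k2) r"
        using 1(2) 2(2) \<open>q = c\<close> E by simp
      ultimately have "k = k2" using 1(3) 2(3) t by (auto dest: inj_onD)
      then show ?thesis using t t' by simp
    qed
  qed
qed

section \<open>Relabelling of darts and isomorphism\<close>

definition conj_by :: "(nat \<Rightarrow> nat) \<Rightarrow> (nat \<Rightarrow> nat) \<Rightarrow> nat \<Rightarrow> nat" where
  "conj_by h p = h \<circ> p \<circ> inv h"

lemma conj_by_props:
  assumes "bij h"
  shows "conj_by h p (h x) = h (p x)" "conj_by h (p \<circ> q) = conj_by h p \<circ> conj_by h q"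
    "conj_by h (tr x y) = tr (h x) (h y)" "conj_by h id = id"
    "(conj_by h p ^^ k) (h x) = h ((p ^^ k) x)"
proof -
  have i: "inv h (h x) = x" "h (inv h x) = x" for x
    using assms by (simp_all add: bij_is_inj bij_is_surj surj_f_inv_f)
  show 1: "conj_by h p (h x) = h (p x)" for x by (simp add: conj_by_def i)
  show "conj_by h (p \<circ> q) = conj_by h p \<circ> conj_by h q" by (simp add: conj_by_def i fun_eq_iff)
  have "h \<circ> tr x y = tr (h x) (h y) \<circ> h" using comp_tr_eq[OF bij_is_inj[OF assms]] .
  then show "conj_by h (tr x y) = tr (h x) (h y)"
    unfolding conj_by_def by (simp add: comp_assoc fun_eq_iff i)
  show "conj_by h id = id" unfolding conj_by_def by (simp add: fun_eq_iff i)
  show "(conj_by h p ^^ k) (h x) = h ((p ^^ k) x)" by (induction k) (simp_all add: 1)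
qed

text \<open>Conjugation by a bijection commutes with composition and carries transpositions to
  transpositions, and both constructions are built from these.\<close>

lemma rep_conj:
  assumes "bij h"
  shows "rep D s a r t \<Longrightarrow> rep (h ` D) (conj_by h s) (conj_by h a) (h r) t"
proof (induction rule: rep.induct)
  case (rep_Vtx r)
  show ?case unfolding image_insert image_empty conj_by_props(4)[OF assms] by (rule rep.rep_Vtx)
next
  case (rep_Iso D1 s1 a1 r1 t1 D2 s2 a2 r2 t2 e)
  have inj: "inj h" using assms bij_is_inj by blast
  have d: "h ` D1 \<inter> h ` D2 = {}" using rep_Iso(3) inj by (metis image_Int image_empty)
  have n: "h e \<notin> h ` D1" "h e \<notin> h ` D2" using rep_Iso(4,5) inj by (auto dest: injD)
  show ?case
    using rep.rep_Iso[OF rep_Iso(6,7) d n]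
    unfolding join_s_def join_a_def image_insert image_Un conj_by_props(2,3)[OF assms] .
next
  case (rep_Non D s a r t e e' k)
  have inj: "inj h" using assms bij_is_inj by blast
  have n: "h e \<notin> h ` D" "h e' \<notin> h ` D" "h e \<noteq> h e'" using rep_Non(2-4) inj by (auto dest: injD)
  have c: "((conj_by h s \<circ> conj_by h a) ^^ k) (h r) = h (((s \<circ> a) ^^ k) r)"
    using conj_by_props(5)[OF assms, of k "s \<circ> a" r] unfolding conj_by_props(2)[OF assms] .
  have "rep (insert (h e) (insert (h e') (h ` D)))
     (add_s (conj_by h s) (conj_by h a) (h r) (h (((s \<circ> a) ^^ k) r)) (h e) (h e'))
     (add_a (conj_by h a) (h e) (h e')) (h r) (Non t k)"
    using rep.rep_Non[OF rep_Non(6) n rep_Non(5)] unfolding c .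
  then show ?case
    unfolding add_s_def add_a_def image_insert conj_by_props(2,3)[OF assms] conj_by_props(1)[OF assms] .
qed

lemma funpow_semiconj:
  assumes "\<And>j. (f ^^ j) x \<in> D" "\<And>y. y \<in> D \<Longrightarrow> h (f y) = g (h y)"
  shows "h ((f ^^ i) x) = (g ^^ i) (h x)"
  by (induction i) (use assms in auto)

text \<open>Isomorphisms of the parts are glued, and new darts are sent to new darts. The places of
  gluing correspond: the roots by induction, and the corner c because it is the same iterate of the
  face permutation in both systems.\<close>

lemma rep_iso:
  "rep D s a r t \<Longrightarrow> rep D' s' a' r' t \<Longrightarrow>
    \<exists>h. bij_betw h D D' \<and> h r = r' \<and> (\<forall>x\<in>D. h (s x) = s' (h x) \<and> h (a x) = a' (h x))"
proof (induction t arbitrary: D s a r D' s' a' r')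
  case Vtx
  then show ?case using rep_VtxE[OF Vtx(1)] rep_VtxE[OF Vtx(2)]
    by (intro exI[of _ "\<lambda>_. r'"]) (auto simp: bij_betw_def)
next
  case (Iso t1 t2)
  from Iso.prems(1) show ?case
  proof (cases rule: rep_IsoE)
    case 1: (1 D1 s1 a1 D2 s2 a2 r2 e)
    from Iso.prems(2) show ?thesis
    proof (cases rule: rep_IsoE)
      case 2: (1 E1 u1 b1 E2 u2 b2 q2 f)
      obtain h1 where h1: "bij_betw h1 D1 E1" "h1 r = r'" "\<And>x. x \<in> D1 \<Longrightarrow> h1 (s1 x) = u1 (h1 x)"
        "\<And>x. x \<in> D1 \<Longrightarrow> h1 (a1 x) = b1 (h1 x)"
        using Iso.IH(1)[OF 1(1) 2(1)] by blast
      obtain h2 where h2: "bij_betw h2 D2 E2" "h2 r2 = q2" "\<And>x. x \<in> D2 \<Longrightarrow> h2 (s2 x) = u2 (h2 x)"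
        "\<And>x. x \<in> D2 \<Longrightarrow> h2 (a2 x) = b2 (h2 x)"
        using Iso.IH(2)[OF 1(2) 2(2)] by blast
      define h where "h x = (if x = e then f else if x \<in> D1 then h1 x else h2 x)" for x
      note d1 = dmapD[OF 1(3)] and d2 = dmapD[OF 1(4)]
      have he: "h e = f" by (simp add: h_def)
      have hD1: "h x = h1 x" if "x \<in> D1" for x using that 1(6) by (auto simp: h_def)
      have hD2: "h x = h2 x" if "x \<in> D2" for x using that 1(5,7) by (auto simp: h_def)
      have b1: "bij_betw h D1 E1" using h1(1) hD1 by (simp cong: bij_betw_cong)
      have b2: "bij_betw h D2 E2" using h2(1) hD2 by (simp cong: bij_betw_cong)
      have "bij_betw h (D1 \<union> D2) (E1 \<union> E2)" using bij_betw_combine[OF b1 b2 2(5)] .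
      then have bij: "bij_betw h D D'"
        unfolding 1(8) 2(8) using notIn_Un_bij_betw[of e "D1 \<union> D2" h "E1 \<union> E2"] 1(6,7) 2(6,7) he by auto
      have inE: "h x \<in> E1" if "x \<in> D1" for x using that b1 bij_betwE by blast
      have inE2: "h x \<in> E2" if "x \<in> D2" for x using that b2 bij_betwE by blast
      have hr: "h r = r'" using hD1[OF d1(5)] h1(2) by simp
      have hr2: "h r2 = q2" using hD2[OF d2(5)] h2(2) by simp
      note S = join_apply(1)[OF 1(3-7), folded 1(9)] and A = join_apply(2)[OF 1(3-7), folded 1(10)]
      note S' = join_apply(1)[OF 2(3-7), folded 2(9)] and A' = join_apply(2)[OF 2(3-7), folded 2(10)]
      have "h (s x) = s' (h x) \<and> h (a x) = a' (h x)" if x: "x \<in> D" for x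
      proof -
        consider "x = e" | "x \<in> D1" | "x \<in> D2" using x 1(8) by blast
        then show ?thesis
        proof cases
          case 1
          have "e \<noteq> r" "f \<noteq> r'" using d1(5) \<open>e \<notin> D1\<close> inE[OF d1(5)] hr \<open>f \<notin> E1\<close> by metis+
          then show ?thesis
            using S[of e] A[of e] S'[of f] A'[of f] he hr2 1 hD1[OF d1(9)[OF d1(5)]] h1(3)[OF d1(5)] h1(2)
            by simp
        next
          case x1: 2
          have n: "x \<noteq> e" "h x \<noteq> f" "x \<noteq> r2" "h x \<noteq> q2"
            using x1 inE[OF x1] 1(5,6) 2(5,6) d2(5) dmapD(5)[OF 2(4)] by blast+
          \<comment> \<open>The explicit formulas branch on equality with the root; injectivity
            makes the branches match.\<close>
          have "h x = r' \<longleftrightarrow> x = r"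
            using x1 d1(5) hr b1 by (metis bij_betw_inv_into_left)
          then show ?thesis
            using S[of x] A[of x] S'[of "h x"] A'[of "h x"] n x1 inE[OF x1] he hD1[OF x1]
              hD1[OF d1(9)[OF x1]] hD1[OF d1(10)[OF x1]] h1(3,4)[OF x1] by simp
        next
          case x2: 3
          have n: "x \<noteq> e" "h x \<noteq> f" "x \<noteq> r" "h x \<noteq> r'" "x \<notin> D1" "h x \<notin> E1"
            using x2 inE2[OF x2] 1(5,7) 2(5,7) d1(5) dmapD(5)[OF 2(3)] by blast+
          have "h x = q2 \<longleftrightarrow> x = r2"
            using x2 d2(5) hr2 b2 by (metis bij_betw_inv_into_left)
          then show ?thesis
            using S[of x] A[of x] S'[of "h x"] A'[of "h x"] n x2 inE2[OF x2] he hD2[OF x2]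
              hD2[OF d2(9)[OF x2]] hD2[OF d2(10)[OF x2]] h2(3,4)[OF x2] by simp
        qed
      qed
      then show ?thesis using bij hr by blast
    qed
  qed
next
  case (Non t k)
  from Non.prems(1) show ?case
  proof (cases rule: rep_NonE)
    case 1: (1 D0 s0 a0 c e e')
    from Non.prems(2) show ?thesis
    proof (cases rule: rep_NonE)
      case 2: (1 E0 u0 b0 q f f')
      obtain h0 where h0: "bij_betw h0 D0 E0" "h0 r = r'" "\<And>x. x \<in> D0 \<Longrightarrow> h0 (s0 x) = u0 (h0 x)"
        "\<And>x. x \<in> D0 \<Longrightarrow> h0 (a0 x) = b0 (h0 x)"
        using Non.IH[OF 1(1) 2(1)] by blast
      note d = dmapD[OF 1(4)]
      have "h0 (((s0 \<circ> a0) ^^ i) r) = ((u0 \<circ> b0) ^^ i) (h0 r)" for i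
      proof (rule funpow_semiconj)
        show "((s0 \<circ> a0) ^^ j) r \<in> D0" for j using dmap_face_in[OF 1(4)] .
        show "h0 ((s0 \<circ> a0) x) = (u0 \<circ> b0) (h0 x)" if "x \<in> D0" for x
          using h0(3)[OF d(10)[OF that]] h0(4)[OF that] by simp
      qed
      then have hc0: "h0 c = q" unfolding 1(2) 2(2) h0(2) .
      define h where "h x = (if x = e then f else if x = e' then f' else h0 x)" for x
      have he: "h e = f" "h e' = f'" using 1(8) by (simp_all add: h_def)
      have hD: "h x = h0 x" if "x \<in> D0" for x using that 1(6,7) by (auto simp: h_def)
      have b0: "bij_betw h D0 E0" using h0(1) hD by (simp cong: bij_betw_cong)
      have "bij_betw h (insert e' D0) (insert f' E0)"
        using notIn_Un_bij_betw[of e' D0 h E0] b0 1(7) 2(7) he by auto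
      then have bij: "bij_betw h D D'"
        unfolding 1(9) 2(9) using notIn_Un_bij_betw[of e "insert e' D0" h "insert f' E0"] 1(6,8) 2(6,8) he by auto
      have inE: "h x \<in> E0" if "x \<in> D0" for x using that b0 bij_betwE by blast
      have hr: "h r = r'" using hD[OF d(5)] h0(2) by simp
      have hac: "h (a0 c) = b0 q" using hD[OF d(10)[OF 1(5)]] h0(4)[OF 1(5)] hc0 by simp
      have heq: "h x = h y \<longleftrightarrow> x = y" if "x \<in> D" "y \<in> D" for x y
        using that bij by (metis bij_betw_inv_into_left)
      have S0: "h (s0 x) = u0 (h x)" "h (a0 x) = b0 (h x)" if "x \<in> D0" for x
        using that hD hD[OF d(9)[OF that]] hD[OF d(10)[OF that]] h0(3,4) by simp_all
      have mem: "r \<in> D" "e \<in> D" "e' \<in> D" "a0 c \<in> D" "a0 c \<in> D0"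
        using d(5) d(10)[OF 1(5)] 1(9) by auto
      note S = add_apply(1)[OF 1(4-8), folded 1(10)] and A = add_apply(2)[OF 1(4-8), folded 1(11)]
      note S' = add_apply(1)[OF 2(4-8), folded 2(10)] and A' = add_apply(2)[OF 2(4-8), folded 2(11)]
      have c0: "h x = r' \<longleftrightarrow> x = r" "h x = f \<longleftrightarrow> x = e" "h x = f' \<longleftrightarrow> x = e'" "h x = b0 q \<longleftrightarrow> x = a0 c" if "x \<in> D" for x
        using heq[OF that] mem hr he hac by metis+
      have bq: "b0 q = r' \<longleftrightarrow> a0 c = r" using c0(1)[OF mem(4)] hac by simp
      have "h (s x) = s' (h x) \<and> h (a x) = a' (h x)" if x: "x \<in> D" for x
      proof
        have x0: "x \<in> D0" if "x \<noteq> e" "x \<noteq> e'" using x 1(9) that by blast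
        show "h (a x) = a' (h x)"
          unfolding A A' using c0[OF x] he S0(2) x0 by simp
        show "h (s x) = s' (h x)"
          unfolding S S' using c0[OF x] bq he hr S0(1) x0 d(5) mem(5) hac 1(8) 2(8) by auto
      qed
      then show ?thesis using bij hr by blast
    qed
  qed
qed

section \<open>Rooted maps and decomposition trees\<close>

text \<open>g is a complete invariant with range B. Reflexivity is demanded on S only, because
  renaming does not relate a term to itself if a free variable is missing from its context.\<close>

lemma quotient_bij:
  assumes "sym R" "trans R" "\<And>x. x \<in> S \<Longrightarrow> (x, x) \<in> R"
    and g: "g ` S = B" "\<And>x y. x \<in> S \<Longrightarrow> y \<in> S \<Longrightarrow> (x, y) \<in> R \<longleftrightarrow> g x = g y"
  shows "\<exists>f. bij_betw f (S // R) B"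
proof -
  define f where "f C = g (SOME x. x \<in> S \<and> x \<in> C)" for C
  have f: "f (R `` {x}) = g x" if x: "x \<in> S" for x
  proof -
    let ?y = "SOME y. y \<in> S \<and> y \<in> R `` {x}"
    have "?y \<in> S \<and> ?y \<in> R `` {x}" by (rule someI[of _ x]) (use x assms(3) in blast)
    then show ?thesis unfolding f_def using g(2)[OF x, of ?y] by simp
  qed
  have R: "R `` {x} = R `` {y}" if "(x, y) \<in> R" for x y
    using that assms(1,2) by (auto dest: symD transD)
  have "inj_on f (S // R)"
  proof (rule inj_onI)
    fix C C' assume "C \<in> S // R" "C' \<in> S // R" and e: "f C = f C'"
    then obtain x y where "x \<in> S" "C = R `` {x}" "y \<in> S" "C' = R `` {y}" by (auto elim!: quotientE)
    then show "C = C'" using e f g(2) R by simp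
  qed
  moreover have "f ` (S // R) = B"
    unfolding g(1)[symmetric] quotient_def using f by (auto simp: image_iff)
  ultimately show ?thesis unfolding bij_betw_def by blast
qed

text \<open>The dangling dart 2 * n is inserted right before the root dart.\<close>

definition root_s :: "nat \<Rightarrow> (nat \<Rightarrow> nat) \<Rightarrow> nat \<Rightarrow> nat \<Rightarrow> nat" where
  "root_s n s r = s \<circ> tr (inv s r) (2 * n)"

lemma darts_out: "2 * n \<notin> darts n" "finite (darts n)"
  by (simp_all add: darts_def)

text \<open>The dart a (inv s r) precedes r on the outer face. In the face permutation the dangling
  dart enters between the two, so only this face grows.\<close>

lemma dangle_face:
  assumes "s permutes darts n" "a permutes darts n" "\<And>x. a (a x) = x" "r \<in> darts n"
  shows "inv s r \<in> darts n" "root_s n s r \<circ> a = s \<circ> a \<circ> tr (a (inv s r)) (2 * n)"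
    "card (cycles_of (root_s n s r) (insert (2 * n) (darts n))) = card (cycles_of s (darts n))"
    "card (cycles_of (root_s n s r \<circ> a) (insert (2 * n) (darts n))) = card (cycles_of (s \<circ> a) (darts n))"
    "card (orbit_of (root_s n s r \<circ> a) (2 * n)) = Suc (card (orbit_of (s \<circ> a) r))"
    "root_s n s r permutes insert (2 * n) (darts n)"
proof -
  let ?e = "2 * n" and ?q = "inv s r"
  have sq: "s ?q = r" using permutes_inverses(1)[OF assms(1)] .
  show q: "?q \<in> darts n" using sq assms(4) permutes_in_image[OF assms(1)] by metis
  have ae: "a ?e = ?e" using permutes_not_in[OF assms(2) darts_out(1)] .
  have aq: "a ?q \<in> darts n" using q permutes_in_image[OF assms(2)] by blast
  have "a \<circ> tr (a ?q) ?e = tr ?q ?e \<circ> a"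
    using comp_tr_eq[OF permutes_inj[OF assms(2)], of "a ?q" ?e] assms(3) ae by simp
  then show F: "root_s n s r \<circ> a = s \<circ> a \<circ> tr (a ?q) ?e"
    unfolding root_s_def by (simp add: comp_assoc)
  have f: "s \<circ> a permutes darts n" using permutes_compose[OF assms(2,1)] .
  note at1 = card_cycles_attach[OF assms(1) darts_out(2) q darts_out(1), folded root_s_def]
  note at2 = card_cycles_attach[OF f darts_out(2) aq darts_out(1), folded F]
  show "card (cycles_of (root_s n s r) (insert ?e (darts n))) = card (cycles_of s (darts n))"
    by (rule at1(1))
  show "root_s n s r permutes insert ?e (darts n)" by (rule at1(6))
  show "card (cycles_of (root_s n s r \<circ> a) (insert ?e (darts n))) = card (cycles_of (s \<circ> a) (darts n))"
    by (rule at2(1))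
  have "(s \<circ> a) (a ?q) = r" using sq assms(3) by simp
  then have "r \<in> orbit_of (s \<circ> a) (a ?q)" using orbit_of_step[OF orbit_of_self, of "s \<circ> a" "a ?q"] by metis
  then have o: "orbit_of (s \<circ> a) (a ?q) = orbit_of (s \<circ> a) r"
    using orbit_of_eq[OF f darts_out(2)] by blast
  have "?e \<notin> orbit_of (s \<circ> a) r" "finite (orbit_of (s \<circ> a) r)"
    using orbit_of_in[OF f assms(4)] darts_out finite_subset by blast+
  then show "card (orbit_of (root_s n s r \<circ> a) ?e) = Suc (card (orbit_of (s \<circ> a) r))"
    using at2(3) o by simp
qed

lemma is_rmapD:
  assumes "is_rmap n (s, a, r)"
  shows "s permutes darts n" "a permutes darts n" "a (a x) = x" "r \<in> darts n" "x \<in> darts n \<Longrightarrow> a x \<noteq> x"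
    "connected_map (darts n) s a" "card (cycles_of s (darts n)) + card (cycles_of (s \<circ> a) (darts n)) = n + 2"
proof -
  show "s permutes darts n" "r \<in> darts n" "x \<in> darts n \<Longrightarrow> a x \<noteq> x" "connected_map (darts n) s a"
    "card (cycles_of s (darts n)) + card (cycles_of (s \<circ> a) (darts n)) = n + 2"
    using assms unfolding is_rmap_def by auto
  show a: "a permutes darts n" using assms unfolding is_rmap_def by auto
  show "a (a x) = x"
    using assms permutes_not_in[OF a] unfolding is_rmap_def by (cases "x \<in> darts n") auto
qed

lemma connected_map_closed:
  assumes "connected_map D s a" "x \<in> X" "x \<in> D" "\<And>z. z \<in> X \<Longrightarrow> z \<in> D \<Longrightarrow> s z \<in> X \<and> a z \<in> X" "X \<subseteq> D"
  shows "D \<subseteq> X"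
proof
  fix y assume "y \<in> D"
  then have "(x, y) \<in> ({(z, s z) | z. z \<in> D} \<union> {(z, a z) | z. z \<in> D})\<^sup>*"
    using assms(1,3) unfolding connected_map_def by blast
  then show "y \<in> X"
    by (induction rule: rtrancl_induct) (use assms(2,4) in auto)
qed

lemma dangle_planar:
  assumes "is_rmap n (s, a, r)" "outer_degree (s, a, r) = d"
  shows "planar_dmap (insert (2 * n) (darts n)) (root_s n s r) a (2 * n) n d"
proof -
  note m = is_rmapD[OF assms(1)]
  let ?e = "2 * n" and ?q = "inv s r" and ?D = "insert (2 * n) (darts n)"
  note f = dangle_face[OF m(1,2,3,4)]
  have sq: "s ?q = r" using permutes_inverses(1)[OF m(1)] .
  have "dmap ?D (root_s n s r) a ?e"
    unfolding dmap_def
  proof (intro conjI allI ballI)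
    show "finite ?D" using darts_out(2) by simp
    show "root_s n s r permutes ?D" by (rule f(6))
    show aD: "a permutes ?D" using permutes_insert_superset[OF m(2)] .
    show "a (a x) = x" for x by (rule m(3))
    show "?e \<in> ?D" by blast
    show "a x = x \<longleftrightarrow> x = ?e" if "x \<in> ?D" for x
      using that m(5) permutes_not_in[OF m(2) darts_out(1)] by auto
    show "comp_of (root_s n s r) a ?e = ?D"
    proof (rule comp_of_eqI)
      show "closed_under (root_s n s r) a ?D" using closed_permutes[OF f(6) aD] .
      fix X assume X: "?e \<in> X" "closed_under (root_s n s r) a X" "X \<subseteq> ?D"
      have cX: "root_s n s r x \<in> X" "a x \<in> X" if "x \<in> X" for x
        using X(2) that unfolding closed_under_def by auto
      have r: "r \<in> X" using cX(1)[OF X(1)] sq unfolding root_s_def by simp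
      have "darts n \<subseteq> X \<inter> darts n"
      proof (rule connected_map_closed[OF m(6)])
        show "r \<in> X \<inter> darts n" "r \<in> darts n" using r m(4) by auto
        show "s z \<in> X \<inter> darts n \<and> a z \<in> X \<inter> darts n" if z: "z \<in> X \<inter> darts n" for z
        proof -
          have "s z \<in> X"
          proof (cases "z = ?q")
            case True
            then show ?thesis using sq r by simp
          next
            case False
            moreover have "z \<noteq> ?e" using z darts_out(1) by blast
            ultimately have "root_s n s r z = s z" unfolding root_s_def by simp
            then show ?thesis using cX(1)[of z] z by simp
          qed
          then show ?thesis
            using z cX(2) permutes_in_image[OF m(1)] permutes_in_image[OF m(2)] by auto
        qed
      qed blast
      then show "?D \<subseteq> X" using X(1) by blast
    qed blast
  qed
  moreover have "card (orbit_of (s \<circ> a) r) = d" using assms(2) unfolding outer_degree_def by simp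
  moreover have "card ?D = Suc (2 * n)" using darts_out by (simp add: darts_def)
  ultimately show ?thesis unfolding planar_dmap_def f(3-5) using m(7) by blast
qed

text \<open>Taking the dangling dart out closes up its vertex; for n = 0 no dart would be left to
  serve as root. Connectedness has to be upgraded from closure starting at the root to paths between
  any two darts.\<close>

lemma undangle:
  assumes p: "planar_dmap (insert (2 * n) (darts n)) sh a (2 * n) n d" and n: "n \<noteq> 0"
  obtains s r where "is_rmap n (s, a, r)" "outer_degree (s, a, r) = d" "sh = root_s n s r"
proof -
  let ?e = "2 * n" and ?D = "insert (2 * n) (darts n)"
  have m: "dmap ?D sh a ?e" using p unfolding planar_dmap_def by blast
  note dm = dmapD[OF m]
  have ne: "sh ?e \<noteq> ?e"
  proof
    assume "sh ?e = ?e"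
    then have "closed_under sh a {?e}" using dm(6) unfolding closed_under_def by simp
    then have "?D \<subseteq> {?e}" using dmap_least[OF m, of "{?e}"] by blast
    moreover have "0 \<in> ?D" using n by (simp add: darts_def)
    ultimately show False using n by auto
  qed
  define q where "q = inv sh ?e"
  define r where "r = sh ?e"
  define s where "s = sh \<circ> tr q ?e"
  have inj: "inj sh" using permutes_inj[OF dm(2)] .
  have shq: "sh q = ?e" unfolding q_def using permutes_inverses(1)[OF dm(2)] .
  have qne: "q \<noteq> ?e" using ne shq by metis
  have qD: "q \<in> ?D" using shq permutes_in_image[OF dm(2)] by (metis insertI1)
  have q: "q \<in> darts n" using qD qne by blast
  have r: "r \<in> darts n" using dm(9)[of ?e] ne unfolding r_def by blast
  have del: "?D - {?e} = darts n" using darts_out(1) by blast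
  have se: "s ?e = ?e" unfolding s_def using shq by simp
  have "s permutes ?D" unfolding s_def using permutes_comp_transpose[OF dm(2) qD] by blast
  then have s: "s permutes darts n" using permutes_delete_fixed[of s ?D ?e] se del by simp
  have a: "a permutes darts n" using permutes_delete_fixed[of a ?D ?e] dm(3,6) del by simp
  have sq: "s q = r" unfolding s_def r_def by simp
  have "inv s r = q" using sq permutes_inj[OF s] by (metis inv_f_f)
  then have sh: "sh = root_s n s r" unfolding root_s_def s_def by (simp add: comp_assoc)
  have shx: "sh x = s x" if "x \<noteq> q" "x \<noteq> ?e" for x unfolding s_def using that by simp
  have root: "darts n \<subseteq> X" if X: "X \<subseteq> darts n" "r \<in> X" "\<forall>x\<in>X. s x \<in> X" "\<forall>x\<in>X. a x \<in> X" for X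
  proof -
    have "closed_under sh a (insert ?e X)"
      unfolding closed_under_def
    proof
      fix x assume x: "x \<in> insert ?e X"
      have "sh x \<in> insert ?e X"
      proof (cases "x = q \<or> x = ?e")
        case True
        then show ?thesis using shq X(2) unfolding r_def by auto
      next
        case False
        then show ?thesis using shx[of x] x X(3) by auto
      qed
      moreover have "a x \<in> insert ?e X" using x X(4) dm(6) by auto
      ultimately show "sh x \<in> insert ?e X \<and> a x \<in> insert ?e X" ..
    qed
    then have "?D \<subseteq> insert ?e X" by (rule dmap_least[OF m, rotated]) simp
    then show ?thesis using darts_out(1) by blast
  qed
  have conn: "connected_map (darts n) s a"
    unfolding connected_map_def
  proof (intro ballI)
    fix x y assume x: "x \<in> darts n" and y: "y \<in> darts n"
    let ?R = "{(z, s z) | z. z \<in> darts n} \<union> {(z, a z) | z. z \<in> darts n}"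
    \<comment> \<open>X collects the darts reachable from x. Its complement is closed too, so if
      that contained r it would contain every dart, including x.\<close>
    define X where "X = {z. (x, z) \<in> ?R\<^sup>*} \<inter> darts n"
    have cl: "\<forall>z\<in>X. s z \<in> X" "\<forall>z\<in>X. a z \<in> X"
      unfolding X_def using permutes_in_image[OF s] permutes_in_image[OF a]
      by (auto intro: rtrancl_into_rtrancl)
    have sub: "X \<subseteq> darts n" unfolding X_def by blast
    have xX: "x \<in> X" unfolding X_def using x by blast
    note co = restr_permutes(4)[OF s darts_out(2) sub cl(1)] restr_permutes(4)[OF a darts_out(2) sub cl(2)]
    have "r \<in> X"
    proof (rule ccontr)
      assume "r \<notin> X"
      then have "darts n \<subseteq> darts n - X"
        by (intro root) (use r co in blast)+
      then show False using xX x by blast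
    qed
    then have "darts n \<subseteq> X" using root[OF sub _ cl] by blast
    then show "(x, y) \<in> ?R\<^sup>*" using y unfolding X_def by blast
  qed
  note f = dangle_face[OF s a dm(4) r, folded sh]
  have "nvert ?D sh + nface ?D sh a = n + 2" "card (orbit_of (sh \<circ> a) ?e) = Suc d"
    using p unfolding planar_dmap_def by blast+
  then have c: "card (cycles_of s (darts n)) + card (cycles_of (s \<circ> a) (darts n)) = n + 2"
    "card (orbit_of (s \<circ> a) r) = d"
    unfolding f(3-5) by simp_all
  have fx: "\<forall>x\<in>darts n. a x \<noteq> x \<and> a (a x) = x"
    using dm(4) dm(7) darts_out(1) by (metis insertCI)
  have "is_rmap n (s, a, r)" unfolding is_rmap_def using s a fx r conn c(1) by simp
  moreover have "outer_degree (s, a, r) = d" unfolding outer_degree_def using c(2) by simp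
  ultimately show ?thesis using that sh by blast
qed

text \<open>Conjugation needs a bijection of all naturals. One from D to E is completed by one
  between the leftovers inside D \<union> E, and a transposition within E corrects the image of
  x.\<close>

lemma bij_extend:
  assumes "finite D" "finite E" "card D = card E" "x \<in> D" "y \<in> E"
  obtains h :: "nat \<Rightarrow> nat" where "bij h" "h ` D = E" "h x = y"
proof -
  let ?U = "D \<union> E"
  have fin: "finite ?U" using assms by simp
  obtain f where f: "bij_betw f D E" using finite_same_card_bij[OF assms(1-3)] by blast
  have "card (?U - D) = card (?U - E)"
    using assms(1-3) card_Diff_subset[OF assms(1), of ?U] card_Diff_subset[OF assms(2), of ?U] by simp
  then obtain g where g: "bij_betw g (?U - D) (?U - E)"
    using finite_same_card_bij[of "?U - D" "?U - E"] fin by auto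
  define k where "k z = (if z \<in> D then f z else if z \<in> E then g z else z)" for z
  have kD: "bij_betw k D E" using f by (simp add: k_def cong: bij_betw_cong)
  have "bij_betw k (?U - D) (?U - E)"
    using g by (rule bij_betw_cong[THEN iffD1, rotated]) (auto simp: k_def)
  from bij_betw_combine[OF kD this] have "bij_betw k ?U ?U" by (simp add: Un_absorb1 Un_commute)
  then have "k permutes ?U" by (rule bij_imp_permutes) (auto simp: k_def)
  then have bk: "bij k" using permutes_bij by blast
  have im: "k ` D = E" using kD bij_betw_imp_surj_on by blast
  then have kx: "k x \<in> E" using assms(4) by blast
  show ?thesis
  proof (rule that[of "tr (k x) y \<circ> k"])
    show "bij (tr (k x) y \<circ> k)" using bk by (simp add: bij_comp)
    show "(tr (k x) y \<circ> k) x = y" by simp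
    have "tr (k x) y ` E = E" using kx assms(5) by simp
    then show "(tr (k x) y \<circ> k) ` D = E" using im by (metis image_comp)
  qed
qed

section \<open>From isomorphism classes of maps to trees\<close>

definition trees :: "nat \<Rightarrow> nat \<Rightarrow> tree set" where
  "trees n d = {t. twf t \<and> tedges t = n \<and> tdeg t = d}"

lemma map_iso_equiv: "sym (map_iso n)" "trans (map_iso n)" "(m, m) \<in> map_iso n"
proof -
  show "(m, m) \<in> map_iso n"
    unfolding map_iso_def by (cases m) (auto intro!: exI[of _ id])
  show "sym (map_iso n)"
  proof (rule symI)
    fix m m' assume "(m, m') \<in> map_iso n"
    then obtain s a r s' a' r' h where m: "m = (s, a, r)" "m' = (s', a', r')" and h: "h permutes darts n"
      "\<forall>x\<in>darts n. h (s x) = s' (h x) \<and> h (a x) = a' (h x)" "h r = r'"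
      unfolding map_iso_def by auto
    have i: "inv h (h x) = x" "h (inv h x) = x" for x using permutes_inverses[OF h(1)] by auto
    have "inv h (s' x) = s (inv h x) \<and> inv h (a' x) = a (inv h x)" if "x \<in> darts n" for x
    proof -
      have "inv h x \<in> darts n" using that permutes_in_image[OF permutes_inv[OF h(1)]] by blast
      then have "h (s (inv h x)) = s' x" "h (a (inv h x)) = a' x" using h(2) i by auto
      then show ?thesis using i by metis
    qed
    moreover have "inv h r' = r" using h(3) i by auto
    ultimately show "(m', m) \<in> map_iso n" unfolding map_iso_def m using permutes_inv[OF h(1)] by blast
  qed
  show "trans (map_iso n)"
  proof (rule transI)
    fix m m' m'' assume "(m, m') \<in> map_iso n" "(m', m'') \<in> map_iso n"
    then obtain s a r s' a' r' h s'' a'' r'' h' where m: "m = (s, a, r)" "m' = (s', a', r')" "m'' = (s'', a'', r'')"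
      and h: "h permutes darts n" "\<forall>x\<in>darts n. h (s x) = s' (h x) \<and> h (a x) = a' (h x)" "h r = r'"
      and h': "h' permutes darts n" "\<forall>x\<in>darts n. h' (s' x) = s'' (h' x) \<and> h' (a' x) = a'' (h' x)" "h' r' = r''"
      unfolding map_iso_def by auto
    have "h' \<circ> h permutes darts n" using permutes_compose[OF h(1) h'(1)] .
    moreover have "(h' \<circ> h) (s x) = s'' ((h' \<circ> h) x) \<and> (h' \<circ> h) (a x) = a'' ((h' \<circ> h) x)" if "x \<in> darts n" for x
      using that h(2) h'(2) permutes_in_image[OF h(1)] by simp
    moreover have "(h' \<circ> h) r = r''" using h(3) h'(3) by simp
    ultimately show "(m, m'') \<in> map_iso n" unfolding map_iso_def m by blast
  qed
qed

definition map_rep :: "nat \<Rightarrow> lmap \<Rightarrow> tree \<Rightarrow> bool" where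
  "map_rep n m t = (case m of (s, a, r) \<Rightarrow> rep (insert (2 * n) (darts n)) (root_s n s r) a (2 * n) t)"

text \<open>An isomorphism of maps fixes 2 * n, which is no dart, and sends inv s r to inv s' r';
  hence it conjugates one dangling system into the other.\<close>

lemma map_rep_iso_invariant:
  assumes m: "is_rmap n m" "is_rmap n m'" "(m, m') \<in> map_iso n" "map_rep n m t"
  shows "map_rep n m' t"
proof -
  obtain s a r s' a' r' h where e: "m = (s, a, r)" "m' = (s', a', r')" and h: "h permutes darts n"
    "\<forall>x\<in>darts n. h (s x) = s' (h x) \<and> h (a x) = a' (h x)" "h r = r'"
    using m(3) unfolding map_iso_def by auto
  note d = is_rmapD[OF m(1)[unfolded e]] and d' = is_rmapD[OF m(2)[unfolded e]]
  have bij: "bij h" using permutes_bij[OF h(1)] .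
  \<comment> \<open>\<open>map_iso\<close> compares permutations on the darts only; elsewhere all of
    them are the identity, so full conjugacy follows.\<close>
  have conj: "conj_by h p = p'" if "p permutes darts n" "p' permutes darts n" "\<forall>x\<in>darts n. h (p x) = p' (h x)" for p p'
  proof
    fix x
    have x: "h (inv h x) = x" using permutes_inverses(1)[OF h(1)] .
    have "h (p (inv h x)) = p' (h (inv h x))"
    proof (cases "inv h x \<in> darts n")
      case False
      then have "p (inv h x) = inv h x" "h (inv h x) = inv h x" "p' (inv h x) = inv h x"
        using permutes_not_in[OF that(1)] permutes_not_in[OF h(1)] permutes_not_in[OF that(2)] by auto
      then show ?thesis by simp
    qed (use that(3) in blast)
    then show "conj_by h p x = p' x" unfolding conj_by_def using x by simp
  qed
  have cs: "conj_by h s = s'" using conj[OF d(1) d'(1)] h(2) by blast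
  have ca: "conj_by h a = a'" using conj[OF d(2) d'(2)] h(2) by blast
  have he: "h (2 * n) = 2 * n" using permutes_not_in[OF h(1) darts_out(1)] .
  have "inv s r \<in> darts n" using dangle_face(1)[OF d(1,2,3,4)] .
  then have "s' (h (inv s r)) = h (s (inv s r))" using h(2) by simp
  then have "s' (h (inv s r)) = r'" using h(3) permutes_inverses(1)[OF d(1)] by simp
  then have hq: "h (inv s r) = inv s' r'" using permutes_inj[OF d'(1)] by (metis inv_f_f)
  have "conj_by h (root_s n s r) = root_s n s' r'"
    unfolding root_s_def conj_by_props(2,3)[OF bij] cs hq he ..
  moreover have "h ` insert (2 * n) (darts n) = insert (2 * n) (darts n)"
    using he permutes_image[OF h(1)] by simp
  ultimately show ?thesis
    using rep_conj[OF bij, of "insert (2 * n) (darts n)" "root_s n s r" a "2 * n" t] m(4) ca he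
    unfolding map_rep_def e by simp
qed

text \<open>An isomorphism of the dangling systems fixes the dangling dart, hence restricts to the
  darts and matches its two neighbours in the rotation: the root and the dart inv s r. Away from the
  latter \<open>root_s\<close> agrees with s on the darts.\<close>

lemma map_rep_same:
  assumes m: "is_rmap n m" "is_rmap n m'" "map_rep n m t" "map_rep n m' t"
  shows "(m, m') \<in> map_iso n"
proof -
  obtain s a r s' a' r' where e: "m = (s, a, r)" "m' = (s', a', r')" by (metis prod_cases3)
  note d = is_rmapD[OF m(1)[unfolded e]] and d' = is_rmapD[OF m(2)[unfolded e]]
  let ?e = "2 * n" and ?D = "insert (2 * n) (darts n)"
  obtain h where h: "bij_betw h ?D ?D" "h ?e = ?e"
    "\<forall>x\<in>?D. h (root_s n s r x) = root_s n s' r' (h x) \<and> h (a x) = a' (h x)"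
    using rep_iso[OF m(3)[unfolded e map_rep_def prod.case] m(4)[unfolded e map_rep_def prod.case]] by blast
  define k where "k x = (if x \<in> darts n then h x else x)" for x
  have "bij_betw h (darts n) (darts n)"
    using bij_betw_DiffI[OF h(1), of "{?e}" "{?e}"] h(2) darts_out(1) by simp
  then have bk: "bij_betw k (darts n) (darts n)" by (simp add: k_def cong: bij_betw_cong)
  have k: "k permutes darts n" by (rule bij_imp_permutes[OF bk]) (simp add: k_def)
  have q: "inv s r \<in> darts n" "s (inv s r) = r"
    using dangle_face(1)[OF d(1,2,3,4)] permutes_inverses(1)[OF d(1)] by auto
  have q': "inv s' r' \<in> darts n" "s' (inv s' r') = r'"
    using dangle_face(1)[OF d'(1,2,3,4)] permutes_inverses(1)[OF d'(1)] by auto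
  have re: "root_s n s r ?e = r" "root_s n s' r' ?e = r'" unfolding root_s_def using q q' by simp_all
  have rq: "root_s n s r (inv s r) = ?e"
    unfolding root_s_def using permutes_not_in[OF d(1) darts_out(1)] by simp
  have rq': "root_s n s' r' (inv s' r') = ?e"
    unfolding root_s_def using permutes_not_in[OF d'(1) darts_out(1)] by simp
  have hr: "h r = r'" using h(2,3) re by (metis insertI1)
  have injr: "inj (root_s n s' r')" using dangle_face(6)[OF d'(1,2,3,4)] permutes_inj by blast
  have hin: "h x \<in> darts n" if "x \<in> darts n" for x
    using that bk bij_betwE[OF bk] unfolding k_def by auto
  have hq: "h (inv s r) = inv s' r'"
  proof -
    have "root_s n s' r' (h (inv s r)) = ?e" using h(3) q(1) rq h(2) by (metis insertCI)
    then show ?thesis using rq' injr by (metis injD)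
  qed
  have S: "k (s x) = s' (k x)" if x: "x \<in> darts n" for x
  proof -
    have sx: "s x \<in> darts n" using x permutes_in_image[OF d(1)] by blast
    show ?thesis
    proof (cases "x = inv s r")
      case True
      then show ?thesis using x sx q(2) q'(2) hq hr unfolding k_def by simp
    next
      case False
      have n: "h x \<noteq> inv s' r'"
        using False hq x q(1) h(1) by (metis bij_betw_inv_into_left insertCI)
      have "x \<noteq> ?e" "h x \<noteq> ?e" using x hin[OF x] darts_out(1) by metis+
      then have "root_s n s r x = s x" "root_s n s' r' (h x) = s' (h x)"
        using False n unfolding root_s_def by simp_all
      then show ?thesis using h(3) x sx unfolding k_def by auto
    qed
  qed
  have A: "k (a x) = a' (k x)" if "x \<in> darts n" for x
    using that h(3) permutes_in_image[OF d(2)] unfolding k_def by simp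
  have "k r = r'" using d(4) hr unfolding k_def by simp
  then show ?thesis unfolding map_iso_def e using k S A by blast
qed

lemma rooted_maps_trees: "\<exists>f. bij_betw f (rooted_maps n d) (trees n d)"
proof (cases "n = 0")
  case True
  \<comment> \<open>The vertex map is set apart in \<open>rooted_maps\<close>; its counterpart is
    the only tree without edges.\<close>
  have "t \<in> trees 0 d \<longleftrightarrow> t = Vtx \<and> d = 0" for t
    unfolding trees_def by (cases t) auto
  then have T: "trees 0 d = (if d = 0 then {Vtx} else {})" by auto
  show ?thesis
  proof (cases "d = 0")
    case d: True
    have "bij_betw (\<lambda>_. Vtx) (rooted_maps n d) (trees n d)"
      unfolding True d using T d by (simp add: rooted_maps_def bij_betw_def)
    then show ?thesis by blast
  next
    case d: False
    have "bij_betw (\<lambda>_. Vtx) (rooted_maps n d) (trees n d)"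
      unfolding True using T d by (simp add: rooted_maps_def bij_betw_def)
    then show ?thesis by blast
  qed
next
  case n: False
  let ?A = "{m. is_rmap n m \<and> outer_degree m = d}"
  define g where "g m = (THE t. map_rep n m t)" for m
  have g: "map_rep n m t \<longleftrightarrow> g m = t" if m: "m \<in> ?A" for m t
  proof -
    obtain s a r where e: "m = (s, a, r)" by (metis prod_cases3)
    have p: "planar_dmap (insert (2 * n) (darts n)) (root_s n s r) a (2 * n) n d"
      using dangle_planar m e by blast
    obtain t' where t': "map_rep n m t'"
      using rep_exists[of "insert (2 * n) (darts n)" "root_s n s r" a "2 * n" n] p
      unfolding map_rep_def e planar_dmap_def prod.case by blast
    have u: "map_rep n m t1 \<Longrightarrow> map_rep n m t2 \<Longrightarrow> t1 = t2" for t1 t2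
      unfolding map_rep_def e prod.case by (rule rep_unique)
    have "g m = t'" unfolding g_def using t' u by blast
    then show ?thesis using t' u by blast
  qed
  have "\<exists>f. bij_betw f (?A // map_iso n) (trees n d)"
  proof (rule quotient_bij[where g = g, OF map_iso_equiv])
    show "(x, y) \<in> map_iso n \<longleftrightarrow> g x = g y" if "x \<in> ?A" "y \<in> ?A" for x y
    proof
      assume "(x, y) \<in> map_iso n"
      then have "map_rep n y (g x)" using map_rep_iso_invariant that g[OF that(1)] by blast
      then show "g x = g y" using g[OF that(2)] by simp
    next
      assume "g x = g y"
      then show "(x, y) \<in> map_iso n" using map_rep_same that g[OF that(1)] g[OF that(2)] by blast
    qed
    show "g ` ?A = trees n d"
    proof
      show "g ` ?A \<subseteq> trees n d"
      proof
        fix t assume "t \<in> g ` ?A"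
        then obtain s a r where m: "(s, a, r) \<in> ?A" "g (s, a, r) = t" by auto
        then have "map_rep n (s, a, r) t" using g by blast
        then have "planar_dmap (insert (2 * n) (darts n)) (root_s n s r) a (2 * n) (tedges t) (tdeg t)" "twf t"
          using rep_planar unfolding map_rep_def by auto
        moreover have "planar_dmap (insert (2 * n) (darts n)) (root_s n s r) a (2 * n) n d"
          using dangle_planar m by blast
        ultimately show "t \<in> trees n d" unfolding planar_dmap_def trees_def by auto
      qed
      show "trees n d \<subseteq> g ` ?A"
      proof
        fix t assume "t \<in> trees n d"
        then have t: "twf t" "tedges t = n" "tdeg t = d" unfolding trees_def by auto
        obtain D s a r where R: "rep D s a r t" using rep_total[OF t(1)] by blast
        then have P: "dmap D s a r" "card D = Suc (2 * n)"
          using rep_planar[OF R] t unfolding planar_dmap_def by blast+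
        have c: "card (insert (2 * n) (darts n)) = Suc (2 * n)" using darts_out by (simp add: darts_def)
        \<comment> \<open>Relabels an arbitrary representative onto the standard darts; its root
          becomes the dangling dart 2 * n.\<close>
        obtain h where h: "bij h" "h ` D = insert (2 * n) (darts n)" "h r = 2 * n"
        proof (rule bij_extend)
          show "finite D" "r \<in> D" using dmapD(1,5)[OF P(1)] by blast+
          show "card D = card (insert (2 * n) (darts n))" using P(2) c by simp
          show "finite (insert (2 * n) (darts n))" using darts_out(2) by simp
        qed blast+
        have R': "rep (insert (2 * n) (darts n)) (conj_by h s) (conj_by h a) (2 * n) t"
          using rep_conj[OF h(1) R] unfolding h(2,3) .
        then have "planar_dmap (insert (2 * n) (darts n)) (conj_by h s) (conj_by h a) (2 * n) n d"
          using rep_planar t by blast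
        then obtain u q where u: "is_rmap n (u, conj_by h a, q)" "outer_degree (u, conj_by h a, q) = d"
          "conj_by h s = root_s n u q"
          using undangle n by metis
        then have "map_rep n (u, conj_by h a, q) t" unfolding map_rep_def using R' by simp
        then have "g (u, conj_by h a, q) = t" using g[of "(u, conj_by h a, q)"] u by blast
        then show "t \<in> g ` ?A" using u by blast
      qed
    qed
  qed
  then show ?thesis using n unfolding rooted_maps_def by simp
qed

section \<open>Colorings and decomposition trees\<close>

fun arity :: "deriv \<Rightarrow> nat" where
  "arity Dv = 1"
| "arity (Da a b) = arity a + arity b"
| "arity (Ds p) = arity p"
| "arity (Dl p) = arity p - 1"

text \<open>Recursive counterparts of \<open>sneu\<close> and \<open>snf\<close>, possible because a
  derivation determines its skeleton and arity. The test 1 \<le> arity p guards the truncated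
  subtraction in \<open>arity\<close>.\<close>

fun neu :: "deriv \<Rightarrow> bool" and nrm :: "deriv \<Rightarrow> bool" where
  "neu Dv = True"
| "neu (Da a b) = (neu a \<and> nrm b)"
| "neu (Ds p) = False"
| "neu (Dl p) = False"
| "nrm Dv = False"
| "nrm (Da a b) = False"
| "nrm (Ds p) = neu p"
| "nrm (Dl p) = (nrm p \<and> 1 \<le> arity p)"

fun skel_of :: "deriv \<Rightarrow> skel" where
  "skel_of Dv = SVar"
| "skel_of (Da a b) = SApp (skel_of a) (skel_of b)"
| "skel_of (Ds p) = skel_of p"
| "skel_of (Dl p) = SLam (skel_of p)"

text \<open>The number of handles depends on the coloring alone, since an argument is closed exactly
  when its arity is 0.\<close>

fun nhandles :: "deriv \<Rightarrow> nat" where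
  "nhandles Dv = 1"
| "nhandles (Da a b) = Suc (nhandles b + (if arity b = 0 then nhandles a else 0))"
| "nhandles (Ds p) = nhandles p"
| "nhandles (Dl p) = nhandles p"

text \<open>Throughout, the last free variable is found by descending into the argument of an application unless
  the argument is closed. \<open>sub_last p c\<close> replaces its occurrence x by x(c), and \<open>ins k p\<close> replaces the
  k-th outer neutral handle n by n(x) for a new last variable x.\<close>

fun sub_last :: "deriv \<Rightarrow> deriv \<Rightarrow> deriv" where
  "sub_last Dv c = Da Dv c"
| "sub_last (Da a b) c = (if arity b = 0 then Da (sub_last a c) b else Da a (sub_last b c))"
| "sub_last (Ds p) c = Ds (sub_last p c)"
| "sub_last (Dl p) c = Dl (sub_last p c)"

fun ins :: "nat \<Rightarrow> deriv \<Rightarrow> deriv" where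
  "ins k Dv = Da Dv (Ds Dv)"
| "ins k (Da a b) = (case k of 0 \<Rightarrow> Da (Da a b) (Ds Dv)
     | Suc j \<Rightarrow> if j < nhandles b then Da a (ins j b) else Da (ins (j - nhandles b) a) b)"
| "ins k (Ds p) = Ds (ins k p)"
| "ins k (Dl p) = Dl (ins k p)"

text \<open>Here the last free variable is the argument of a neutral term; in
  \<open>last_head\<close> it is a head applied to a closed term. A variable in argument position is
  \<open>Ds Dv\<close> because arguments are normal.\<close>

fun last_arg :: "deriv \<Rightarrow> bool" where
  "last_arg Dv = False"
| "last_arg (Da a b) = (if arity b = 0 then last_arg a else b = Ds Dv \<or> last_arg b)"
| "last_arg (Ds p) = last_arg p"
| "last_arg (Dl p) = last_arg p"

fun last_head :: "deriv \<Rightarrow> bool" where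
  "last_head Dv = False"
| "last_head (Da a b) = (if arity b = 0 then a = Dv \<or> last_head a else last_head b)"
| "last_head (Ds p) = last_head p"
| "last_head (Dl p) = last_head p"

text \<open>This and the next two functions invert the insertions, under \<open>last_head\<close> or
  \<open>last_arg\<close>; the values at \<open>Dv\<close> are defaults.\<close>

fun unhead :: "deriv \<Rightarrow> deriv" where
  "unhead Dv = Dv"
| "unhead (Da a b) = (if arity b = 0 then if a = Dv then Dv else Da (unhead a) b else Da a (unhead b))"
| "unhead (Ds p) = Ds (unhead p)"
| "unhead (Dl p) = Dl (unhead p)"

fun head_arg :: "deriv \<Rightarrow> deriv" where
  "head_arg Dv = Dv"
| "head_arg (Da a b) = (if arity b = 0 then if a = Dv then b else head_arg a else head_arg b)"
| "head_arg (Ds p) = head_arg p"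
| "head_arg (Dl p) = head_arg p"

fun unarg :: "deriv \<Rightarrow> deriv" where
  "unarg Dv = Dv"
| "unarg (Da a b) = (if arity b = 0 then Da (unarg a) b else if b = Ds Dv then a else Da a (unarg b))"
| "unarg (Ds p) = Ds (unarg p)"
| "unarg (Dl p) = Dl (unarg p)"

section \<open>Insertion and erasure at the last variable\<close>

lemma neu_arity: "neu p \<Longrightarrow> 1 \<le> arity p"
  by (induction p) auto

lemma nrm_uses: "nrm p \<Longrightarrow> 1 \<le> uses_s p"
  by (induction p) auto

text \<open>A head applied to a term that is not closed cannot be the last variable. The two kinds
  are treated together because \<open>Ds\<close> leads from one to the other.\<close>

lemma last_cases:
  "(neu p \<longrightarrow> p = Dv \<or> last_arg p \<or> last_head p) \<and>
   (nrm p \<and> 1 \<le> arity p \<longrightarrow> p = Ds Dv \<or> last_arg p \<or> last_head p)"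
proof (induction p)
  case (Da a b)
  then show ?case by (cases "arity b = 0") auto
next
  case (Dl p)
  then show ?case by (cases "p = Ds Dv") auto
qed auto

lemma last_exclusive: "last_arg p \<Longrightarrow> \<not> last_head p"
  by (induction p) (auto split: if_splits)

lemma sub_last_ne: "sub_last p c \<noteq> Dv"
  by (cases p) auto

text \<open>Guards the test b = \<open>Ds Dv\<close> in \<open>unarg\<close>, which must not succeed
  above the place of insertion.\<close>

lemma ins_ne: "ins k p \<noteq> Dv" "ins k p \<noteq> Ds Dv"
proof -
  show 1: "ins k p \<noteq> Dv" for p by (cases p) (auto split: nat.splits)
  show "ins k p \<noteq> Ds Dv" using 1 by (cases p) (auto split: nat.splits)
qed

text \<open>The handle at x gives way to x(c), the handles of c, and x, the last one because c is
  closed; this is the increment nhandles c + 1. All other handles stay since arities do not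
  change.\<close>

lemma sub_last_props:
  assumes "nrm c" "arity c = 0"
  shows "(neu p \<longrightarrow> neu (sub_last p c)) \<and> (nrm p \<and> 1 \<le> arity p \<longrightarrow> nrm (sub_last p c)) \<and>
    ((neu p \<or> nrm p) \<and> 1 \<le> arity p \<longrightarrow> arity (sub_last p c) = arity p \<and> last_head (sub_last p c) \<and>
      nhandles (sub_last p c) = Suc (nhandles p + nhandles c) \<and> uses_s (sub_last p c) = uses_s p + uses_s c \<and>
      unhead (sub_last p c) = p \<and> head_arg (sub_last p c) = c)"
proof (induction p)
  case Dv
  then show ?case using assms by auto
next
  case (Da a b)
  then show ?case using neu_arity[of a] sub_last_ne by (cases "arity b = 0") auto
qed auto

lemma last_head_decomp:
  "(neu p \<and> last_head p \<longrightarrow> neu (unhead p)) \<and>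
   (nrm p \<and> 1 \<le> arity p \<and> last_head p \<longrightarrow> nrm (unhead p)) \<and>
   ((neu p \<or> nrm p) \<and> 1 \<le> arity p \<and> last_head p \<longrightarrow> arity (unhead p) = arity p \<and>
     nrm (head_arg p) \<and> arity (head_arg p) = 0 \<and> sub_last (unhead p) (head_arg p) = p)"
proof (induction p)
  case (Da a b)
  then show ?case using neu_arity[of a] by (cases "arity b = 0") auto
qed auto

text \<open>The k handles listed before n stay, n(x) and x take the place of n, and those listed
  after n are lost: they lie inside n or in a function part whose argument is no longer closed. This
  leaves k + 2.\<close>

lemma ins_props:
  "k < nhandles p \<Longrightarrow> (neu p \<longrightarrow> neu (ins k p)) \<and> (nrm p \<longrightarrow> nrm (ins k p)) \<and>
   (neu p \<or> nrm p \<longrightarrow> arity (ins k p) = Suc (arity p) \<and> last_arg (ins k p) \<and>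
     nhandles (ins k p) = Suc (Suc k) \<and> uses_s (ins k p) = Suc (uses_s p) \<and> unarg (ins k p) = p)"
proof (induction p arbitrary: k)
  case (Da a b)
  show ?case
  proof (cases k)
    case (Suc j)
    show ?thesis
    proof (cases "j < nhandles b")
      case True
      then show ?thesis using Da.IH(2)[OF True] Suc ins_ne by auto
    next
      case False
      then have "arity b = 0" "j - nhandles b < nhandles a" using Da.prems Suc by (auto split: if_splits)
      then show ?thesis using Da.IH(1)[of "j - nhandles b"] Suc False by auto
    qed
  qed auto
qed auto

text \<open>Insertion at the k-th handle leaves k + 2 handles, so the index can only be nhandles p -
  2.\<close>

lemma last_arg_decomp:
  "(neu p \<and> last_arg p \<longrightarrow> neu (unarg p)) \<and> (nrm p \<and> 1 \<le> arity p \<and> last_arg p \<longrightarrow> nrm (unarg p)) \<and>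
   ((neu p \<or> nrm p) \<and> 1 \<le> arity p \<and> last_arg p \<longrightarrow> Suc (arity (unarg p)) = arity p \<and>
     2 \<le> nhandles p \<and> nhandles p - 2 < nhandles (unarg p) \<and> ins (nhandles p - 2) (unarg p) = p)"
proof (induction p)
  case (Da a b)
  show ?case
  proof (cases "arity b = 0")
    case True
    show ?thesis
    proof (cases "neu a \<and> nrm b \<and> last_arg a")
      case h: True
      then have i: "2 \<le> nhandles a" "nhandles a - 2 < nhandles (unarg a)" "ins (nhandles a - 2) (unarg a) = a"
        "neu (unarg a)" "Suc (arity (unarg a)) = arity a"
        using Da.IH(1) neu_arity[of a] by auto
      \<comment> \<open>Naming the difference removes the truncated subtraction before the
        successors are computed.\<close>
      obtain m where "nhandles a = 2 + m" using le_Suc_ex[OF i(1)] by blast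
      then show ?thesis using True h i by simp
    qed (use True in auto)
  next
    case b: False
    show ?thesis
    proof (cases "b = Ds Dv")
      case True
      show ?thesis unfolding True by (cases a) auto
    next
      case False
      show ?thesis
      proof (cases "neu a \<and> nrm b \<and> last_arg b")
        case h: True
        then have i: "2 \<le> nhandles b" "nhandles b - 2 < nhandles (unarg b)" "ins (nhandles b - 2) (unarg b) = b"
          "nrm (unarg b)" "Suc (arity (unarg b)) = arity b"
          using Da.IH(2) b by auto
        obtain m where "nhandles b = 2 + m" using le_Suc_ex[OF i(1)] by blast
        then show ?thesis using b False h i by simp
      qed (use b False in auto)
    qed
  qed
qed auto

text \<open>The head variable of a neutral term is free. If there is no other, every argument on the
  spine is closed and the last variable is the head. So a normal derivation of arity 1 with
  \<open>last_arg\<close> ends with an abstraction.\<close>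

lemma neu_last_arg: "neu p \<Longrightarrow> arity p = 1 \<Longrightarrow> \<not> last_arg p"
proof (induction p)
  case (Da a b)
  then show ?case using neu_arity[of a] by auto
qed auto

text \<open>In \<open>Non\<close> the insertion creates a second free variable, placed last, and the
  abstraction binds the first, which was the free variable of the old term. With the index tdeg t -
  k there remain tdeg t - k + 2 handles, one more than the degree of \<open>Non t k\<close>.\<close>

fun tree_deriv :: "tree \<Rightarrow> deriv" where
  "tree_deriv Vtx = Ds Dv"
| "tree_deriv (Iso t u) = sub_last (tree_deriv t) (Dl (tree_deriv u))"
| "tree_deriv (Non t k) = Dl (ins (tdeg t - k) (tree_deriv t))"

lemma tree_deriv_props:
  "twf t \<Longrightarrow> nrm (tree_deriv t) \<and> arity (tree_deriv t) = 1 \<and> uses_s (tree_deriv t) = tedges t + 1 \<and>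
    nhandles (tree_deriv t) = tdeg t + 1"
proof (induction t)
  case (Iso t u)
  then have "nrm (Dl (tree_deriv u))" "arity (Dl (tree_deriv u)) = 0" by auto
  from sub_last_props[OF this, of "tree_deriv t"] show ?case using Iso by auto
next
  case (Non t k)
  then have "tdeg t - k < nhandles (tree_deriv t)" by auto
  from ins_props[OF this] show ?case using Non by auto
qed auto

lemma tree_deriv_shape:
  assumes "twf t"
  shows "last_head (tree_deriv t) \<longleftrightarrow> (\<exists>u v. t = Iso u v)" "last_arg (tree_deriv t) \<longleftrightarrow> (\<exists>u k. t = Non u k)"
proof -
  have "last_head (tree_deriv (Iso u v))" if "twf (Iso u v)" for u v
    using sub_last_props[of "Dl (tree_deriv v)" "tree_deriv u"] tree_deriv_props[of u] tree_deriv_props[of v] that by auto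
  moreover have "last_arg (tree_deriv (Non u k))" if "twf (Non u k)" for u k
    using ins_props[of "tdeg u - k" "tree_deriv u"] tree_deriv_props[of u] that by auto
  ultimately show "last_head (tree_deriv t) \<longleftrightarrow> (\<exists>u v. t = Iso u v)"
    "last_arg (tree_deriv t) \<longleftrightarrow> (\<exists>u k. t = Non u k)"
    using assms last_exclusive by (cases t; force)+
qed

text \<open>The place of the last variable reveals the constructor, the inverse operations give the
  subtrees, and the number of handles gives the index k.\<close>

lemma tree_deriv_inj: "twf t \<Longrightarrow> twf t' \<Longrightarrow> tree_deriv t = tree_deriv t' \<Longrightarrow> t = t'"
proof (induction t arbitrary: t')
  case Vtx
  then show ?case using tree_deriv_shape[OF Vtx(1)] tree_deriv_shape[OF Vtx(2)] by (cases t') auto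
next
  case (Iso t u)
  obtain v w where t': "t' = Iso v w"
    using tree_deriv_shape(1)[OF Iso(3)] tree_deriv_shape(1)[OF Iso(4)] Iso(5) by auto
  have i: "unhead (tree_deriv (Iso x y)) = tree_deriv x \<and> head_arg (tree_deriv (Iso x y)) = Dl (tree_deriv y)"
    if "twf (Iso x y)" for x y
    using sub_last_props[of "Dl (tree_deriv y)" "tree_deriv x"] tree_deriv_props[of x] tree_deriv_props[of y] that by auto
  have "tree_deriv t = tree_deriv v" "tree_deriv u = tree_deriv w"
    using i[OF Iso(3)] i[OF Iso(4)[unfolded t']] Iso(5)[unfolded t'] by (simp_all del: tree_deriv.simps)
  then have "t = v" "u = w" using Iso(1)[of v] Iso(2)[of w] Iso(3,4) t' by simp_all
  then show ?case using t' by simp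
next
  case (Non t k)
  obtain v j where t': "t' = Non v j"
    using tree_deriv_shape(2)[OF Non(2)] tree_deriv_shape(2)[OF Non(3)] unfolding Non(4) by blast
  have i: "unarg (tree_deriv (Non x l)) = Dl (tree_deriv x) \<and> nhandles (tree_deriv (Non x l)) = Suc (Suc (tdeg x - l))"
    if "twf (Non x l)" for x l
    using ins_props[of "tdeg x - l" "tree_deriv x"] tree_deriv_props[of x] that by auto
  have "tree_deriv t = tree_deriv v" and k: "tdeg t - k = tdeg v - j"
    using i[OF Non(2)] i[OF Non(3)[unfolded t']] Non(4)[unfolded t'] by (simp_all del: tree_deriv.simps)
  then have "t = v" using Non(1)[of v] Non(2,3) t' by simp
  then show ?case using k Non(2,3) t' by auto
qed

lemma nrm_closed: "nrm p \<Longrightarrow> arity p = 0 \<Longrightarrow> \<exists>q. p = Dl q \<and> nrm q \<and> arity q = 1"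
  using neu_arity by (cases p) force+

text \<open>The measure is the number of uses of (s), because erasing in the interior does not give
  a subderivation. Every normal derivation has at least one use, so both parts of the
  \<open>last_head\<close> case are smaller.\<close>

lemma tree_deriv_surj: "nrm p \<Longrightarrow> arity p = 1 \<Longrightarrow> \<exists>t. twf t \<and> tree_deriv t = p"
proof (induction "uses_s p" arbitrary: p rule: less_induct)
  case less
  consider "p = Ds Dv" | "last_head p" | "last_arg p" using last_cases[of p] less.prems by auto
  then show ?case
  proof cases
    case 1
    then show ?thesis by (intro exI[of _ Vtx]) simp
  next
    case 2
    then have d: "nrm (unhead p)" "arity (unhead p) = 1" "nrm (head_arg p)" "arity (head_arg p) = 0"
      "sub_last (unhead p) (head_arg p) = p"
      using last_head_decomp[of p] less.prems by auto
    obtain q where q: "head_arg p = Dl q" "nrm q" "arity q = 1" using nrm_closed d(3,4) by blast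
    have "uses_s p = uses_s (unhead p) + uses_s q"
      using sub_last_props[OF d(3,4), of "unhead p"] d q(1) by auto
    then have "uses_s (unhead p) < uses_s p" "uses_s q < uses_s p"
      using nrm_uses[OF d(1)] nrm_uses[OF q(2)] by auto
    then obtain t u where "twf t" "tree_deriv t = unhead p" "twf u" "tree_deriv u = q"
      using less.hyps d(1,2) q(2,3) by meson
    then show ?thesis using d(5) q(1) by (intro exI[of _ "Iso t u"]) simp
  next
    case 3
    obtain q where q: "p = Dl q"
      using less.prems 3 neu_last_arg by (cases p) auto
    then have d: "nrm (unarg q)" "arity (unarg q) = 1" "nhandles q - 2 < nhandles (unarg q)"
      "ins (nhandles q - 2) (unarg q) = q"
      using last_arg_decomp[of q] less.prems 3 by auto
    have "uses_s (unarg q) < uses_s p"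
      using ins_props[OF d(3)] d(1,4) q by auto
    then obtain t where t: "twf t" "tree_deriv t = unarg q" using less.hyps d(1,2) by meson
    have "nhandles q - 2 \<le> tdeg t" using d(3) tree_deriv_props[OF t(1)] t(2) by simp
    \<comment> \<open>The witness undoes the reversal: subtracted from tdeg t it gives the index of
      the handle.\<close>
    then show ?thesis using t d(4) q by (intro exI[of _ "Non t (tdeg t - (nhandles q - 2))"]) simp
  qed
qed

section \<open>Terms and colorings\<close>

lemma coloring_iff:
  "sneu \<pi> p i \<longleftrightarrow> neu \<pi> \<and> p = skel_of \<pi> \<and> i = arity \<pi>"
  "snf \<pi> p i \<longleftrightarrow> nrm \<pi> \<and> p = skel_of \<pi> \<and> i = arity \<pi>"
proof -
  have 1: "(sneu \<pi> p i \<longrightarrow> neu \<pi> \<and> p = skel_of \<pi> \<and> i = arity \<pi>) \<and>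
      (snf \<pi> p i \<longrightarrow> nrm \<pi> \<and> p = skel_of \<pi> \<and> i = arity \<pi>)" for p i
  proof (induction \<pi> arbitrary: p i)
    case Dv
    show ?case by (auto elim: sneu.cases snf.cases)
  next
    case (Da a b)
    show ?case using Da.IH by (auto elim!: sneu.cases[of "Da a b"] elim: snf.cases)
  next
    case (Ds a)
    show ?case using Ds.IH by (auto elim!: snf.cases[of "Ds a"] elim: sneu.cases)
  next
    case (Dl a)
    show ?case using Dl.IH by (fastforce elim!: snf.cases[of "Dl a"] elim: sneu.cases)
  qed
  have 2: "(neu \<pi> \<longrightarrow> sneu \<pi> (skel_of \<pi>) (arity \<pi>)) \<and> (nrm \<pi> \<longrightarrow> snf \<pi> (skel_of \<pi>) (arity \<pi>))"
  proof (induction \<pi>)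
    case (Dl a)
    then show ?case using rl[of a "skel_of a" "arity a - 1"] by auto
  qed (auto intro: sneu_snf.intros simp del: One_nat_def)
  show "sneu \<pi> p i \<longleftrightarrow> neu \<pi> \<and> p = skel_of \<pi> \<and> i = arity \<pi>"
    "snf \<pi> p i \<longleftrightarrow> nrm \<pi> \<and> p = skel_of \<pi> \<and> i = arity \<pi>"
    using 1 2 by blast+
qed

text \<open>A neutral skeleton is never an abstraction, so the skeleton tells whether a normal
  derivation ends with (s) or (l). Colorings are therefore unique.\<close>

lemma skel_of_inj:
  "(neu p \<and> neu q \<and> skel_of p = skel_of q \<longrightarrow> p = q) \<and> (nrm p \<and> nrm q \<and> skel_of p = skel_of q \<longrightarrow> p = q)"
proof (induction p arbitrary: q)
  case Dv
  show ?case by (cases q) auto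
next
  case (Da a b)
  then show ?case by (cases q) auto
next
  case (Ds p)
  have "skel_of p \<noteq> SLam s" if "neu p" for s using that by (cases p) auto
  then show ?case using Ds by (cases q) auto
next
  case (Dl p)
  have "skel_of r \<noteq> SLam s" if "neu r" for s r using that by (cases r) auto
  then show ?case using Dl by (cases q) (auto, metis)
qed

fun skel_arity :: "skel \<Rightarrow> nat" where
  "skel_arity SVar = 1"
| "skel_arity (SApp p q) = skel_arity p + skel_arity q"
| "skel_arity (SLam p) = skel_arity p - 1"

fun term_skel :: "lterm \<Rightarrow> skel" where
  "term_skel (V x) = SVar"
| "term_skel (A t u) = SApp (term_skel t) (term_skel u)"
| "term_skel (L x t) = SLam (term_skel t)"

lemma arity_skel_of: "arity p = skel_arity (skel_of p)"
  by (induction p) auto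

lemma planar_facts:
  "planar G t p \<Longrightarrow> p = term_skel t \<and> fv t = set G \<and> distinct G \<and> length G = skel_arity p"
  by (induction rule: planar.induct) auto

lemma length_onh:
  "(neu \<pi> \<or> nrm \<pi>) \<Longrightarrow> planar G t (skel_of \<pi>) \<Longrightarrow> length (onh \<pi> t) = nhandles \<pi>"
proof (induction \<pi> arbitrary: G t)
  case Dv
  then show ?case by (auto elim: planar.cases)
next
  case (Da a b)
  from Da.prems(2) obtain G1 D1 u v where e: "t = A u v" "planar G1 u (skel_of a)" "planar D1 v (skel_of b)"
    by (auto elim: planar.cases)
  have "fv v = {} \<longleftrightarrow> arity b = 0"
    using planar_facts[OF e(3)] by (auto simp: arity_skel_of)
  then show ?case using Da.IH(1)[OF _ e(2)] Da.IH(2)[OF _ e(3)] Da.prems(1) e(1) by auto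
next
  case (Ds p)
  then show ?case by auto
next
  case (Dl p)
  from Dl.prems(2) obtain x u where e: "t = L x u" "planar (x # G) u (skel_of p)"
    by (auto elim: planar.cases)
  then show ?case using Dl.IH[OF _ e(2)] Dl.prems(1) by auto
qed

text \<open>An application splits the context at the arity of its function part; an abstraction may
  use any name outside the context.\<close>

lemma planar_exists:
  "slam p i \<Longrightarrow> length G = i \<Longrightarrow> distinct G \<Longrightarrow> \<exists>t. planar G t p"
proof (induction arbitrary: G rule: slam.induct)
  case 1
  then show ?case using pvar by (metis One_nat_def length_0_conv length_Suc_conv)
next
  case (2 p j q k)
  have "length (take j G) = j" "length (drop j G) = k" "distinct (take j G)" "distinct (drop j G)"
    using 2 by auto
  then obtain t u where "planar (take j G) t p" "planar (drop j G) u q" using 2 by blast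
  then show ?case using papp[of "take j G" t p "drop j G" u q] 2 by auto
next
  case (3 p i)
  obtain x where "x \<notin> set G" using ex_new_if_finite[OF infinite_UNIV_nat finite_set] by blast
  then have "length (x # G) = Suc i" "distinct (x # G)" using 3 by auto
  then show ?case using 3 plam by blast
qed

lemma coloring_slam: "neu p \<or> nrm p \<Longrightarrow> slam (skel_of p) (arity p)"
proof (induction p)
  case Dv
  show ?case unfolding skel_of.simps arity.simps by (rule slam.intros(1))
next
  case (Da a b)
  then have "slam (skel_of a) (arity a)" "slam (skel_of b) (arity b)" by simp_all
  then show ?case unfolding skel_of.simps arity.simps by (rule slam.intros(2))
next
  case (Dl p)
  then have "slam (skel_of p) (arity p)" "Suc (arity p - 1) = arity p" by simp_all
  then have "slam (skel_of p) (Suc (arity p - 1))" by (simp only:)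
  then show ?case unfolding skel_of.simps arity.simps by (rule slam.intros(3))
next
  case (Ds p)
  then have "slam (skel_of p) (arity p)" unfolding nrm.simps neu.simps by blast
  then show ?case unfolding skel_of.simps arity.simps .
qed

section \<open>Alpha-equivalence of planar terms\<close>

lemma rel_var_Cons: "rel_var (p # env) x y \<longleftrightarrow>
    (fst p = x \<and> snd p = y) \<or> (fst p \<noteq> x \<and> snd p \<noteq> y \<and> rel_var env x y)"
  by (cases p) auto

declare rel_var.simps(2) [simp del]

lemma rel_var_append: "rel_var e x y \<Longrightarrow> rel_var (e @ e') x y"
  by (induction e) (auto simp: rel_var_Cons)

lemma rel_var_append_fresh:
  "x \<notin> fst ` set e \<Longrightarrow> y \<notin> snd ` set e \<Longrightarrow> rel_var (e @ e') x y = rel_var e' x y"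
  by (induction e) (auto simp: rel_var_Cons)

lemma rel_var_swap: "rel_var (map (\<lambda>(x, y). (y, x)) e) y x = rel_var e x y"
  by (induction e) (auto simp: rel_var_Cons)

lemma rel_var_trans:
  "length G = length G' \<Longrightarrow> length G' = length G'' \<Longrightarrow>
    rel_var (zip G G') x y \<Longrightarrow> rel_var (zip G' G'') y z \<Longrightarrow> rel_var (zip G G'') x z"
  by (induction G G' G'' rule: list_induct3) (auto simp: rel_var_Cons)

text \<open>Only pairs of names that occur in the terms matter, so the correspondence for one part
  of a context may be enlarged by that of the other.\<close>

lemma aeq_mono:
  "aeq e t t' \<Longrightarrow> (\<And>x y. x \<in> fv t \<Longrightarrow> y \<in> fv t' \<Longrightarrow> rel_var e x y \<Longrightarrow> rel_var e' x y) \<Longrightarrow> aeq e' t t'"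
proof (induction arbitrary: e' rule: aeq.induct)
  case (1 env x y)
  then show ?case by (auto intro: aeq.intros)
next
  case (2 env t t' u u')
  then show ?case by (auto intro!: aeq.intros)
next
  case (3 x y env t t')
  show ?case
  proof (rule aeq.intros(3), rule 3(2))
    fix a b assume "a \<in> fv t" "b \<in> fv t'" "rel_var ((x, y) # env) a b"
    then show "rel_var ((x, y) # e') a b" using 3(3)[of a b] by (auto simp: rel_var_Cons)
  qed
qed

text \<open>Planarity fixes the order in which variables are used, so the skeleton determines the
  term up to renaming. In an application the names for the function part do not shadow those of the
  argument, the two contexts being disjoint.\<close>

lemma planar_aeq:
  "planar G t p \<Longrightarrow> planar G' t' p \<Longrightarrow> length G = length G' \<and> aeq (zip G G') t t'"
proof (induction arbitrary: G' t' rule: planar.induct)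
  case (pvar x)
  then show ?case by (auto elim!: planar.cases intro!: aeq.intros simp: rel_var_Cons)
next
  case (papp G t p D u q)
  from papp.prems obtain G1 D1 v w where e: "G' = G1 @ D1" "t' = A v w" "planar G1 v p" "planar D1 w q" "distinct (G1 @ D1)"
    by (auto elim: planar.cases)
  have l: "length G = length G1" "length D = length D1" and a: "aeq (zip G G1) t v" "aeq (zip D D1) u w"
    using papp.IH(1)[OF e(3)] papp.IH(2)[OF e(4)] by auto
  have z: "zip (G @ D) (G1 @ D1) = zip G G1 @ zip D D1" using l by simp
  have "aeq (zip G G1 @ zip D D1) t v" using aeq_mono[OF a(1)] rel_var_append by blast
  moreover have "aeq (zip G G1 @ zip D D1) u w"
  proof (rule aeq_mono[OF a(2)])
    fix x y assume "x \<in> fv u" "y \<in> fv w" and r: "rel_var (zip D D1) x y"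
    then have "x \<notin> set G" "y \<notin> set G1"
      using planar_facts[OF papp.hyps(2)] planar_facts[OF e(4)] papp.hyps(3) e(5) by auto
    then have "x \<notin> fst ` set (zip G G1)" "y \<notin> snd ` set (zip G G1)"
      by (auto dest: set_zip_leftD set_zip_rightD)
    then show "rel_var (zip G G1 @ zip D D1) x y" using rel_var_append_fresh r by simp
  qed
  ultimately show ?case using l z e(1,2) by (auto intro: aeq.intros)
next
  case (plam x G t p)
  from plam.prems obtain y v where e: "t' = L y v" "planar (y # G') v p"
    by (auto elim: planar.cases)
  show ?case using plam.IH[OF e(2)] e(1) by (auto intro: aeq.intros)
qed

lemma aeq_skel: "aeq e t t' \<Longrightarrow> term_skel t = term_skel t'"
  by (induction rule: aeq.induct) auto

lemma aeq_swap: "aeq e t t' \<Longrightarrow> aeq (map (\<lambda>(x, y). (y, x)) e) t' t"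
  by (induction rule: aeq.induct) (auto intro: aeq.intros simp: rel_var_swap)

text \<open>Correspondences are written as zips so that both share the middle list of names; each
  binder extends all three lists.\<close>

lemma aeq_trans:
  "aeq e t t' \<Longrightarrow> e = zip G G' \<Longrightarrow> length G = length G' \<Longrightarrow> length G' = length G'' \<Longrightarrow>
    aeq (zip G' G'') t' t'' \<Longrightarrow> aeq (zip G G'') t t''"
proof (induction arbitrary: G G' G'' t'' rule: aeq.induct)
  case (1 env x y)
  from 1(5) obtain z where "t'' = V z" "rel_var (zip G' G'') y z" by (auto elim: aeq.cases)
  then show ?case using rel_var_trans[OF 1(3,4)] 1(1,2) by (auto intro: aeq.intros)
next
  case (2 env t t' u u')
  from 2(8) obtain v w where "t'' = A v w" "aeq (zip G' G'') t' v" "aeq (zip G' G'') u' w"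
    by (auto elim: aeq.cases)
  then show ?case using 2 by (auto intro!: aeq.intros)
next
  case (3 x y env t t')
  from 3(6) obtain z v where e: "t'' = L z v" "aeq (zip (y # G') (z # G'')) t' v"
    by (auto elim: aeq.cases)
  have "aeq (zip (x # G) (z # G'')) t v"
    using 3(2)[of "x # G" "y # G'" "z # G''" v] 3(3-5) e(2) by simp
  then show ?case using e(1) by (auto intro: aeq.intros)
qed

lemma term_renaming_equiv: "sym term_renaming" "trans term_renaming"
proof -
  show "sym term_renaming"
  proof (rule symI)
    fix x y assume "(x, y) \<in> term_renaming"
    then obtain G t G' t' where e: "x = (G, t)" "y = (G', t')" "length G = length G'" "aeq (zip G G') t t'"
      unfolding term_renaming_def by auto
    have "zip G' G = map (\<lambda>(x, y). (y, x)) (zip G G')" by (rule zip_commute)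
    then have "aeq (zip G' G) t' t" using aeq_swap[OF e(4)] by simp
    then show "(y, x) \<in> term_renaming" unfolding term_renaming_def using e by simp
  qed
  show "trans term_renaming"
  proof (rule transI)
    fix x y z assume "(x, y) \<in> term_renaming" "(y, z) \<in> term_renaming"
    then obtain G t G' t' G'' t'' where e: "x = (G, t)" "y = (G', t')" "z = (G'', t'')" "length G = length G'"
      "length G' = length G''" "aeq (zip G G') t t'" "aeq (zip G' G'') t' t''"
      unfolding term_renaming_def by auto
    then have "aeq (zip G G'') t t''" using aeq_trans[OF e(6) refl e(4,5)] by blast
    then show "(x, z) \<in> term_renaming" unfolding term_renaming_def using e by simp
  qed
qed

lemma npts_trees: "\<exists>f. bij_betw f (npts n d) (trees n d)"
proof -
  let ?S = "{(G, t). \<exists>x p \<pi>. G = [x] \<and> planar [x] t p \<and> snf \<pi> p 1 \<and> uses_s \<pi> = n + 1 \<and> length (onh \<pi> t) = d + 1}"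
  \<comment> \<open>Since colorings are unique, the skeleton of the term alone determines the
    tree.\<close>
  define g where "g = (\<lambda>(G :: nat list, t). THE tr. twf tr \<and> skel_of (tree_deriv tr) = term_skel t)"
  have uniq: "tr = tr'" if "twf tr" "twf tr'" "skel_of (tree_deriv tr) = skel_of (tree_deriv tr')" for tr tr'
    using tree_deriv_inj[OF that(1,2)] skel_of_inj[of "tree_deriv tr" "tree_deriv tr'"]
      tree_deriv_props[OF that(1)] tree_deriv_props[OF that(2)] that(3) by blast
  have g: "twf tr \<and> skel_of (tree_deriv tr) = term_skel t \<longleftrightarrow> g (G, t) = tr"
    and gT: "g (G, t) \<in> trees n d" and pl: "planar G t (term_skel t)"
    if m: "(G, t) \<in> ?S" for G t tr
  proof -
    obtain x p \<pi> where e: "G = [x]" "planar [x] t p" "snf \<pi> p 1" "uses_s \<pi> = n + 1" "length (onh \<pi> t) = d + 1"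
      using m by auto
    have p: "p = term_skel t" using planar_facts[OF e(2)] by blast
    then show "planar G t (term_skel t)" using e(1,2) by simp
    have \<pi>: "nrm \<pi>" "p = skel_of \<pi>" "arity \<pi> = 1" using e(3) coloring_iff(2) by auto
    obtain tr0 where t0: "twf tr0" "tree_deriv tr0 = \<pi>" using tree_deriv_surj \<pi> by blast
    have g0: "g (G, t) = tr0"
      unfolding g_def prod.case by (rule the_equality) (use t0 \<pi> p uniq in auto)
    then show "twf tr \<and> skel_of (tree_deriv tr) = term_skel t \<longleftrightarrow> g (G, t) = tr"
      using t0 \<pi> p uniq by metis
    have "length (onh \<pi> t) = nhandles \<pi>" using length_onh \<pi> e(2) by blast
    then show "g (G, t) \<in> trees n d"
      unfolding g0 trees_def using tree_deriv_props[OF t0(1)] t0 e(4,5) by simp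
  qed
  have "\<exists>f. bij_betw f (?S // term_renaming) (trees n d)"
  proof (rule quotient_bij[where g = g, OF term_renaming_equiv])
    have planar_iso: "(x, y) \<in> term_renaming \<longleftrightarrow> g x = g y" if x: "x \<in> ?S" and y: "y \<in> ?S" for x y
    proof -
      obtain G t G' t' where e: "x = (G, t)" "y = (G', t')" by (metis surj_pair)
      note gx = g[OF x[unfolded e]] and gy = g[OF y[unfolded e]]
      have tx: "skel_of (tree_deriv (g x)) = term_skel t" and ty: "skel_of (tree_deriv (g y)) = term_skel t'"
        unfolding e using gx gy by blast+
      have ptx: "planar G t (term_skel t)" and pty: "planar G' t' (term_skel t')"
        using pl[OF x[unfolded e]] pl[OF y[unfolded e]] .
      show ?thesis
      proof
        assume "(x, y) \<in> term_renaming"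
        then have "aeq (zip G G') t t'" unfolding e term_renaming_def by simp
        then have eq: "term_skel t = term_skel t'" by (rule aeq_skel)
        have "twf (g x) \<and> skel_of (tree_deriv (g x)) = term_skel t'" unfolding eq[symmetric] e using gx by blast
        then show "g x = g y" unfolding e using gy by metis
      next
        assume "g x = g y"
        then have "term_skel t = term_skel t'" using tx ty by simp
        then show "(x, y) \<in> term_renaming"
          using planar_aeq[OF ptx] pty unfolding e term_renaming_def by simp
      qed
    qed
    then show "(x, y) \<in> term_renaming \<longleftrightarrow> g x = g y" if "x \<in> ?S" "y \<in> ?S" for x y using that by blast
    \<comment> \<open>Reflexivity holds here by \<open>planar_aeq\<close>, applied to a planar term
      and itself.\<close>
    show "(x, x) \<in> term_renaming" if "x \<in> ?S" for x using planar_iso[OF that that] by blast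
    show "g ` ?S = trees n d"
    proof
      show "g ` ?S \<subseteq> trees n d"
      proof
        fix tr assume "tr \<in> g ` ?S"
        then obtain z where "z \<in> ?S" "tr = g z" by (rule imageE)
        then show "tr \<in> trees n d" using gT[of "fst z" "snd z"] by (simp only: prod.collapse)
      qed
      show "trees n d \<subseteq> g ` ?S"
      proof
        fix tr assume "tr \<in> trees n d"
        then have tr: "twf tr" "tedges tr = n" "tdeg tr = d" unfolding trees_def by auto
        define \<pi> where "\<pi> = tree_deriv tr"
        have \<pi>: "nrm \<pi>" "arity \<pi> = 1" "uses_s \<pi> = n + 1" "nhandles \<pi> = d + 1"
          using tree_deriv_props[OF tr(1)] tr(2,3) unfolding \<pi>_def by auto
        have s: "snf \<pi> (skel_of \<pi>) 1" using coloring_iff(2) \<pi> by simp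
        have "slam (skel_of \<pi>) 1" using coloring_slam[of \<pi>] \<pi> by simp
        then obtain t where t: "planar [0] t (skel_of \<pi>)" using planar_exists[of "skel_of \<pi>" 1 "[0]"] by auto
        have "length (onh \<pi> t) = d + 1" using length_onh[OF _ t] \<pi> by simp
        then have "[0] = [0::nat] \<and> planar [0] t (skel_of \<pi>) \<and> snf \<pi> (skel_of \<pi>) 1 \<and>
            uses_s \<pi> = n + 1 \<and> length (onh \<pi> t) = d + 1"
          using t s \<pi>(3) by blast
        then have m: "([0], t) \<in> ?S" unfolding mem_Collect_eq prod.case by (intro exI)
        have "twf tr \<and> skel_of (tree_deriv tr) = term_skel t"
          using tr(1) planar_facts[OF t] unfolding \<pi>_def by blast
        then have "tr = g ([0], t)" unfolding g[OF m] by (rule sym)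
        then show "tr \<in> g ` ?S" using m by (rule image_eqI)
      qed
    qed
  qed
  then show ?thesis unfolding npts_def .
qed

theorem theorem4p13:
  fixes n d :: nat
  shows "\<exists>f. bij_betw f (rooted_maps n d) (npts n d)"
proof -
  obtain f g where "bij_betw f (rooted_maps n d) (trees n d)" "bij_betw g (npts n d) (trees n d)"
    using rooted_maps_trees npts_trees by meson
  then show ?thesis using bij_betw_trans bij_betw_inv_into by blast
qed

end
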